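(* For any $\epsilon > 0$ and any $p \ge 1$, there is an $\epsilon$-tester for submodularity in the $\ell_p$ testing model with query complexity $2^{\tilde{O}(1/\epsilon^{\max\{2,p\}})}$ (in particular, independent of $n$).
   Context: For $n \ge 1$, let $\mathcal{F}_n$ be the set of functions $f:\{0,1\}^n \to [0,1]$. A function $f \in \mathcal{F}_n$ is submodular if $f(x)+f(y) \ge f(x\wedge y) + f(x \vee y)$ for all $x,y\in\{0,1\}^n$, where $\wedge,\vee$ are bitwise AND and OR; submodularity denotes the set of submodular functions in $\mathcal{F}_n$. For $p \ge 1$, the $\ell_p$ distance between $f,g\in\mathcal{F}_n$ is $\mathrm{dist}_p(f,g) = (\mathbb{E}_x[|f(x)-g(x)|^p])^{1/p}$ with $x$ uniform on $\{0,1\}^n$, and for a property $\mathcal{P}\subseteq \mathcal{F}_n$, $\mathrm{dist}_p(f,\mathcal{P}) = \inf_{g\in\mathcal{P}} \mathrm{dist}_p(f,g)$. An $\epsilon$-tester for $\mathcal{P}$ in the $\ell_p$ testing model is a randomized algorithm with oracle (query) access to $f$ that accepts every $f\in\mathcal{P}$ with probability at least $2/3$ and rejects every $f$ with $\mathrm{dist}_p(f,\mathcal{P}) \ge \epsilon$ with probability at least $2/3$; its query complexity is the number of oracle queries it makes. The notation $\tilde{O}(\cdot)$ hides polylogarithmic factors in $1/\epsilon$. *)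

theory Defs
  imports "HOL-Probability.Probability"
begin

(* On functions into bool, inf and sup are the pointwise conjunction and disjunction, so for
   points of the cube they are bitwise AND and OR.  The cube is closed under both: outside
   {..<n} all points take the same value, and inf and sup are idempotent. *)
definition cube :: "nat \<Rightarrow> (nat \<Rightarrow> bool) set" where
  "cube n = {..<n} \<rightarrow>\<^sub>E UNIV"

definition bounded_functions :: "nat \<Rightarrow> ((nat \<Rightarrow> bool) \<Rightarrow> real) set" where
  "bounded_functions n = cube n \<rightarrow>\<^sub>E {0..1}"

definition submodularity :: "nat \<Rightarrow> ((nat \<Rightarrow> bool) \<Rightarrow> real) set" where
  "submodularity n =
     {f \<in> bounded_functions n.
        \<forall>x\<in>cube n. \<forall>y\<in>cube n. f x + f y \<ge> f (inf x y) + f (sup x y)}"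

definition lp_dist :: "nat \<Rightarrow> real \<Rightarrow> ((nat \<Rightarrow> bool) \<Rightarrow> real) \<Rightarrow> ((nat \<Rightarrow> bool) \<Rightarrow> real) \<Rightarrow> real" where
  "lp_dist n p f g =
     (measure_pmf.expectation (pmf_of_set (cube n)) (\<lambda>x. \<bar>f x - g x\<bar> powr p)) powr (1 / p)"

(* A real infimum, hence meaningful only for nonempty P. *)
definition lp_dist_to ::
  "nat \<Rightarrow> real \<Rightarrow> ((nat \<Rightarrow> bool) \<Rightarrow> real) \<Rightarrow> ((nat \<Rightarrow> bool) \<Rightarrow> real) set \<Rightarrow> real" where
  "lp_dist_to n p f P = (INF g\<in>P. lp_dist n p f g)"

(* Deterministic adaptive query algorithms: the continuation receives the real number returned
   by the oracle.  A randomized algorithm is a probability distribution over these, that is,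
   its random bits are drawn before the first query. *)
datatype (queries: 'x) query_alg =
    Answer bool
  | Query 'x "real \<Rightarrow> 'x query_alg"

primrec accepts :: "('x \<Rightarrow> real) \<Rightarrow> 'x query_alg \<Rightarrow> bool" where
  "accepts f (Answer b) = b"
| "accepts f (Query x k) = accepts f (k (f x))"

primrec num_queries :: "('x \<Rightarrow> real) \<Rightarrow> 'x query_alg \<Rightarrow> nat" where
  "num_queries f (Answer b) = 0"
| "num_queries f (Query x k) = Suc (num_queries f (k (f x)))"

definition lp_tester ::
  "nat \<Rightarrow> real \<Rightarrow> real \<Rightarrow> ((nat \<Rightarrow> bool) \<Rightarrow> real) set \<Rightarrow> (nat \<Rightarrow> bool) query_alg pmf \<Rightarrow> bool" where
  "lp_tester n p \<epsilon> P T \<longleftrightarrow>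
     (\<forall>t\<in>set_pmf T. queries t \<subseteq> cube n) \<and>
     (\<forall>f\<in>P. measure_pmf.prob T {t. accepts f t} \<ge> 2 / 3) \<and>
     (\<forall>f\<in>bounded_functions n. lp_dist_to n p f P \<ge> \<epsilon> \<longrightarrow>
        measure_pmf.prob T {t. \<not> accepts f t} \<ge> 2 / 3)"

(* Worst case over the input function and over the random bits. *)
definition query_complexity_at_most ::
  "nat \<Rightarrow> (nat \<Rightarrow> bool) query_alg pmf \<Rightarrow> real \<Rightarrow> bool" where
  "query_complexity_at_most n T q \<longleftrightarrow>
     (\<forall>f\<in>bounded_functions n. \<forall>t\<in>set_pmf T. real (num_queries f t) \<le> q)"

(* An upper bound of the form O~(m) is a bound by soft_O_bound C K m for constants C and K.
   The 2 keeps the logarithm bounded away from 0 for small m. *)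
definition soft_O_bound :: "real \<Rightarrow> nat \<Rightarrow> real \<Rightarrow> real" where
  "soft_O_bound C K m = C * m * ln (2 + m) ^ K"

end

(* By Young's inequality, being epsilon-far in l_p implies squared l_2 distance at least
   delta = epsilon^(max 2 p) from every submodular function, so it suffices to test in l_2^2.

   A submodular f : {0,1}^n -> [0,1] is tau-close to a k-junta with k = O((1/tau) log (1/tau)):
   adding a coordinate j to J raises the expectation of max {f A | A <= X}, X a q-biased subset
   of J, by q times the mean positive marginal of j, so greedy selection stops after 1/(q alpha)
   steps.  For the remaining j the event that the marginal on J exceeds alpha is a down-set of
   q-biased measure at most 1/2; writing a uniform set as a union of about log (1/tau) q-biased
   sets makes this event negligible, and what is left has total squared influence O(alpha).

   The test partitions the coordinates into poly(1/delta) classes pi and splits each class in two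
   by a random set B.  First it searches for a union U of at most k half-classes such that f is
   insensitive to rerandomizing the complement of U together with a little noise on U.  The noise
   forces f to have little weight on high frequencies, hence few influential coordinates; the
   others contribute little to U because the partition spreads them out, so f is close to a junta
   on boundedly many coordinates, which the partition separates.  Then it reads f on the points
   that are constant on each half-class (complementary on the two halves of a class, which makes
   such a point uniformly distributed) for all 2^k assignments to the chosen half-classes, and
   asks whether the resulting table is close to a submodular function of k variables. *)

theory Submission
  imports Defs
begin

section \<open>Biased expectations over subsets\<close>

lemma sum_Pow_insert:
  assumes "finite N" "a \<notin> N"
  shows "(\<Sum>X\<in>Pow (insert a N). g X) = (\<Sum>X\<in>Pow N. g X) + (\<Sum>X\<in>Pow N. g (insert a X))"
proof -
  have "inj_on (insert a) (Pow N)" "Pow N \<inter> insert a ` Pow N = {}"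
    using assms by (auto simp: inj_on_def)
  then show ?thesis
    using assms by (simp add: Pow_insert sum.union_disjoint sum.reindex)
qed

definition bexp :: "real \<Rightarrow> 'a set \<Rightarrow> ('a set \<Rightarrow> real) \<Rightarrow> real" where
  "bexp p N F = (\<Sum>X\<in>Pow N. p ^ card X * (1 - p) ^ card (N - X) * F X)"

lemma bexp_empty [simp]: "bexp p {} F = F {}"
  by (simp add: bexp_def)

lemma bexp_insert:
  assumes "finite N" "a \<notin> N"
  shows "bexp p (insert a N) F = p * bexp p N (\<lambda>X. F (insert a X)) + (1 - p) * bexp p N F"
proof -
  have "bexp p (insert a N) F =
      (\<Sum>X\<in>Pow N. p ^ card X * (1 - p) ^ card (insert a N - X) * F X) +
      (\<Sum>X\<in>Pow N. p ^ card (insert a X) * (1 - p) ^ card (insert a N - insert a X) * F (insert a X))"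
    unfolding bexp_def by (rule sum_Pow_insert[OF assms])
  also have "(\<Sum>X\<in>Pow N. p ^ card X * (1 - p) ^ card (insert a N - X) * F X) = (1 - p) * bexp p N F"
    unfolding bexp_def sum_distrib_left
  proof (intro sum.cong refl)
    fix X assume X: "X \<in> Pow N"
    then have "insert a N - X = insert a (N - X)" using assms by auto
    then show "p ^ card X * (1 - p) ^ card (insert a N - X) * F X
        = (1 - p) * (p ^ card X * (1 - p) ^ card (N - X) * F X)"
      using assms by simp
  qed
  also have "(\<Sum>X\<in>Pow N. p ^ card (insert a X) * (1 - p) ^ card (insert a N - insert a X) * F (insert a X))
      = p * bexp p N (\<lambda>X. F (insert a X))"
    unfolding bexp_def sum_distrib_left
  proof (intro sum.cong refl)
    fix X assume X: "X \<in> Pow N"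
    then have "insert a N - insert a X = N - X" "finite X" "a \<notin> X"
      using assms by (auto intro: finite_subset)
    then show "p ^ card (insert a X) * (1 - p) ^ card (insert a N - insert a X) * F (insert a X)
        = p * (p ^ card X * (1 - p) ^ card (N - X) * F (insert a X))"
      by simp
  qed
  finally show ?thesis by simp
qed

lemma bexp_cong:
  assumes "\<And>X. X \<subseteq> N \<Longrightarrow> F X = G X"
  shows "bexp p N F = bexp p N G"
  unfolding bexp_def using assms by (intro sum.cong) auto

lemma bexp_mono:
  assumes "0 \<le> p" "p \<le> 1" "\<And>X. X \<subseteq> N \<Longrightarrow> F X \<le> G X"
  shows "bexp p N F \<le> bexp p N G"
  unfolding bexp_def using assms by (intro sum_mono mult_left_mono) auto

lemma bexp_nonneg:
  assumes "0 \<le> p" "p \<le> 1" "\<And>X. X \<subseteq> N \<Longrightarrow> 0 \<le> F X"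
  shows "0 \<le> bexp p N F"
  unfolding bexp_def using assms by (intro sum_nonneg) auto

lemma bexp_add: "bexp p N (\<lambda>X. F X + G X) = bexp p N F + bexp p N G"
  by (simp add: bexp_def algebra_simps sum.distrib)

lemma bexp_diff: "bexp p N (\<lambda>X. F X - G X) = bexp p N F - bexp p N G"
  by (simp add: bexp_def algebra_simps sum_subtractf)

lemma bexp_cmult: "bexp p N (\<lambda>X. c * F X) = c * bexp p N F"
  by (simp add: bexp_def sum_distrib_left algebra_simps)

lemma bexp_multc: "bexp p N (\<lambda>X. F X * c) = bexp p N F * c"
  using bexp_cmult[of p N c F] by (simp add: mult.commute)

lemma bexp_minus: "bexp p N (\<lambda>X. - F X) = - bexp p N F"
  using bexp_cmult[of p N "-1" F] by simp

lemma bexp_sum: "bexp p N (\<lambda>X. \<Sum>i\<in>A. F i X) = (\<Sum>i\<in>A. bexp p N (F i))"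
  unfolding bexp_def sum_distrib_left by (rule sum.swap)

lemma bexp_swap: "bexp p N (\<lambda>X. bexp q M (F X)) = bexp q M (\<lambda>Y. bexp p N (\<lambda>X. F X Y))"
proof -
  have "bexp p N (\<lambda>X. bexp q M (F X)) = (\<Sum>X\<in>Pow N. \<Sum>Y\<in>Pow M.
      p ^ card X * (1 - p) ^ card (N - X) * (q ^ card Y * (1 - q) ^ card (M - Y) * F X Y))"
    by (simp add: bexp_def sum_distrib_left)
  also have "\<dots> = (\<Sum>Y\<in>Pow M. \<Sum>X\<in>Pow N.
      p ^ card X * (1 - p) ^ card (N - X) * (q ^ card Y * (1 - q) ^ card (M - Y) * F X Y))"
    by (rule sum.swap)
  also have "\<dots> = bexp q M (\<lambda>Y. bexp p N (\<lambda>X. F X Y))"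
    by (simp add: bexp_def sum_distrib_left algebra_simps)
  finally show ?thesis .
qed

lemma bexp_const [simp]: "finite N \<Longrightarrow> bexp p N (\<lambda>_. c) = c"
  by (induction N rule: finite_induct) (simp_all add: bexp_insert algebra_simps)

lemma bexp_Un:
  assumes "finite A" "finite B" "A \<inter> B = {}"
  shows "bexp p (A \<union> B) F = bexp p A (\<lambda>X. bexp p B (\<lambda>Y. F (X \<union> Y)))"
  using assms
proof (induction A arbitrary: F rule: finite_induct)
  case empty
  then show ?case by simp
next
  case (insert a A)
  then have "a \<notin> A \<union> B" "finite (A \<union> B)" "A \<inter> B = {}" by auto
  then show ?case using insert by (simp add: bexp_insert)
qed

lemma bexp_split:
  assumes "finite N" "J \<subseteq> N"
  shows "bexp p N F = bexp p J (\<lambda>X. bexp p (N - J) (\<lambda>Y. F (X \<union> Y)))"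
  using bexp_Un[of J "N - J" p F] assms finite_subset[OF assms(2,1)]
  by (simp add: Un_absorb1)

lemma bexp_inter:
  assumes "finite N" "J \<subseteq> N"
  shows "bexp p N (\<lambda>X. F (X \<inter> J)) = bexp p J F"
proof -
  have "bexp p N (\<lambda>X. F (X \<inter> J)) = bexp p J (\<lambda>X. bexp p (N - J) (\<lambda>Y. F ((X \<union> Y) \<inter> J)))"
    by (rule bexp_split[OF assms])
  also have "\<dots> = bexp p J (\<lambda>X. bexp p (N - J) (\<lambda>Y. F X))"
  proof (intro bexp_cong)
    fix X Y assume "X \<subseteq> J" "Y \<subseteq> N - J"
    then have "(X \<union> Y) \<inter> J = X" by auto
    then show "F ((X \<union> Y) \<inter> J) = F X" by simp
  qed
  also have "\<dots> = bexp p J F" using assms by simp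
  finally show ?thesis .
qed

lemma bexp_union_indep:
  assumes "finite N"
  shows "bexp p N (\<lambda>X. bexp q N (\<lambda>Y. F (X \<union> Y))) = bexp (p + q - p * q) N F"
  using assms
proof (induction N arbitrary: F rule: finite_induct)
  case empty
  then show ?case by simp
next
  case (insert a N)
  have "bexp p (insert a N) (\<lambda>X. bexp q (insert a N) (\<lambda>Y. F (X \<union> Y))) =
     p * bexp p N (\<lambda>X. bexp q N (\<lambda>Y. F (insert a (X \<union> Y)))) +
     (1 - p) * (q * bexp p N (\<lambda>X. bexp q N (\<lambda>Y. F (insert a (X \<union> Y)))) +
      (1 - q) * bexp p N (\<lambda>X. bexp q N (\<lambda>Y. F (X \<union> Y))))"
    using insert(1,2) by (simp add: bexp_insert bexp_add bexp_cmult) (simp add: algebra_simps)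
  also have "\<dots> = (p + q - p * q) * bexp (p + q - p * q) N (\<lambda>X. F (insert a X)) +
       (1 - (p + q - p * q)) * bexp (p + q - p * q) N F"
    unfolding insert.IH[of F] insert.IH[of "\<lambda>X. F (insert a X)"] by (simp add: algebra_simps)
  also have "\<dots> = bexp (p + q - p * q) (insert a N) F"
    using insert(1,2) by (simp add: bexp_insert)
  finally show ?case .
qed

lemma bexp_superset:
  assumes "finite N" "T \<subseteq> N"
  shows "bexp p N (\<lambda>X. of_bool (T \<subseteq> X)) = p ^ card T"
proof -
  have "bexp p N (\<lambda>X. of_bool (T \<subseteq> X)) = bexp p N (\<lambda>X. (\<lambda>Y. of_bool (Y = T)) (X \<inter> T))"
    by (rule bexp_cong) auto
  also have "\<dots> = bexp p T (\<lambda>Y. of_bool (Y = T))"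
    by (rule bexp_inter[OF assms])
  also have "\<dots> = (\<Sum>X\<in>Pow T. if X = T then p ^ card T else 0)"
    unfolding bexp_def by (intro sum.cong refl) auto
  also have "\<dots> = p ^ card T"
    using assms by (simp add: finite_subset)
  finally show ?thesis .
qed

lemma bexp_half:
  assumes "finite N"
  shows "bexp (1/2) N F = (\<Sum>X\<in>Pow N. F X) / 2 ^ card N"
proof -
  have "(1/2::real) ^ card X * (1 - 1/2) ^ card (N - X) = 1 / 2 ^ card N" if "X \<subseteq> N" for X
  proof -
    have "card N = card X + card (N - X)"
      using that assms by (metis card_Diff_subset card_mono finite_subset le_add_diff_inverse)
    then show ?thesis by (simp add: power_add field_simps)
  qed
  then have "bexp (1/2) N F = (\<Sum>X\<in>Pow N. (1 / 2 ^ card N) * F X)"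
    unfolding bexp_def by (intro sum.cong refl) auto
  then show ?thesis by (simp add: sum_divide_distrib)
qed

lemma bexp_half_bij:
  assumes "finite N" "finite M" "bij_betw g (Pow N) (Pow M)"
  shows "bexp (1/2) N (\<lambda>X. F (g X)) = bexp (1/2) M F"
proof -
  have "card (Pow N) = card (Pow M)" using assms by (metis bij_betw_same_card)
  then have "(2::nat) ^ card N = 2 ^ card M" using assms by (simp add: card_Pow)
  then have c: "(2::real) ^ card N = 2 ^ card M"
    by (metis of_nat_numeral of_nat_power)
  have "(\<Sum>X\<in>Pow N. F (g X)) = (\<Sum>X\<in>Pow M. F X)"
    by (rule sum.reindex_bij_betw[OF assms(3)])
  then show ?thesis using assms c by (simp add: bexp_half)
qed

lemma bexp_half_image:
  assumes "finite N" "inj_on g N"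
  shows "bexp (1/2) N (\<lambda>X. F (g ` X)) = bexp (1/2) (g ` N) F"
  using assms by (intro bexp_half_bij bij_betw_Pow) (auto simp: bij_betw_def)

lemma bexp_half_compl:
  assumes "finite N"
  shows "bexp (1/2) N (\<lambda>X. F (N - X)) = bexp (1/2) N F"
  using assms by (intro bexp_half_bij bij_betwI[where g = "\<lambda>X. N - X"]) auto

lemma bexp_square_le:
  assumes "finite N" "0 \<le> p" "p \<le> 1"
  shows "(bexp p N F)\<^sup>2 \<le> bexp p N (\<lambda>X. (F X)\<^sup>2)"
proof -
  have "0 \<le> bexp p N (\<lambda>X. (F X - bexp p N F)\<^sup>2)"
    using assms by (intro bexp_nonneg) auto
  also have "\<dots> = bexp p N (\<lambda>X. (F X)\<^sup>2 - 2 * bexp p N F * F X + (bexp p N F)\<^sup>2)"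
    by (intro bexp_cong) (simp add: power2_eq_square algebra_simps)
  also have "\<dots> = bexp p N (\<lambda>X. (F X)\<^sup>2) - 2 * bexp p N F * bexp p N F + (bexp p N F)\<^sup>2"
    using assms by (simp add: bexp_add bexp_diff bexp_cmult)
  finally show ?thesis by (simp add: power2_eq_square)
qed

section \<open>Fourier analysis on the cube\<close>

definition fourier :: "'a set \<Rightarrow> ('a set \<Rightarrow> real) \<Rightarrow> 'a set \<Rightarrow> real" where
  "fourier N f T = bexp (1/2) N (\<lambda>X. (-1) ^ card (T \<inter> X) * f X)"

lemma fourier_insert:
  assumes "finite N" "a \<notin> N" "T \<subseteq> N"
  shows "fourier (insert a N) f T = (fourier N f T + fourier N (\<lambda>X. f (insert a X)) T) / 2"
    and "fourier (insert a N) f (insert a T) = (fourier N f T - fourier N (\<lambda>X. f (insert a X)) T) / 2"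
proof -
  have aT: "a \<notin> T" using assms by auto
  have fin: "finite (T \<inter> X)" for X using assms finite_subset by blast
  have "fourier (insert a N) f T = 1/2 * fourier N (\<lambda>X. f (insert a X)) T + 1/2 * fourier N f T"
    using assms aT by (simp add: fourier_def bexp_insert)
  then show "fourier (insert a N) f T = (fourier N f T + fourier N (\<lambda>X. f (insert a X)) T) / 2"
    by simp
  have 1: "bexp (1/2) N (\<lambda>X. (-1) ^ card (insert a T \<inter> X) * f X) = fourier N f T"
    unfolding fourier_def
  proof (rule bexp_cong)
    fix X assume "X \<subseteq> N"
    then have "insert a T \<inter> X = T \<inter> X" using assms by auto
    then show "(-1) ^ card (insert a T \<inter> X) * f X = (-1) ^ card (T \<inter> X) * f X" by simp
  qed
  have 2: "bexp (1/2) N (\<lambda>X. (-1) ^ card (insert a T \<inter> insert a X) * f (insert a X))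
      = - fourier N (\<lambda>X. f (insert a X)) T"
    unfolding fourier_def bexp_minus[symmetric]
  proof (rule bexp_cong)
    fix X assume "X \<subseteq> N"
    have "insert a T \<inter> insert a X = insert a (T \<inter> X)" by auto
    then show "(-1) ^ card (insert a T \<inter> insert a X) * f (insert a X)
        = - ((-1) ^ card (T \<inter> X) * f (insert a X))"
      using fin[of X] aT by simp
  qed
  have "fourier (insert a N) f (insert a T)
     = 1/2 * bexp (1/2) N (\<lambda>X. (-1) ^ card (insert a T \<inter> insert a X) * f (insert a X))
      + (1 - 1/2) * bexp (1/2) N (\<lambda>X. (-1) ^ card (insert a T \<inter> X) * f X)"
    unfolding fourier_def using assms(1,2) by (rule bexp_insert)
  then show "fourier (insert a N) f (insert a T) = (fourier N f T - fourier N (\<lambda>X. f (insert a X)) T) / 2"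
    unfolding 1 2 by simp
qed

lemma plancherel:
  assumes "finite N"
  shows "bexp (1/2) N (\<lambda>X. f X * g X) = (\<Sum>T\<in>Pow N. fourier N f T * fourier N g T)"
  using assms
proof (induction N arbitrary: f g rule: finite_induct)
  case empty
  then show ?case by (simp add: fourier_def)
next
  case (insert a N)
  let ?N = "insert a N" and ?f = "\<lambda>X. f (insert a X)" and ?g = "\<lambda>X. g (insert a X)"
  have "(\<Sum>T\<in>Pow ?N. fourier ?N f T * fourier ?N g T)
     = (\<Sum>T\<in>Pow N. fourier ?N f T * fourier ?N g T
          + fourier ?N f (insert a T) * fourier ?N g (insert a T))"
    using insert(1,2) by (simp add: sum_Pow_insert sum.distrib)
  also have "\<dots> = (\<Sum>T\<in>Pow N. (fourier N f T * fourier N g T + fourier N ?f T * fourier N ?g T) / 2)"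
  proof (intro sum.cong refl)
    fix T assume "T \<in> Pow N"
    then have T: "T \<subseteq> N" by simp
    show "fourier ?N f T * fourier ?N g T + fourier ?N f (insert a T) * fourier ?N g (insert a T)
       = (fourier N f T * fourier N g T + fourier N ?f T * fourier N ?g T) / 2"
      unfolding fourier_insert[OF insert(1,2) T] by (simp add: field_simps)
  qed
  also have "\<dots> = (bexp (1/2) N (\<lambda>X. f X * g X) + bexp (1/2) N (\<lambda>X. ?f X * ?g X)) / 2"
    by (simp add: insert.IH sum.distrib flip: sum_divide_distrib)
  also have "\<dots> = bexp (1/2) ?N (\<lambda>X. f X * g X)"
    using insert(1,2) by (simp add: bexp_insert)
  finally show ?case ..
qed

lemma fourier_diff: "fourier N (\<lambda>X. f X - g X) T = fourier N f T - fourier N g T"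
  by (simp add: fourier_def right_diff_distrib bexp_diff)

definition weight :: "'a set \<Rightarrow> ('a set \<Rightarrow> real) \<Rightarrow> 'a set \<Rightarrow> real" where
  "weight N f T = (fourier N f T)\<^sup>2"

lemma weight_nonneg [simp]: "0 \<le> weight N f T"
  by (simp add: weight_def)

lemma parseval: "finite N \<Longrightarrow> bexp (1/2) N (\<lambda>X. (f X)\<^sup>2) = (\<Sum>T\<in>Pow N. weight N f T)"
  using plancherel[of N f f] by (simp add: power2_eq_square weight_def)

definition average_outside :: "'a set \<Rightarrow> 'a set \<Rightarrow> ('a set \<Rightarrow> real) \<Rightarrow> 'a set \<Rightarrow> real" where
  "average_outside N J f X = bexp (1/2) (N - J) (\<lambda>Z. f (X \<inter> J \<union> Z))"

lemma average_outside_inter: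
  "average_outside N J f (X \<inter> J') = average_outside N J f X" if "J \<subseteq> J'"
proof -
  have "X \<inter> J' \<inter> J = X \<inter> J" using that by auto
  then show ?thesis by (simp add: average_outside_def)
qed

lemma average_outside_all:
  "X \<subseteq> N \<Longrightarrow> average_outside N N f X = f X"
  by (simp add: average_outside_def Int_absorb2)

lemma average_outside_eq:
  assumes "finite N" "J \<subseteq> N" "X \<subseteq> N"
  shows "average_outside N J f X = bexp (1/2) N (\<lambda>Z. f (X \<inter> J \<union> (Z - J)))"
proof -
  have "bexp (1/2) N (\<lambda>Z. f (X \<inter> J \<union> (Z - J))) = bexp (1/2) N (\<lambda>Z. (\<lambda>Y. f (X \<inter> J \<union> Y)) (Z \<inter> (N - J)))"
    by (rule bexp_cong) (auto intro!: arg_cong[of _ _ f])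
  also have "\<dots> = bexp (1/2) (N - J) (\<lambda>Y. f (X \<inter> J \<union> Y))"
    by (rule bexp_inter) (use assms in auto)
  finally show ?thesis by (simp add: average_outside_def)
qed

lemma fourier_average_outside:
  assumes "finite N" "J \<subseteq> N" "T \<subseteq> N"
  shows "fourier N (average_outside N J f) T = of_bool (T \<subseteq> J) * fourier N f T"
proof (cases "T \<subseteq> J")
  case True
  have [simp]: "finite (N - J)" using assms by auto
  have "fourier N (average_outside N J f) T
     = bexp (1/2) N (\<lambda>X. (\<lambda>Y. (-1) ^ card (T \<inter> Y) * average_outside N J f Y) (X \<inter> J))"
    unfolding fourier_def
  proof (rule bexp_cong)
    fix X
    have "T \<inter> (X \<inter> J) = T \<inter> X" using True by auto
    then show "(-1) ^ card (T \<inter> X) * average_outside N J f X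
      = (-1) ^ card (T \<inter> (X \<inter> J)) * average_outside N J f (X \<inter> J)"
      by (simp add: average_outside_inter)
  qed
  also have "\<dots> = bexp (1/2) J (\<lambda>X. (-1) ^ card (T \<inter> X) * average_outside N J f X)"
    by (rule bexp_inter[OF assms(1,2)])
  also have "\<dots> = bexp (1/2) J (\<lambda>X. bexp (1/2) (N - J) (\<lambda>Z. (-1) ^ card (T \<inter> (X \<union> Z)) * f (X \<union> Z)))"
  proof (rule bexp_cong)
    fix X assume X: "X \<subseteq> J"
    have "(-1) ^ card (T \<inter> X) * average_outside N J f X
       = bexp (1/2) (N - J) (\<lambda>Z. (-1) ^ card (T \<inter> X) * f (X \<union> Z))"
      using X by (simp add: average_outside_def bexp_cmult Int_absorb2)
    also have "\<dots> = bexp (1/2) (N - J) (\<lambda>Z. (-1) ^ card (T \<inter> (X \<union> Z)) * f (X \<union> Z))"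
    proof (rule bexp_cong)
      fix Z assume "Z \<subseteq> N - J"
      then have "T \<inter> (X \<union> Z) = T \<inter> X" using True by auto
      then show "(-1) ^ card (T \<inter> X) * f (X \<union> Z) = (-1) ^ card (T \<inter> (X \<union> Z)) * f (X \<union> Z)" by simp
    qed
    finally show "(-1) ^ card (T \<inter> X) * average_outside N J f X
      = bexp (1/2) (N - J) (\<lambda>Z. (-1) ^ card (T \<inter> (X \<union> Z)) * f (X \<union> Z))" .
  qed
  also have "\<dots> = fourier N f T"
    unfolding fourier_def by (rule bexp_split[OF assms(1,2), symmetric])
  finally show ?thesis using True by simp
next
  case False
  then obtain j where j: "j \<in> T" "j \<notin> J" by auto
  define N' where "N' = N - {j}"
  have N: "N = insert j N'" "j \<notin> N'" "finite N'" using j assms by (auto simp: N'_def)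
  have finT: "finite T" using assms finite_subset by auto
  have eq: "average_outside N J f (insert j X) = average_outside N J f X" for X
    using j by (simp add: average_outside_def)
  have "fourier N (average_outside N J f) T
     = 1/2 * bexp (1/2) N' (\<lambda>X. (-1) ^ card (T \<inter> insert j X) * average_outside N J f (insert j X))
       + (1 - 1/2) * bexp (1/2) N' (\<lambda>X. (-1) ^ card (T \<inter> X) * average_outside N J f X)"
    unfolding fourier_def by (subst (1) N(1)) (rule bexp_insert[OF N(3,2)])
  also have "bexp (1/2) N' (\<lambda>X. (-1) ^ card (T \<inter> insert j X) * average_outside N J f (insert j X))
     = - bexp (1/2) N' (\<lambda>X. (-1) ^ card (T \<inter> X) * average_outside N J f X)"
    unfolding bexp_minus[symmetric]
  proof (rule bexp_cong)
    fix X assume "X \<subseteq> N'"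
    then have "T \<inter> insert j X = insert j (T \<inter> X)" "j \<notin> T \<inter> X" using j N by auto
    then show "(-1) ^ card (T \<inter> insert j X) * average_outside N J f (insert j X)
        = - ((-1) ^ card (T \<inter> X) * average_outside N J f X)"
      using finT by (simp add: eq)
  qed
  finally show ?thesis using False by simp
qed

lemma average_outside_dist:
  assumes "finite N" "J \<subseteq> N" "J' \<subseteq> J"
  shows "bexp (1/2) N (\<lambda>X. (average_outside N J f X - average_outside N J' f X)\<^sup>2)
     = (\<Sum>T\<in>Pow N. of_bool (T \<subseteq> J \<and> \<not> T \<subseteq> J') * weight N f T)"
proof -
  have "bexp (1/2) N (\<lambda>X. (average_outside N J f X - average_outside N J' f X)\<^sup>2)
     = (\<Sum>T\<in>Pow N. (fourier N (average_outside N J f) T - fourier N (average_outside N J' f) T)\<^sup>2)"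
    using parseval[OF assms(1), of "\<lambda>X. average_outside N J f X - average_outside N J' f X"]
    by (simp add: weight_def fourier_diff)
  also have "\<dots> = (\<Sum>T\<in>Pow N. of_bool (T \<subseteq> J \<and> \<not> T \<subseteq> J') * weight N f T)"
    using assms by (intro sum.cong refl) (auto simp: fourier_average_outside weight_def)
  finally show ?thesis .
qed

lemma average_outside_dist_self:
  assumes "finite N" "J \<subseteq> N"
  shows "bexp (1/2) N (\<lambda>X. (f X - average_outside N J f X)\<^sup>2)
     = (\<Sum>T\<in>Pow N. of_bool (\<not> T \<subseteq> J) * weight N f T)"
proof -
  have "bexp (1/2) N (\<lambda>X. (f X - average_outside N J f X)\<^sup>2)
     = bexp (1/2) N (\<lambda>X. (average_outside N N f X - average_outside N J f X)\<^sup>2)"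
    by (rule bexp_cong) (simp add: average_outside_all)
  also have "\<dots> = (\<Sum>T\<in>Pow N. of_bool (T \<subseteq> N \<and> \<not> T \<subseteq> J) * weight N f T)"
    by (rule average_outside_dist) (use assms in auto)
  also have "\<dots> = (\<Sum>T\<in>Pow N. of_bool (\<not> T \<subseteq> J) * weight N f T)"
    by (intro sum.cong) auto
  finally show ?thesis .
qed

lemma rerandomize_dist:
  assumes "finite N" "R \<subseteq> N"
  shows "bexp (1/2) N (\<lambda>X. bexp (1/2) N (\<lambda>Z. (f X - f (X \<inter> R \<union> (Z - R)))\<^sup>2))
     = 2 * (\<Sum>T\<in>Pow N. of_bool (\<not> T \<subseteq> R) * weight N f T)"
proof -
  let ?a = "average_outside N R f"
  have sq: "bexp (1/2) N (\<lambda>X. bexp (1/2) N (\<lambda>Z. (f (X \<inter> R \<union> (Z - R)))\<^sup>2)) = bexp (1/2) N (\<lambda>X. (f X)\<^sup>2)"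
  proof -
    have "bexp (1/2) N (\<lambda>X. bexp (1/2) N (\<lambda>Z. (f (X \<inter> R \<union> (Z - R)))\<^sup>2))
       = bexp (1/2) N (\<lambda>X. bexp (1/2) (N - R) (\<lambda>Z. (f (X \<inter> R \<union> Z))\<^sup>2))"
      using average_outside_eq[OF assms, where f = "\<lambda>X. (f X)\<^sup>2"]
      by (intro bexp_cong) (simp add: average_outside_def)
    also have "\<dots> = bexp (1/2) R (\<lambda>X. bexp (1/2) (N - R) (\<lambda>Z. (f (X \<union> Z))\<^sup>2))"
      by (rule bexp_inter[OF assms])
    also have "\<dots> = bexp (1/2) N (\<lambda>X. (f X)\<^sup>2)"
      by (rule bexp_split[OF assms, symmetric])
    finally show ?thesis .
  qed
  have "bexp (1/2) N (\<lambda>X. bexp (1/2) N (\<lambda>Z. (f X - f (X \<inter> R \<union> (Z - R)))\<^sup>2))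
     = bexp (1/2) N (\<lambda>X. bexp (1/2) N (\<lambda>Z. (f X)\<^sup>2 - 2 * f X * f (X \<inter> R \<union> (Z - R)) + (f (X \<inter> R \<union> (Z - R)))\<^sup>2))"
    by (intro bexp_cong) (simp add: power2_eq_square algebra_simps)
  also have "\<dots> = bexp (1/2) N (\<lambda>X. (f X)\<^sup>2 - 2 * f X * ?a X + bexp (1/2) N (\<lambda>Z. (f (X \<inter> R \<union> (Z - R)))\<^sup>2))"
    using assms by (intro bexp_cong) (simp add: bexp_add bexp_diff bexp_cmult average_outside_eq)
  also have "\<dots> = 2 * bexp (1/2) N (\<lambda>X. (f X)\<^sup>2) - 2 * bexp (1/2) N (\<lambda>X. f X * ?a X)"
    using sq by (simp add: bexp_add bexp_diff bexp_cmult mult.assoc)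
  also have "bexp (1/2) N (\<lambda>X. f X * ?a X) = (\<Sum>T\<in>Pow N. of_bool (T \<subseteq> R) * weight N f T)"
    unfolding plancherel[OF assms(1)] using assms
    by (intro sum.cong refl) (simp add: fourier_average_outside weight_def power2_eq_square)
  also have "bexp (1/2) N (\<lambda>X. (f X)\<^sup>2) = (\<Sum>T\<in>Pow N. weight N f T)"
    by (rule parseval[OF assms(1)])
  finally show ?thesis
    by (simp flip: right_diff_distrib sum_subtractf) (intro sum.cong; auto)
qed

lemma influence:
  assumes "finite N" "j \<in> N"
  shows "bexp (1/2) N (\<lambda>X. (f (insert j X) - f (X - {j}))\<^sup>2)
     = 4 * (\<Sum>T\<in>Pow N. of_bool (j \<in> T) * weight N f T)"
proof -
  define N' where "N' = N - {j}"
  have N: "N = insert j N'" "j \<notin> N'" "finite N'" using assms by (auto simp: N'_def)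
  have "(\<Sum>T\<in>Pow N. of_bool (j \<in> T) * weight N f T) = (\<Sum>T\<in>Pow N'. weight N f (insert j T))"
    unfolding N(1) sum_Pow_insert[OF N(3,2)] using N(2)
    by (auto intro!: sum.neutral)
  also have "\<dots> = (\<Sum>T\<in>Pow N'. ((fourier N' f T - fourier N' (\<lambda>X. f (insert j X)) T) / 2)\<^sup>2)"
    unfolding weight_def N(1)
    by (intro sum.cong refl) (simp only: Pow_iff fourier_insert(2)[OF N(3,2)])
  also have "\<dots> = (\<Sum>T\<in>Pow N'. weight N' (\<lambda>X. f X - f (insert j X)) T) / 4"
    by (simp add: weight_def fourier_diff power_divide flip: sum_divide_distrib)
  also have "\<dots> = bexp (1/2) N' (\<lambda>X. (f X - f (insert j X))\<^sup>2) / 4"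
    using parseval[OF N(3)] by simp
  also have "bexp (1/2) N' (\<lambda>X. (f X - f (insert j X))\<^sup>2)
      = bexp (1/2) N' (\<lambda>X. (f (insert j X) - f (X - {j}))\<^sup>2)"
  proof (rule bexp_cong)
    fix X assume "X \<subseteq> N'"
    then have "X - {j} = X" using N by auto
    then show "(f X - f (insert j X))\<^sup>2 = (f (insert j X) - f (X - {j}))\<^sup>2"
      by (simp add: power2_commute)
  qed
  also have "\<dots> = bexp (1/2) N (\<lambda>X. (f (insert j X) - f (X - {j}))\<^sup>2)"
  proof -
    have "bexp (1/2) N' (\<lambda>X. (f (insert j X) - f (insert j X - {j}))\<^sup>2)
      = bexp (1/2) N' (\<lambda>X. (f (insert j X) - f (X - {j}))\<^sup>2)"
      by (rule bexp_cong) simp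
    then show ?thesis unfolding N(1) by (simp add: bexp_insert[OF N(3,2)])
  qed
  finally show ?thesis by simp
qed

section \<open>Junta approximation of submodular functions\<close>

definition marginal :: "('a set \<Rightarrow> real) \<Rightarrow> 'a \<Rightarrow> 'a set \<Rightarrow> real" where
  "marginal f j X = f (insert j X) - f (X - {j})"

lemma bexp_iterated_union:
  assumes "finite N" "0 \<le> q" "q \<le> 1"
    and b: "\<And>X. X \<subseteq> N \<Longrightarrow> 0 \<le> b X"
    and H: "\<And>X Y. X \<subseteq> N \<Longrightarrow> Y \<subseteq> N \<Longrightarrow> H (X \<union> Y) \<le> b Y * H X"
  shows "bexp (1 - (1 - q) ^ Suc m) N H \<le> bexp q N b ^ m * bexp q N H"
proof (induction m)
  case 0
  then show ?case by simp
next
  case (Suc m)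
  define p where "p = 1 - (1 - q) ^ Suc m"
  have p: "0 \<le> p" "p \<le> 1"
    using assms by (auto simp: p_def power_le_one simp del: power_Suc)
  have "1 - (1 - q) ^ Suc (Suc m) = p + q - p * q"
    by (simp add: p_def algebra_simps)
  then have "bexp (1 - (1 - q) ^ Suc (Suc m)) N H = bexp p N (\<lambda>X. bexp q N (\<lambda>Y. H (X \<union> Y)))"
    using bexp_union_indep[OF assms(1)] by metis
  also have "\<dots> \<le> bexp p N (\<lambda>X. bexp q N (\<lambda>Y. b Y * H X))"
    using assms p H by (intro bexp_mono) auto
  also have "\<dots> = bexp q N b * bexp p N H"
    by (simp only: bexp_multc bexp_cmult)
  also have "\<dots> \<le> bexp q N b * (bexp q N b ^ m * bexp q N H)"
    using Suc assms by (intro mult_left_mono bexp_nonneg) (auto simp: p_def)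
  finally show ?case by simp
qed

locale submodular_function =
  fixes N :: "'a set" and f :: "'a set \<Rightarrow> real"
  assumes fin: "finite N"
    and nonneg: "X \<subseteq> N \<Longrightarrow> 0 \<le> f X"
    and le_one: "X \<subseteq> N \<Longrightarrow> f X \<le> 1"
    and submod: "X \<subseteq> N \<Longrightarrow> Y \<subseteq> N \<Longrightarrow> f (X \<inter> Y) + f (X \<union> Y) \<le> f X + f Y"
begin

lemma marginal_antimono:
  assumes "X \<subseteq> Y" "Y \<subseteq> N" "j \<in> N"
  shows "marginal f j Y \<le> marginal f j X"
proof -
  have "insert j X \<inter> (Y - {j}) = X - {j}" "insert j X \<union> (Y - {j}) = insert j Y"
    using assms by auto
  then show ?thesis
    using submod[of "insert j X" "Y - {j}"] subset_trans[OF assms(1,2)] assms(2,3)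
    by (simp add: marginal_def subset_insertI2 Diff_subset[THEN subset_trans])
qed

lemma marginal_le_one:
  assumes "X \<subseteq> N" "j \<in> N"
  shows "marginal f j X \<le> 1"
proof -
  have "X - {j} \<subseteq> N" "insert j X \<subseteq> N" using assms by auto
  then show ?thesis
    using nonneg[of "X - {j}"] le_one[of "insert j X"] by (simp add: marginal_def)
qed

definition best :: "'a set \<Rightarrow> real" where
  "best X = Max (f ` Pow X)"

lemma best_upper: "A \<subseteq> X \<Longrightarrow> X \<subseteq> N \<Longrightarrow> f A \<le> best X"
  using finite_subset[OF _ fin, of X] by (auto simp: best_def intro!: Max_ge)

lemma best_attained:
  assumes "X \<subseteq> N"
  obtains A where "A \<subseteq> X" "best X = f A"
proof -
  have "best X \<in> f ` Pow X"
    unfolding best_def using finite_subset[OF assms fin] by (intro Max_in) auto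
  then show ?thesis using that by auto
qed

lemma best_bounds:
  assumes "X \<subseteq> N"
  shows "0 \<le> best X" "best X \<le> 1"
proof -
  obtain A where "A \<subseteq> X" "best X = f A" using best_attained[OF assms] .
  then show "0 \<le> best X" "best X \<le> 1" using nonneg[of A] le_one[of A] assms by auto
qed

lemma best_insert:
  assumes "X \<subseteq> N" "j \<in> N" "j \<notin> X"
  shows "best X + max 0 (marginal f j X) \<le> best (insert j X)"
proof -
  obtain A where A: "A \<subseteq> X" "best X = f A" using best_attained[OF assms(1)] .
  have "A - {j} = A" using A assms by auto
  then have "f (insert j A) = f A + marginal f j A" by (simp add: marginal_def)
  then have "f A + marginal f j X \<le> f (insert j A)"
    using marginal_antimono[of A X j] A assms by simp
  moreover have "f (insert j A) \<le> best (insert j X)" "f A \<le> best (insert j X)"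
    using A assms by (auto intro!: best_upper)
  ultimately show ?thesis using A by simp
qed

lemma bexp_best_bounds:
  assumes "J \<subseteq> N" "0 \<le> q" "q \<le> 1"
  shows "0 \<le> bexp q J best" "bexp q J best \<le> 1"
proof -
  have "finite J" using assms fin finite_subset by auto
  show "0 \<le> bexp q J best" using assms best_bounds by (intro bexp_nonneg) auto
  have "bexp q J best \<le> bexp q J (\<lambda>_. 1)" using assms best_bounds by (intro bexp_mono) auto
  then show "bexp q J best \<le> 1" using \<open>finite J\<close> by simp
qed

lemma bexp_best_insert:
  assumes "J \<subseteq> N" "j \<in> N - J" "0 \<le> q" "q \<le> 1"
  shows "bexp q J best + q * bexp q J (\<lambda>X. max 0 (marginal f j X)) \<le> bexp q (insert j J) best"
proof -
  have "finite J" using assms fin finite_subset by auto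
  have "q * bexp q J best + q * bexp q J (\<lambda>X. max 0 (marginal f j X))
      = q * bexp q J (\<lambda>X. best X + max 0 (marginal f j X))"
    by (simp add: bexp_add algebra_simps)
  also have "\<dots> \<le> q * bexp q J (\<lambda>X. best (insert j X))"
    using assms by (intro mult_left_mono bexp_mono best_insert) auto
  finally show ?thesis
    using assms \<open>finite J\<close> by (simp add: bexp_insert algebra_simps)
qed

lemma sum_marginal_le:
  assumes "J \<subseteq> N" "0 \<le> q" "q \<le> 1"
  shows "q * (\<Sum>j\<in>J. bexp q N (\<lambda>X. max 0 (marginal f j X))) \<le> bexp q J best"
proof -
  have "finite J" using assms fin finite_subset by auto
  then show ?thesis using assms
  proof (induction J rule: finite_induct)
    case empty
    then show ?case using best_bounds by simp
  next
    case (insert j J)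
    have "bexp q N (\<lambda>X. max 0 (marginal f j X)) \<le> bexp q N (\<lambda>X. max 0 (marginal f j (X \<inter> J)))"
      using insert by (intro bexp_mono max.mono marginal_antimono) auto
    also have "\<dots> = bexp q J (\<lambda>X. max 0 (marginal f j X))"
      by (rule bexp_inter) (use fin insert in auto)
    finally have "q * bexp q N (\<lambda>X. max 0 (marginal f j X)) \<le> q * bexp q J (\<lambda>X. max 0 (marginal f j X))"
      using insert by (intro mult_left_mono)
    then show ?case
      using insert bexp_best_insert[of J j q] by (simp add: distrib_left)
  qed
qed

lemma greedy_junta:
  fixes c q :: real
  assumes "0 \<le> q" "q \<le> 1" "0 < c"
  obtains J where "J \<subseteq> N" "c * card J \<le> 1"
    "\<And>j. j \<in> N - J \<Longrightarrow> q * bexp q J (\<lambda>X. max 0 (marginal f j X)) < c"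
proof -
  define S where "S = {J. J \<subseteq> N \<and> c * card J \<le> bexp q J best}"
  have "finite S" unfolding S_def using fin by auto
  moreover have "{} \<in> S" using best_bounds by (auto simp: S_def)
  ultimately have mx: "Max (card ` S) \<in> card ` S" by (intro Max_in) auto
  then obtain J where J: "J \<in> S" "card J = Max (card ` S)" by auto
  have finJ: "finite J" using J fin finite_subset by (auto simp: S_def)
  show thesis
  proof (rule that[of J])
    show "J \<subseteq> N" using J by (simp add: S_def)
    show "c * card J \<le> 1" using J bexp_best_bounds[of J q] assms by (auto simp: S_def)
    fix j assume j: "j \<in> N - J"
    show "q * bexp q J (\<lambda>X. max 0 (marginal f j X)) < c"
    proof (rule ccontr)
      assume "\<not> ?thesis"
      then have "insert j J \<in> S"
        using J j bexp_best_insert[of J j q] assms finJ by (auto simp: S_def distrib_left)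
      then have "card (insert j J) \<le> card J"
        using \<open>finite S\<close> J by auto
      then show False using j finJ by simp
    qed
  qed
qed

lemma positive_marginals_outside_junta:
  assumes r: "r \<ge> 1" and \<alpha>: "0 < \<alpha>"
  obtains J where "J \<subseteq> N" "real (card J) \<le> 4 * real r / \<alpha>"
    "(\<Sum>j\<in>N - J. bexp (1/2) N (\<lambda>X. (max 0 (marginal f j X))\<^sup>2)) \<le> 2 * \<alpha> + 4 * real r * (1/2) ^ r"
proof -
  obtain m where m: "r = Suc m" using r by (cases r) auto
  define q :: real where "q = 1 - (1/2) powr (1 / r)"
  have qr: "(1 - q) ^ r = 1/2"
    using r by (simp add: q_def powr_realpow[symmetric] powr_powr)
  have q1: "q \<le> 1" by (simp add: q_def)
  have q2: "q \<ge> 1 / (2 * r)"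
  proof (rule ccontr)
    assume "\<not> ?thesis"
    then have "1 - 1 / (2 * r) < 1 - q" by simp
    moreover have "0 \<le> 1 - 1 / (2 * real r)" using r by (simp add: field_simps)
    ultimately have "(1 - 1 / (2 * r)) ^ r < (1 - q) ^ r"
      using r by (intro power_strict_mono) auto
    moreover have "1 + real r * (- 1 / (2 * r)) \<le> (1 + (- 1 / (2 * r))) ^ r"
      using r by (intro Bernoulli_inequality) (simp add: field_simps)
    ultimately show False using r by (simp add: qr)
  qed
  moreover have "0 < 1 / (2 * real r)" using r by simp
  ultimately have q0: "q > 0" by linarith
  have inv: "1 / q \<le> 2 * r" using q2 q0 r by (simp add: field_simps)
  define c where "c = q * \<alpha> / 2"
  have "c > 0" using q0 \<alpha> by (simp add: c_def)
  obtain J where J: "J \<subseteq> N" "c * card J \<le> 1"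
    and out: "\<And>j. j \<in> N - J \<Longrightarrow> q * bexp q J (\<lambda>X. max 0 (marginal f j X)) < c"
    using greedy_junta[of q c] q0 q1 \<open>c > 0\<close> by auto
  let ?g = "\<lambda>j X. max 0 (marginal f j X)"
  have single: "bexp (1/2) N (\<lambda>X. (?g j X)\<^sup>2)
      \<le> \<alpha> * bexp (1/2) N (?g j) + (1/2) ^ m * bexp q N (?g j)" if j: "j \<in> N - J" for j
  proof -
    define b where "b X = (of_bool (marginal f j (X \<inter> J) > \<alpha>) :: real)" for X
    have "bexp q N b \<le> bexp q N (\<lambda>X. (1 / \<alpha>) * ?g j (X \<inter> J))"
      using q0 q1 \<alpha> by (intro bexp_mono) (auto simp: b_def field_simps)
    also have "\<dots> = (1 / \<alpha>) * bexp q J (?g j)"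
      unfolding bexp_cmult by (subst bexp_inter[OF fin J(1)]) simp
    also have "\<dots> \<le> 1 / 2"
      using out[OF j] q0 \<alpha> by (simp add: c_def field_simps)
    finally have b_half: "bexp q N b \<le> 1 / 2" .
    have b_anti: "b (X \<union> Y) \<le> b X" if "X \<subseteq> N" "Y \<subseteq> N" for X Y
    proof -
      have "X \<inter> J \<subseteq> (X \<union> Y) \<inter> J" "(X \<union> Y) \<inter> J \<subseteq> N" using J by auto
      then have "marginal f j ((X \<union> Y) \<inter> J) \<le> marginal f j (X \<inter> J)"
        using marginal_antimono j by blast
      then show ?thesis by (simp add: b_def)
    qed
    have g_anti: "?g j (X \<union> Y) \<le> ?g j X" if "X \<subseteq> N" "Y \<subseteq> N" for X Y
      using marginal_antimono[of X "X \<union> Y" j] that j by auto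
    define H where "H X = b X * ?g j X" for X
    have "(?g j X)\<^sup>2 \<le> \<alpha> * ?g j X + H X" if X: "X \<subseteq> N" for X
    proof (cases "marginal f j (X \<inter> J) > \<alpha>")
      case True
      have "?g j X * ?g j X \<le> 1 * ?g j X"
        using marginal_le_one[OF X] j by (intro mult_right_mono) auto
      moreover have "0 \<le> \<alpha> * ?g j X" using \<alpha> by simp
      ultimately show ?thesis using True by (simp add: H_def b_def power2_eq_square del: mult_le_cancel_right1)
    next
      case False
      then have "?g j X \<le> \<alpha>"
        using marginal_antimono[of "X \<inter> J" X j] X j \<alpha> by auto
      then have "?g j X * ?g j X \<le> \<alpha> * ?g j X" by (intro mult_right_mono) auto
      then show ?thesis using False by (simp add: H_def b_def power2_eq_square)
    qed
    then have "bexp (1/2) N (\<lambda>X. (?g j X)\<^sup>2) \<le> bexp (1/2) N (\<lambda>X. \<alpha> * ?g j X + H X)"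
      by (intro bexp_mono) auto
    also have "\<dots> = \<alpha> * bexp (1/2) N (?g j) + bexp (1/2) N H"
      by (simp add: bexp_add bexp_cmult)
    also have "bexp (1/2) N H = bexp (1 - (1 - q) ^ Suc m) N H"
    proof -
      have "1 - (1 - q) ^ Suc m = 1/2" using qr unfolding m by linarith
      then show ?thesis by (simp only:)
    qed
    also have "\<dots> \<le> bexp q N b ^ m * bexp q N H"
    proof (rule bexp_iterated_union)
      fix X Y assume XY: "X \<subseteq> N" "Y \<subseteq> N"
      have "b (X \<union> Y) \<le> b Y * b X"
        using b_anti[of X Y] b_anti[of Y X] XY by (auto simp: b_def Un_commute split: if_splits)
      then have "b (X \<union> Y) * ?g j (X \<union> Y) \<le> (b Y * b X) * ?g j X"
        using g_anti[OF XY] by (intro mult_mono) (auto simp: b_def)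
      then show "H (X \<union> Y) \<le> b Y * H X" by (simp add: H_def mult.assoc)
    qed (use fin q0 q1 in \<open>auto simp: b_def\<close>)
    also have "\<dots> \<le> (1/2) ^ m * bexp q N (?g j)"
    proof (intro mult_mono power_mono b_half bexp_mono)
      show "H X \<le> ?g j X" if "X \<subseteq> N" for X by (simp add: H_def b_def)
    qed (use q0 q1 in \<open>auto intro!: bexp_nonneg simp: H_def b_def\<close>)
    finally show ?thesis by simp
  qed
  have total: "(\<Sum>j\<in>N - J. bexp p N (?g j)) \<le> 1 / p" if p: "0 < p" "p \<le> 1" for p
  proof -
    have "(\<Sum>j\<in>N - J. bexp p N (?g j)) \<le> (\<Sum>j\<in>N. bexp p N (?g j))"
      using fin p by (intro sum_mono2 bexp_nonneg) auto
    moreover have "p * (\<Sum>j\<in>N. bexp p N (?g j)) \<le> 1"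
      using sum_marginal_le[of N p] bexp_best_bounds[of N p] p by auto
    ultimately show ?thesis using p mult_left_mono[of _ _ p]
      by (smt (verit, best) mult.commute pos_le_divide_eq)
  qed
  have "(\<Sum>j\<in>N - J. bexp (1/2) N (\<lambda>X. (?g j X)\<^sup>2))
     \<le> (\<Sum>j\<in>N - J. \<alpha> * bexp (1/2) N (?g j) + (1/2) ^ m * bexp q N (?g j))"
    by (intro sum_mono single)
  also have "\<dots> = \<alpha> * (\<Sum>j\<in>N - J. bexp (1/2) N (?g j)) + (1/2) ^ m * (\<Sum>j\<in>N - J. bexp q N (?g j))"
    by (simp add: sum.distrib sum_distrib_left)
  also have "\<dots> \<le> \<alpha> * (1 / (1/2)) + (1/2) ^ m * (1 / q)"
    using \<alpha> q0 q1 by (intro add_mono mult_left_mono total) auto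
  also have "\<dots> \<le> 2 * \<alpha> + (1/2) ^ m * (2 * r)"
    using inv by (intro add_mono mult_left_mono) auto
  also have "\<dots> = 2 * \<alpha> + 4 * real r * (1/2) ^ r" by (simp add: m)
  finally have "(\<Sum>j\<in>N - J. bexp (1/2) N (\<lambda>X. (?g j X)\<^sup>2)) \<le> 2 * \<alpha> + 4 * real r * (1/2) ^ r" .
  moreover have "real (card J) \<le> 4 * real r / \<alpha>"
  proof -
    have "real (card J) \<le> 1 / c" using J \<open>c > 0\<close> by (simp add: field_simps)
    also have "\<dots> = (1 / q) * (2 / \<alpha>)" by (simp add: c_def)
    also have "\<dots> \<le> (2 * r) * (2 / \<alpha>)" using inv \<alpha> by (intro mult_right_mono) auto
    finally show ?thesis by simp
  qed
  ultimately show ?thesis using that J by blast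
qed

lemma compl: "submodular_function N (\<lambda>X. f (N - X))"
proof
  fix X Y assume "X \<subseteq> N" "Y \<subseteq> N"
  then show "f (N - X \<inter> Y) + f (N - (X \<union> Y)) \<le> f (N - X) + f (N - Y)"
    using submod[of "N - X" "N - Y"] by (simp add: Diff_Int Diff_Un add.commute)
qed (use fin nonneg le_one in auto)

lemma marginal_compl:
  assumes "X \<subseteq> N" "j \<in> N"
  shows "marginal (\<lambda>X. f (N - X)) j X = - marginal f j (N - X)"
proof -
  have "N - insert j X = (N - X) - {j}" "N - (X - {j}) = insert j (N - X)"
    using assms by auto
  then show ?thesis by (simp add: marginal_def)
qed

theorem junta_approximation:
  assumes r: "r \<ge> 1" and \<alpha>: "0 < \<alpha>"
  obtains J where "J \<subseteq> N" "real (card J) \<le> 8 * real r / \<alpha>"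
    "(\<Sum>T\<in>Pow N. of_bool (\<not> T \<subseteq> J) * weight N f T) \<le> \<alpha> + 2 * real r * (1/2) ^ r"
proof -
  interpret c: submodular_function N "\<lambda>X. f (N - X)" by (rule compl)
  obtain J1 where J1: "J1 \<subseteq> N" "real (card J1) \<le> 4 * real r / \<alpha>"
    "(\<Sum>j\<in>N - J1. bexp (1/2) N (\<lambda>X. (max 0 (marginal f j X))\<^sup>2)) \<le> 2 * \<alpha> + 4 * real r * (1/2) ^ r"
    using positive_marginals_outside_junta[OF assms] .
  obtain J2 where J2: "J2 \<subseteq> N" "real (card J2) \<le> 4 * real r / \<alpha>"
    "(\<Sum>j\<in>N - J2. bexp (1/2) N (\<lambda>X. (max 0 (marginal (\<lambda>X. f (N - X)) j X))\<^sup>2)) \<le> 2 * \<alpha> + 4 * real r * (1/2) ^ r"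
    using c.positive_marginals_outside_junta[OF assms] .
  define J where "J = J1 \<union> J2"
  have neg: "bexp (1/2) N (\<lambda>X. (max 0 (marginal (\<lambda>X. f (N - X)) j X))\<^sup>2)
     = bexp (1/2) N (\<lambda>X. (max 0 (- marginal f j X))\<^sup>2)" if "j \<in> N" for j
  proof -
    have "bexp (1/2) N (\<lambda>X. (max 0 (marginal (\<lambda>X. f (N - X)) j X))\<^sup>2)
       = bexp (1/2) N (\<lambda>X. (\<lambda>Y. (max 0 (- marginal f j Y))\<^sup>2) (N - X))"
      using that by (intro bexp_cong) (simp add: marginal_compl)
    also have "\<dots> = bexp (1/2) N (\<lambda>Y. (max 0 (- marginal f j Y))\<^sup>2)"
      by (rule bexp_half_compl[OF fin])
    finally show ?thesis .
  qed
  have JN: "J \<subseteq> N" using J1 J2 by (auto simp: J_def)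
  have finJ: "finite (N - J)" using fin by simp
  have "(\<Sum>T\<in>Pow N. of_bool (\<not> T \<subseteq> J) * weight N f T)
      \<le> (\<Sum>T\<in>Pow N. \<Sum>j\<in>N - J. of_bool (j \<in> T) * weight N f T)"
  proof (rule sum_mono)
    fix T assume T: "T \<in> Pow N"
    show "of_bool (\<not> T \<subseteq> J) * weight N f T \<le> (\<Sum>j\<in>N - J. of_bool (j \<in> T) * weight N f T)"
    proof (cases "T \<subseteq> J")
      case False
      then obtain j where "j \<in> T" "j \<in> N - J" using T by auto
      then show ?thesis
        using member_le_sum[of j "N - J" "\<lambda>j. of_bool (j \<in> T) * weight N f T"] finJ by simp
    qed (simp add: sum_nonneg)
  qed
  also have "\<dots> = (\<Sum>j\<in>N - J. \<Sum>T\<in>Pow N. of_bool (j \<in> T) * weight N f T)"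
    by (rule sum.swap)
  also have "\<dots> = (\<Sum>j\<in>N - J. bexp (1/2) N (\<lambda>X. (marginal f j X)\<^sup>2) / 4)"
    using influence[OF fin, of _ f] by (intro sum.cong) (auto simp: marginal_def)
  also have "\<dots> = (\<Sum>j\<in>N - J. bexp (1/2) N (\<lambda>X. (max 0 (marginal f j X))\<^sup>2)
       + bexp (1/2) N (\<lambda>X. (max 0 (marginal (\<lambda>X. f (N - X)) j X))\<^sup>2)) / 4"
    unfolding sum_divide_distrib
  proof (intro sum.cong refl)
    fix j assume "j \<in> N - J"
    then show "bexp (1/2) N (\<lambda>X. (marginal f j X)\<^sup>2) / 4 = (bexp (1/2) N (\<lambda>X. (max 0 (marginal f j X))\<^sup>2)
       + bexp (1/2) N (\<lambda>X. (max 0 (marginal (\<lambda>X. f (N - X)) j X))\<^sup>2)) / 4"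
      by (subst neg, simp, subst bexp_add[symmetric])
         (auto intro!: bexp_cong arg_cong2[of _ _ _ _ "(/)"] simp: max_def)
  qed
  also have "\<dots> \<le> ((\<Sum>j\<in>N - J1. bexp (1/2) N (\<lambda>X. (max 0 (marginal f j X))\<^sup>2))
       + (\<Sum>j\<in>N - J2. bexp (1/2) N (\<lambda>X. (max 0 (marginal (\<lambda>X. f (N - X)) j X))\<^sup>2))) / 4"
    unfolding sum.distrib using fin
    by (intro divide_right_mono add_mono sum_mono2 bexp_nonneg) (auto simp: J_def)
  also have "\<dots> \<le> \<alpha> + 2 * real r * (1/2) ^ r" using J1(3) J2(3) by simp
  finally have "(\<Sum>T\<in>Pow N. of_bool (\<not> T \<subseteq> J) * weight N f T) \<le> \<alpha> + 2 * real r * (1/2) ^ r" .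
  moreover have "real (card J) \<le> real (card J1) + real (card J2)"
    unfolding J_def using card_Un_le[of J1 J2] by linarith
  then have "real (card J) \<le> 8 * real r / \<alpha>" using J1(2) J2(2) by simp
  ultimately show ?thesis using that JN by blast
qed

end

section \<open>Noise, influences and juntas\<close>

lemma submodular_functionI_average:
  assumes "finite M" "0 \<le> p" "p \<le> 1" "\<And>Z. Z \<subseteq> M \<Longrightarrow> submodular_function N (\<lambda>X. f X Z)"
  shows "submodular_function N (\<lambda>X. bexp p M (f X))"
proof
  show "finite N" using assms(4)[of "{}"] by (simp add: submodular_function_def)
next
  fix X assume X: "X \<subseteq> N"
  show "0 \<le> bexp p M (f X)"
    using assms X by (intro bexp_nonneg) (auto simp: submodular_function_def)
  have "bexp p M (f X) \<le> bexp p M (\<lambda>_. 1)"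
    using assms X by (intro bexp_mono) (auto simp: submodular_function_def)
  then show "bexp p M (f X) \<le> 1" using assms by simp
next
  fix X Y assume XY: "X \<subseteq> N" "Y \<subseteq> N"
  have "bexp p M (\<lambda>Z. f (X \<inter> Y) Z + f (X \<union> Y) Z) \<le> bexp p M (\<lambda>Z. f X Z + f Y Z)"
    using assms(2,3) submodular_function.submod[OF assms(4) XY] by (intro bexp_mono) auto
  then show "bexp p M (f (X \<inter> Y)) + bexp p M (f (X \<union> Y)) \<le> bexp p M (f X) + bexp p M (f Y)"
    by (simp add: bexp_add)
qed

lemma submodular_functionI_pullback:
  assumes "submodular_function M h" "finite N"
    and "\<And>X. X \<subseteq> N \<Longrightarrow> \<phi> X \<subseteq> M"
    and "\<And>X Y. X \<subseteq> N \<Longrightarrow> Y \<subseteq> N \<Longrightarrow> \<phi> (X \<inter> Y) = \<phi> X \<inter> \<phi> Y"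
    and "\<And>X Y. X \<subseteq> N \<Longrightarrow> Y \<subseteq> N \<Longrightarrow> \<phi> (X \<union> Y) = \<phi> X \<union> \<phi> Y"
  shows "submodular_function N (\<lambda>X. h (\<phi> X))"
  using assms by (auto simp: submodular_function_def)

definition noisy_dist :: "real \<Rightarrow> 'a set \<Rightarrow> 'a set \<Rightarrow> ('a set \<Rightarrow> real) \<Rightarrow> real" where
  "noisy_dist \<rho> N U f = 2 * (\<Sum>T\<in>Pow N. (1 - of_bool (T \<subseteq> U) * \<rho> ^ card T) * weight N f T)"

lemma noisy_dist_eq:
  assumes "finite N" "U \<subseteq> N"
  shows "bexp \<rho> N (\<lambda>R. bexp (1/2) N (\<lambda>X. bexp (1/2) N (\<lambda>Z.
      (f X - f (X \<inter> (R \<inter> U) \<union> (Z - R \<inter> U)))\<^sup>2))) = noisy_dist \<rho> N U f"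
proof -
  have "bexp \<rho> N (\<lambda>R. bexp (1/2) N (\<lambda>X. bexp (1/2) N (\<lambda>Z.
      (f X - f (X \<inter> (R \<inter> U) \<union> (Z - R \<inter> U)))\<^sup>2)))
    = bexp \<rho> N (\<lambda>R. 2 * (\<Sum>T\<in>Pow N. of_bool (\<not> T \<subseteq> R \<inter> U) * weight N f T))"
    using assms by (intro bexp_cong rerandomize_dist) auto
  also have "\<dots> = 2 * (\<Sum>T\<in>Pow N. bexp \<rho> N (\<lambda>R. of_bool (\<not> T \<subseteq> R \<inter> U)) * weight N f T)"
    by (simp add: bexp_cmult bexp_sum bexp_multc)
  also have "\<dots> = noisy_dist \<rho> N U f"
    unfolding noisy_dist_def
  proof (intro arg_cong2[where f = "(*)"] sum.cong refl)
    fix T assume T: "T \<in> Pow N"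
    have "bexp \<rho> N (\<lambda>R. of_bool (\<not> T \<subseteq> R \<inter> U)) = bexp \<rho> N (\<lambda>R. 1 - of_bool (T \<subseteq> U) * of_bool (T \<subseteq> R))"
      by (rule bexp_cong) auto
    also have "\<dots> = 1 - of_bool (T \<subseteq> U) * \<rho> ^ card T"
      using T assms by (simp add: bexp_diff bexp_cmult bexp_superset)
    finally show "bexp \<rho> N (\<lambda>R. of_bool (\<not> T \<subseteq> R \<inter> U)) = 1 - of_bool (T \<subseteq> U) * \<rho> ^ card T" .
  qed
  finally show ?thesis .
qed

lemma sum_weight_le_one:
  assumes "finite N" "\<And>X. X \<subseteq> N \<Longrightarrow> \<bar>f X\<bar> \<le> 1"
  shows "(\<Sum>T\<in>Pow N. weight N f T) \<le> 1"
proof -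
  have "bexp (1/2) N (\<lambda>X. (f X)\<^sup>2) \<le> bexp (1/2) N (\<lambda>_. 1)"
    using assms by (intro bexp_mono) (auto simp: abs_square_le_1)
  then show ?thesis using assms by (simp add: parseval)
qed

lemma noisy_dist_junta_le:
  assumes N: "finite N" and U: "J \<subseteq> U" "U \<subseteq> N" and k: "card J \<le> k" "k > 0"
    and \<tau>: "0 \<le> \<tau>" "\<tau> \<le> k" and \<rho>: "\<rho> = 1 - \<tau> / k"
    and f: "\<And>X. X \<subseteq> N \<Longrightarrow> \<bar>f X\<bar> \<le> 1"
    and J: "(\<Sum>T\<in>Pow N. of_bool (\<not> T \<subseteq> J) * weight N f T) \<le> \<tau>"
  shows "noisy_dist \<rho> N U f \<le> 4 * \<tau>"
proof -
  have \<rho>01: "0 \<le> \<rho>" "\<rho> \<le> 1" unfolding \<rho> using \<tau> k by (auto simp: divide_le_eq)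
  have "(1 - of_bool (T \<subseteq> U) * \<rho> ^ card T) * weight N f T
      \<le> of_bool (\<not> T \<subseteq> J) * weight N f T + \<tau> * weight N f T" if T: "T \<in> Pow N" for T
  proof (cases "T \<subseteq> J")
    case True
    have "finite J" by (rule finite_subset[OF subset_trans[OF U] N])
    then have "card T \<le> k" using True k card_mono[of J T] by linarith
    have "1 + real (card T) * (\<rho> - 1) \<le> (1 + (\<rho> - 1)) ^ card T"
      using \<rho>01 by (intro Bernoulli_inequality) auto
    then have "1 - \<rho> ^ card T \<le> real (card T) * (1 - \<rho>)" by (simp add: algebra_simps)
    also have "\<dots> \<le> k * (1 - \<rho>)" using \<open>card T \<le> k\<close> \<rho>01 by (intro mult_right_mono) auto
    also have "\<dots> = \<tau>" using \<rho> k by simp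
    finally have "1 - \<rho> ^ card T \<le> \<tau>" .
    then have "(1 - \<rho> ^ card T) * weight N f T \<le> \<tau> * weight N f T"
      by (intro mult_right_mono) auto
    moreover have "T \<subseteq> U" using True U by auto
    ultimately show ?thesis using True by simp
  next
    case False
    have "(1 - of_bool (T \<subseteq> U) * \<rho> ^ card T) * weight N f T \<le> 1 * weight N f T"
      using \<rho>01 by (intro mult_right_mono) auto
    moreover have "0 \<le> \<tau> * weight N f T" using \<tau> by simp
    ultimately show ?thesis using False by simp
  qed
  then have "(\<Sum>T\<in>Pow N. (1 - of_bool (T \<subseteq> U) * \<rho> ^ card T) * weight N f T)
     \<le> (\<Sum>T\<in>Pow N. of_bool (\<not> T \<subseteq> J) * weight N f T + \<tau> * weight N f T)"
    by (rule sum_mono)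
  also have "\<dots> = (\<Sum>T\<in>Pow N. of_bool (\<not> T \<subseteq> J) * weight N f T) + \<tau> * (\<Sum>T\<in>Pow N. weight N f T)"
    by (simp add: sum.distrib sum_distrib_left)
  also have "\<dots> \<le> \<tau> + \<tau> * 1"
    using J sum_weight_le_one[OF N f] \<tau> by (intro add_mono mult_left_mono) auto
  finally show ?thesis by (simp add: noisy_dist_def)
qed

lemma weight_outside_le_noisy_dist:
  assumes "0 \<le> \<rho>" "\<rho> \<le> 1"
  shows "2 * (\<Sum>T\<in>Pow N. of_bool (\<not> T \<subseteq> U) * weight N f T) \<le> noisy_dist \<rho> N U f"
  unfolding noisy_dist_def using assms
  by (intro mult_left_mono sum_mono mult_right_mono) (auto simp: power_le_one)

text \<open>Damping by \<open>\<rho> ^ card T\<close> bounds the total influence by \<open>1 / (1 - \<rho>)\<close>, and \<open>noisy_dist\<close> already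
  controls the mass lost by it.\<close>

definition damped_influence :: "real \<Rightarrow> 'a set \<Rightarrow> ('a set \<Rightarrow> real) \<Rightarrow> 'a \<Rightarrow> real" where
  "damped_influence \<rho> N f j = (\<Sum>T\<in>Pow N. of_bool (j \<in> T) * (\<rho> ^ card T * weight N f T))"

lemma damped_influence_nonneg: "0 \<le> \<rho> \<Longrightarrow> 0 \<le> damped_influence \<rho> N f j"
  unfolding damped_influence_def by (intro sum_nonneg) auto

lemma mult_power_le:
  assumes "0 \<le> (\<rho>::real)" "\<rho> \<le> 1"
  shows "real m * \<rho> ^ m * (1 - \<rho>) \<le> 1 - \<rho> ^ m"
proof (induction m)
  case (Suc m)
  have "real (Suc m) * \<rho> ^ Suc m * (1 - \<rho>)
      = \<rho> * (real m * \<rho> ^ m * (1 - \<rho>)) + \<rho> ^ Suc m * (1 - \<rho>)"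
    by (simp add: algebra_simps)
  also have "\<dots> \<le> \<rho> * (1 - \<rho> ^ m) + \<rho> ^ Suc m * (1 - \<rho>)"
    using Suc assms by (intro add_right_mono mult_left_mono)
  also have "\<dots> = \<rho> * (1 - \<rho> ^ Suc m)" by (simp add: algebra_simps)
  also have "\<dots> \<le> 1 * (1 - \<rho> ^ Suc m)"
    using assms by (intro mult_right_mono) (auto simp: power_le_one simp del: power_Suc)
  finally show ?case by simp
qed simp

lemma sum_damped_influence_le:
  assumes "finite N" "0 \<le> \<rho>" "\<rho> < 1" "\<And>X. X \<subseteq> N \<Longrightarrow> \<bar>f X\<bar> \<le> 1"
  shows "(\<Sum>j\<in>N. damped_influence \<rho> N f j) \<le> 1 / (1 - \<rho>)"
proof -
  have "(\<Sum>j\<in>N. damped_influence \<rho> N f j)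
     = (\<Sum>T\<in>Pow N. \<Sum>j\<in>N. of_bool (j \<in> T) * (\<rho> ^ card T * weight N f T))"
    unfolding damped_influence_def by (rule sum.swap)
  also have "\<dots> = (\<Sum>T\<in>Pow N. real (card T) * \<rho> ^ card T * weight N f T)"
  proof (intro sum.cong refl)
    fix T assume "T \<in> Pow N"
    then have "N \<inter> T = T" by auto
    then show "(\<Sum>j\<in>N. of_bool (j \<in> T) * (\<rho> ^ card T * weight N f T))
       = real (card T) * \<rho> ^ card T * weight N f T"
      using assms(1) by (simp flip: sum_distrib_right)
  qed
  also have "\<dots> \<le> (\<Sum>T\<in>Pow N. (1 / (1 - \<rho>)) * weight N f T)"
  proof (intro sum_mono mult_right_mono)
    fix T
    have "real (card T) * \<rho> ^ card T * (1 - \<rho>) \<le> 1 - \<rho> ^ card T"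
      using assms by (intro mult_power_le) auto
    also have "\<dots> \<le> 1" using assms by simp
    finally show "real (card T) * \<rho> ^ card T \<le> 1 / (1 - \<rho>)"
      using assms by (simp add: field_simps)
  qed auto
  also have "\<dots> \<le> (1 / (1 - \<rho>)) * 1"
    unfolding sum_distrib_left[symmetric]
    using assms sum_weight_le_one[OF assms(1,4)] by (intro mult_left_mono) auto
  finally show ?thesis by simp
qed

lemma weight_outside_junta_le:
  assumes "finite N" "U \<subseteq> N" "0 \<le> \<rho>" "\<rho> \<le> 1"
  shows "(\<Sum>T\<in>Pow N. of_bool (\<not> T \<subseteq> J) * weight N f T)
    \<le> noisy_dist \<rho> N U f / 2 + (\<Sum>j\<in>U - J. damped_influence \<rho> N f j)"
proof -
  have fin: "finite (U - J)" using assms finite_subset by blast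
  have "(\<Sum>T\<in>Pow N. of_bool (\<not> T \<subseteq> J) * weight N f T)
     \<le> (\<Sum>T\<in>Pow N. (1 - of_bool (T \<subseteq> U) * \<rho> ^ card T) * weight N f T
         + (\<Sum>j\<in>U - J. of_bool (j \<in> T) * (\<rho> ^ card T * weight N f T)))"
  proof (rule sum_mono)
    fix T assume "T \<in> Pow N"
    let ?S = "\<Sum>j\<in>U - J. of_bool (j \<in> T) * (\<rho> ^ card T * weight N f T)"
    have S: "0 \<le> ?S" using assms by (intro sum_nonneg) auto
    consider "\<not> T \<subseteq> U" | "T \<subseteq> U" "\<not> T \<subseteq> J" | "T \<subseteq> U" "T \<subseteq> J" by blast
    then show "of_bool (\<not> T \<subseteq> J) * weight N f T
        \<le> (1 - of_bool (T \<subseteq> U) * \<rho> ^ card T) * weight N f T + ?S"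
    proof cases
      case 1
      then show ?thesis using S by (cases "T \<subseteq> J") (simp_all add: add_increasing2)
    next
      case 2
      then obtain j where "j \<in> T" "j \<in> U - J" by auto
      then have "\<rho> ^ card T * weight N f T \<le> ?S"
        using member_le_sum[of j "U - J" "\<lambda>j. of_bool (j \<in> T) * (\<rho> ^ card T * weight N f T)"] fin assms
        by auto
      then show ?thesis using 2 by (simp add: algebra_simps)
    next
      case 3
      have "0 \<le> (1 - \<rho> ^ card T) * weight N f T"
        using assms by (intro mult_nonneg_nonneg) (auto simp: power_le_one)
      then show ?thesis using 3 S by simp
    qed
  qed
  also have "\<dots> = noisy_dist \<rho> N U f / 2 + (\<Sum>j\<in>U - J. damped_influence \<rho> N f j)"
  proof -
    have "(\<Sum>T\<in>Pow N. \<Sum>j\<in>U - J. of_bool (j \<in> T) * (\<rho> ^ card T * weight N f T))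
       = (\<Sum>j\<in>U - J. damped_influence \<rho> N f j)"
      unfolding damped_influence_def by (rule sum.swap)
    then show ?thesis by (simp add: noisy_dist_def sum.distrib)
  qed
  finally show ?thesis .
qed

section \<open>Collapsing the coordinates along a partition\<close>

text \<open>A half-class is coded by a pair \<open>(i, c)\<close>: it consists of the coordinates \<open>j\<close> with \<open>\<pi> j = i\<close>
  and \<open>(j \<in> B) = c\<close>, and \<open>point\<close> gives its coordinates the value \<open>(i \<in> u) = c\<close>.  Thus
  \<open>overwrite u I a\<close> is the modification of \<open>u\<close> whose point takes the value \<open>p \<in> a\<close> on every
  half-class \<open>p \<in> I\<close>; this needs \<open>I\<close> not to contain both halves of a class.\<close>

definition point :: "'a set \<Rightarrow> ('a \<Rightarrow> 'i) \<Rightarrow> 'a set \<Rightarrow> 'i set \<Rightarrow> 'a set" where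
  "point N \<pi> B u = {j \<in> N. (\<pi> j \<in> u) = (j \<in> B)}"

definition region :: "'a set \<Rightarrow> ('a \<Rightarrow> 'i) \<Rightarrow> 'a set \<Rightarrow> ('i \<times> bool) set \<Rightarrow> 'a set" where
  "region N \<pi> B I = {j \<in> N. (\<pi> j, j \<in> B) \<in> I}"

definition overwrite :: "'i set \<Rightarrow> ('i \<times> bool) set \<Rightarrow> ('i \<times> bool) set \<Rightarrow> 'i set" where
  "overwrite u I a = (u - fst ` I) \<union> {i. \<exists>c. (i, c) \<in> I \<and> ((i, c) \<in> a) = c}"

lemma point_subset: "point N \<pi> B u \<subseteq> N"
  by (auto simp: point_def)

lemma region_subset: "region N \<pi> B I \<subseteq> N"
  by (auto simp: region_def)

lemma point_overwrite:
  assumes "inj_on fst I" "j \<in> region N \<pi> B I"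
  shows "j \<in> point N \<pi> B (overwrite u I a) \<longleftrightarrow> (\<pi> j, j \<in> B) \<in> a"
proof -
  have j: "j \<in> N" "(\<pi> j, j \<in> B) \<in> I" using assms by (auto simp: region_def)
  have uniq: "c = (j \<in> B)" if "(\<pi> j, c) \<in> I" for c
    using inj_onD[OF assms(1) _ that j(2)] by simp
  have "\<pi> j \<in> fst ` I" using imageI[OF j(2), of fst] by simp
  then have "\<pi> j \<in> overwrite u I a \<longleftrightarrow> (\<exists>c. (\<pi> j, c) \<in> I \<and> ((\<pi> j, c) \<in> a) = c)"
    by (simp add: overwrite_def)
  also have "\<dots> \<longleftrightarrow> ((\<pi> j, j \<in> B) \<in> a) = (j \<in> B)"
  proof
    assume "\<exists>c. (\<pi> j, c) \<in> I \<and> ((\<pi> j, c) \<in> a) = c"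
    then obtain c where c: "(\<pi> j, c) \<in> I" "((\<pi> j, c) \<in> a) = c" by blast
    show "((\<pi> j, j \<in> B) \<in> a) = (j \<in> B)" using c(2) unfolding uniq[OF c(1)] .
  qed (use j(2) in blast)
  finally show ?thesis using j by (cases "j \<in> B") (simp_all add: point_def)
qed

lemma bexp_overwrite:
  assumes "finite P" "fst ` I \<subseteq> P" "inj_on fst I"
  shows "bexp (1/2) P (\<lambda>u. bexp (1/2) I (\<lambda>a. F (overwrite u I a))) = bexp (1/2) P F"
proof -
  define h where "h a = {i. \<exists>c. (i, c) \<in> I \<and> ((i, c) \<in> a) = c}" for a
  define g where "g v = {p \<in> I. (fst p \<in> v) = snd p}" for v
  have uniq: "c = d" if "(i, c) \<in> I" "(i, d) \<in> I" for i c d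
    using inj_onD[OF assms(3) _ that] by simp
  have finI: "finite I" using assms by (metis finite_imageD finite_subset)
  have hmem: "i \<in> h a \<longleftrightarrow> ((i, c) \<in> a) = c" if "(i, c) \<in> I" for i c a
    using that uniq[OF that] unfolding h_def by blast
  have bij: "bij_betw h (Pow I) (Pow (fst ` I))"
  proof (rule bij_betwI[where g = g])
    show "h \<in> Pow I \<rightarrow> Pow (fst ` I)" by (force simp: h_def)
    show "g \<in> Pow (fst ` I) \<rightarrow> Pow I" by (auto simp: g_def)
    show "g (h a) = a" if "a \<in> Pow I" for a
      using that by (fastforce simp: g_def hmem)
    show "h (g v) = v" if "v \<in> Pow (fst ` I)" for v
    proof -
      have "i \<in> h (g v) \<longleftrightarrow> i \<in> v" if "i \<in> fst ` I" for i
      proof -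
        have "i \<in> fst ` I" by fact
        then obtain c where c: "(i, c) \<in> I" by auto
        show ?thesis using c by (cases c) (simp_all add: hmem[OF c] g_def)
      qed
      moreover have "h (g v) \<subseteq> fst ` I" by (force simp: h_def)
      ultimately show ?thesis using that by blast
    qed
  qed
  have "bexp (1/2) P (\<lambda>u. bexp (1/2) I (\<lambda>a. F (overwrite u I a)))
     = bexp (1/2) P (\<lambda>u. (\<lambda>w. bexp (1/2) I (\<lambda>a. F (w \<union> h a))) (u \<inter> (P - fst ` I)))"
  proof (rule bexp_cong)
    fix u assume "u \<subseteq> P"
    then have "overwrite u I a = u \<inter> (P - fst ` I) \<union> h a" for a
      by (auto simp: overwrite_def h_def)
    then show "bexp (1/2) I (\<lambda>a. F (overwrite u I a))
       = (\<lambda>w. bexp (1/2) I (\<lambda>a. F (w \<union> h a))) (u \<inter> (P - fst ` I))" by simp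
  qed
  also have "\<dots> = bexp (1/2) (P - fst ` I) (\<lambda>w. bexp (1/2) I (\<lambda>a. F (w \<union> h a)))"
    by (rule bexp_inter) (use assms in auto)
  also have "\<dots> = bexp (1/2) (P - fst ` I) (\<lambda>w. bexp (1/2) (fst ` I) (\<lambda>v. F (w \<union> v)))"
    using finI bij by (intro bexp_cong bexp_half_bij) auto
  also have "\<dots> = bexp (1/2) (P - fst ` I \<union> fst ` I) F"
    by (rule bexp_Un[symmetric]) (use assms finI in auto)
  also have "P - fst ` I \<union> fst ` I = P" using assms by auto
  finally show ?thesis .
qed

lemma bexp_point_shift:
  assumes "finite N"
  shows "bexp (1/2) N (\<lambda>B. F (point N \<pi> B u)) = bexp (1/2) N F"
  by (rule bexp_half_bij[OF assms assms], rule bij_betwI[where g = "\<lambda>B. point N \<pi> B u"])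
     (auto simp: point_def)

lemma bexp_point_junta:
  assumes "finite N" "J \<subseteq> N" "finite P" "\<pi> ` J \<subseteq> P" "inj_on \<pi> J"
  shows "bexp (1/2) P (\<lambda>u. F (point N \<pi> B u \<inter> J)) = bexp (1/2) N (\<lambda>X. F (X \<inter> J))"
proof -
  define h where "h v = {j \<in> J. (\<pi> j \<in> v) = (j \<in> B)}" for v
  define g where "g Y = \<pi> ` {j \<in> J. (j \<in> Y) = (j \<in> B)}" for Y
  have finJ: "finite J" by (rule finite_subset[OF assms(2,1)])
  have bij: "bij_betw h (Pow (\<pi> ` J)) (Pow J)"
  proof (rule bij_betwI[where g = g])
    show "g (h v) = v" if "v \<in> Pow (\<pi> ` J)" for v
      using that by (auto simp: g_def h_def)
    show "h (g Y) = Y" if "Y \<in> Pow J" for Y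
    proof -
      have "\<pi> j \<in> g Y \<longleftrightarrow> (j \<in> Y) = (j \<in> B)" if "j \<in> J" for j
        using inj_onD[OF assms(5)] that by (auto simp: g_def)
      then show ?thesis using that by (auto simp: h_def)
    qed
  qed (auto simp: h_def g_def)
  have "bexp (1/2) P (\<lambda>u. F (point N \<pi> B u \<inter> J)) = bexp (1/2) P (\<lambda>u. (\<lambda>v. F (h v)) (u \<inter> \<pi> ` J))"
  proof (rule bexp_cong)
    fix u
    have "point N \<pi> B u \<inter> J = h (u \<inter> \<pi> ` J)" using assms by (auto simp: point_def h_def)
    then show "F (point N \<pi> B u \<inter> J) = (\<lambda>v. F (h v)) (u \<inter> \<pi> ` J)" by simp
  qed
  also have "\<dots> = bexp (1/2) (\<pi> ` J) (\<lambda>v. F (h v))"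
    by (rule bexp_inter[OF assms(3,4)])
  also have "\<dots> = bexp (1/2) J F"
    using finJ by (intro bexp_half_bij bij) auto
  also have "\<dots> = bexp (1/2) N (\<lambda>X. F (X \<inter> J))"
    by (rule bexp_inter[OF assms(1,2), symmetric])
  finally show ?thesis .
qed

definition lift :: "('a \<Rightarrow> 'i) \<Rightarrow> 'a set \<Rightarrow> 'a set \<Rightarrow> ('i \<times> bool) set \<Rightarrow> 'a set" where
  "lift \<pi> B J a = {j \<in> J. (\<pi> j, j \<in> B) \<in> a}"

lemma power2_sum_le: "(x + y)\<^sup>2 \<le> 2 * x\<^sup>2 + 2 * (y::real)\<^sup>2"
  using zero_le_power2[of "x - y"] by (simp add: power2_eq_square algebra_simps)

lemma bexp_dist_triangle:
  assumes "0 \<le> p" "p \<le> 1"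
  shows "bexp p N (\<lambda>X. (f X - h X)\<^sup>2) \<le> 2 * bexp p N (\<lambda>X. (f X - g X)\<^sup>2) + 2 * bexp p N (\<lambda>X. (g X - h X)\<^sup>2)"
proof -
  have "bexp p N (\<lambda>X. (f X - h X)\<^sup>2) \<le> bexp p N (\<lambda>X. 2 * (f X - g X)\<^sup>2 + 2 * (g X - h X)\<^sup>2)"
  proof (rule bexp_mono[OF assms])
    fix X show "(f X - h X)\<^sup>2 \<le> 2 * (f X - g X)\<^sup>2 + 2 * (g X - h X)\<^sup>2"
      using power2_sum_le[of "f X - g X" "g X - h X"] by simp
  qed
  then show ?thesis by (simp add: bexp_add bexp_cmult)
qed

definition learned_dist ::
  "'a set \<Rightarrow> ('a set \<Rightarrow> real) \<Rightarrow> ('a \<Rightarrow> 'i) \<Rightarrow> 'a set \<Rightarrow> 'i set \<Rightarrow> ('i \<times> bool) set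
     \<Rightarrow> (('i \<times> bool) set \<Rightarrow> real) \<Rightarrow> real" where
  "learned_dist N f \<pi> B u I h = bexp (1/2) I (\<lambda>a. (f (point N \<pi> B (overwrite u I a)) - h a)\<^sup>2)"

lemma learned_dist_nonneg: "0 \<le> learned_dist N f \<pi> B u I h"
  unfolding learned_dist_def by (intro bexp_nonneg) auto

lemma average_outside_point_overwrite:
  assumes "inj_on fst I" "J \<subseteq> region N \<pi> B I"
  shows "average_outside N J f (point N \<pi> B (overwrite u I a)) = average_outside N J f (lift \<pi> B J a)"
proof -
  have "point N \<pi> B (overwrite u I a) \<inter> J = lift \<pi> B J a \<inter> J"
    using assms by (auto simp: lift_def point_overwrite subset_iff)
  then show ?thesis by (simp add: average_outside_def)
qed

lemma bexp_learned_dist: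
  fixes B :: "'a set"
  assumes N: "finite N" and P: "finite P" "fst ` I \<subseteq> P" "\<pi> ` J \<subseteq> P"
    and I: "inj_on fst I" and J: "J \<subseteq> N" "inj_on \<pi> J"
  defines "J1 \<equiv> J \<inter> region N \<pi> B I"
  shows "bexp (1/2) P (\<lambda>u. learned_dist N f \<pi> B u I (\<lambda>a. average_outside N J1 f (lift \<pi> B J1 a)))
    \<le> 2 * bexp (1/2) P (\<lambda>u. (f (point N \<pi> B u) - average_outside N J f (point N \<pi> B u))\<^sup>2)
      + 2 * (\<Sum>T\<in>Pow N. of_bool (\<not> T \<subseteq> region N \<pi> B I) * weight N f T)"
proof -
  let ?g = "average_outside N J f" and ?g1 = "average_outside N J1 f"
  have "bexp (1/2) P (\<lambda>u. learned_dist N f \<pi> B u I (\<lambda>a. ?g1 (lift \<pi> B J1 a)))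
     = bexp (1/2) P (\<lambda>u. bexp (1/2) I (\<lambda>a. (\<lambda>v. (f (point N \<pi> B v) - ?g1 (point N \<pi> B v))\<^sup>2) (overwrite u I a)))"
    unfolding learned_dist_def
    by (intro bexp_cong) (simp add: average_outside_point_overwrite[OF I] J1_def)
  also have "\<dots> = bexp (1/2) P (\<lambda>u. (f (point N \<pi> B u) - ?g1 (point N \<pi> B u))\<^sup>2)"
    by (rule bexp_overwrite[OF P(1,2) I])
  also have "\<dots> \<le> 2 * bexp (1/2) P (\<lambda>u. (f (point N \<pi> B u) - ?g (point N \<pi> B u))\<^sup>2)
      + 2 * bexp (1/2) P (\<lambda>u. (?g (point N \<pi> B u) - ?g1 (point N \<pi> B u))\<^sup>2)"
    by (rule bexp_dist_triangle) auto
  also have "bexp (1/2) P (\<lambda>u. (?g (point N \<pi> B u) - ?g1 (point N \<pi> B u))\<^sup>2)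
      = bexp (1/2) P (\<lambda>u. (\<lambda>X. (?g X - ?g1 X)\<^sup>2) (point N \<pi> B u \<inter> J))"
    by (intro bexp_cong) (simp add: average_outside_inter J1_def)
  also have "\<dots> = bexp (1/2) N (\<lambda>X. (\<lambda>X. (?g X - ?g1 X)\<^sup>2) (X \<inter> J))"
    by (rule bexp_point_junta) (use assms in auto)
  also have "\<dots> = bexp (1/2) N (\<lambda>X. (?g X - ?g1 X)\<^sup>2)"
    by (intro bexp_cong) (simp add: average_outside_inter J1_def)
  also have "\<dots> = (\<Sum>T\<in>Pow N. of_bool (T \<subseteq> J \<and> \<not> T \<subseteq> J1) * weight N f T)"
    by (rule average_outside_dist) (use N J in \<open>auto simp: J1_def\<close>)
  also have "\<dots> \<le> (\<Sum>T\<in>Pow N. of_bool (\<not> T \<subseteq> region N \<pi> B I) * weight N f T)"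
    by (intro sum_mono mult_right_mono) (auto simp: J1_def)
  finally show ?thesis by simp
qed

lemma (in submodular_function) learned_function_submodular:
  assumes "J \<subseteq> N" "finite I"
  shows "submodular_function I (\<lambda>a. average_outside N J f (lift \<pi> B J a))"
  unfolding average_outside_def
proof (rule submodular_functionI_average)
  fix Z assume Z: "Z \<subseteq> N - J"
  show "submodular_function I (\<lambda>a. f (lift \<pi> B J a \<inter> J \<union> Z))"
  proof (rule submodular_functionI_pullback[where M = N])
    show "submodular_function N f" by unfold_locales
  qed (use assms Z in \<open>auto simp: lift_def\<close>)
qed (use fin in auto)

lemma submodular_extension:
  assumes N: "finite N" and I: "finite I" and h: "submodular_function I h"
    and J: "J \<subseteq> region N \<pi> B I" "inj_on \<pi> J"
  obtains H where "submodular_function N H"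
    "bexp (1/2) N (\<lambda>X. (average_outside N J f X - H X)\<^sup>2)
      \<le> bexp (1/2) I (\<lambda>a. (average_outside N J f (lift \<pi> B J a) - h a)\<^sup>2)"
proof -
  define key where "key j = (\<pi> j, j \<in> B)" for j
  have JN: "J \<subseteq> N" by (rule subset_trans[OF J(1) region_subset])
  have finJ: "finite J" by (rule finite_subset[OF JN N])
  have keyI: "key ` J \<subseteq> I"
  proof (rule image_subsetI)
    fix j assume "j \<in> J"
    then show "key j \<in> I" using subsetD[OF J(1)] by (simp add: key_def region_def)
  qed
  have inj: "inj_on key J"
    by (rule inj_onI) (use inj_onD[OF J(2)] in \<open>simp add: key_def\<close>)
  let ?I0 = "key ` J"
  let ?g = "average_outside N J f"
  define H where "H X = bexp (1/2) (I - ?I0) (\<lambda>c. h (key ` (X \<inter> J) \<union> c))" for X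
  have "submodular_function N H"
    unfolding H_def
  proof (rule submodular_functionI_average)
    fix Z assume Z: "Z \<subseteq> I - ?I0"
    show "submodular_function N (\<lambda>X. h (key ` (X \<inter> J) \<union> Z))"
    proof (rule submodular_functionI_pullback[OF h N])
      fix X Y
      have "key ` (X \<inter> J \<inter> (Y \<inter> J)) = key ` (X \<inter> J) \<inter> key ` (Y \<inter> J)"
        by (rule inj_on_image_Int[OF inj]) auto
      moreover have "X \<inter> J \<inter> (Y \<inter> J) = X \<inter> Y \<inter> J" by auto
      ultimately show "key ` (X \<inter> Y \<inter> J) \<union> Z = (key ` (X \<inter> J) \<union> Z) \<inter> (key ` (Y \<inter> J) \<union> Z)" by auto
    qed (use keyI Z in auto)
  qed (use I in auto)
  moreover have "bexp (1/2) N (\<lambda>X. (?g X - H X)\<^sup>2) \<le> bexp (1/2) I (\<lambda>a. (?g (lift \<pi> B J a) - h a)\<^sup>2)"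
  proof -
    define G where "G v = (?g (lift \<pi> B J v) - bexp (1/2) (I - ?I0) (\<lambda>c. h (v \<union> c)))\<^sup>2" for v
    have liftkey: "lift \<pi> B J (key ` Y) = Y" if "Y \<subseteq> J" for Y
    proof -
      have "key j \<in> key ` Y \<longleftrightarrow> j \<in> Y" if "j \<in> J" for j
        using inj_on_image_mem_iff[OF inj that \<open>Y \<subseteq> J\<close>] .
      then show ?thesis using that unfolding lift_def key_def[symmetric] by blast
    qed
    have "bexp (1/2) N (\<lambda>X. (?g X - H X)\<^sup>2) = bexp (1/2) N (\<lambda>X. (\<lambda>Y. G (key ` Y)) (X \<inter> J))"
      by (intro bexp_cong) (simp add: H_def G_def liftkey average_outside_inter)
    also have "\<dots> = bexp (1/2) J (\<lambda>Y. G (key ` Y))"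
      by (rule bexp_inter[OF N JN])
    also have "\<dots> = bexp (1/2) ?I0 G"
      by (rule bexp_half_image[OF finJ inj])
    also have "\<dots> \<le> bexp (1/2) ?I0 (\<lambda>v. bexp (1/2) (I - ?I0) (\<lambda>c. (?g (lift \<pi> B J (v \<union> c)) - h (v \<union> c))\<^sup>2))"
    proof (rule bexp_mono)
      fix v assume v: "v \<subseteq> ?I0"
      have "G v = (bexp (1/2) (I - ?I0) (\<lambda>c. ?g (lift \<pi> B J v) - h (v \<union> c)))\<^sup>2"
        using I by (simp add: G_def bexp_diff)
      also have "\<dots> \<le> bexp (1/2) (I - ?I0) (\<lambda>c. (?g (lift \<pi> B J v) - h (v \<union> c))\<^sup>2)"
        using I by (intro bexp_square_le) auto
      also have "\<dots> = bexp (1/2) (I - ?I0) (\<lambda>c. (?g (lift \<pi> B J (v \<union> c)) - h (v \<union> c))\<^sup>2)"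
      proof (rule bexp_cong)
        fix c assume c: "c \<subseteq> I - ?I0"
        have "key j \<notin> c" if "j \<in> J" for j using that c by auto
        then have "lift \<pi> B J (v \<union> c) = lift \<pi> B J v" by (auto simp: lift_def key_def)
        then show "(?g (lift \<pi> B J v) - h (v \<union> c))\<^sup>2 = (?g (lift \<pi> B J (v \<union> c)) - h (v \<union> c))\<^sup>2" by simp
      qed
      finally show "G v \<le> bexp (1/2) (I - ?I0) (\<lambda>c. (?g (lift \<pi> B J (v \<union> c)) - h (v \<union> c))\<^sup>2)" .
    qed auto
    also have "\<dots> = bexp (1/2) I (\<lambda>a. (?g (lift \<pi> B J a) - h a)\<^sup>2)"
      by (rule bexp_split[OF I keyI, symmetric])
    finally show ?thesis .
  qed
  ultimately show ?thesis by (rule that)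
qed

lemma close_to_submodular:
  fixes B :: "'a set"
  assumes N: "finite N" and I: "finite I" "inj_on fst I" and h: "submodular_function I h"
    and J: "J \<subseteq> N" "inj_on \<pi> J"
  defines "J1 \<equiv> J \<inter> region N \<pi> B I"
  assumes h_close: "learned_dist N f \<pi> B u I h \<le> \<theta>"
    and g_close: "learned_dist N f \<pi> B u I (\<lambda>a. average_outside N J1 f (lift \<pi> B J1 a)) \<le> \<theta>"
    and wJ: "(\<Sum>T\<in>Pow N. of_bool (\<not> T \<subseteq> J) * weight N f T) \<le> \<alpha>"
    and wI: "(\<Sum>T\<in>Pow N. of_bool (\<not> T \<subseteq> region N \<pi> B I) * weight N f T) \<le> \<beta>"
  obtains H where "submodular_function N H"
    "bexp (1/2) N (\<lambda>X. (f X - H X)\<^sup>2) \<le> 2 * (\<alpha> + \<beta>) + 8 * \<theta>"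
proof -
  let ?g = "average_outside N J1 f"
  have inj1: "inj_on \<pi> J1" using J by (auto simp: J1_def inj_on_def)
  obtain H where H: "submodular_function N H"
    "bexp (1/2) N (\<lambda>X. (?g X - H X)\<^sup>2) \<le> bexp (1/2) I (\<lambda>a. (?g (lift \<pi> B J1 a) - h a)\<^sup>2)"
    using submodular_extension[OF N I(1) h _ inj1] by (auto simp: J1_def)
  have "bexp (1/2) I (\<lambda>a. (?g (lift \<pi> B J1 a) - h a)\<^sup>2) \<le> 4 * \<theta>"
    using bexp_dist_triangle[of "1/2" I "\<lambda>a. ?g (lift \<pi> B J1 a)" h "\<lambda>a. f (point N \<pi> B (overwrite u I a))"]
      h_close g_close by (simp add: learned_dist_def power2_commute)
  then have gH: "bexp (1/2) N (\<lambda>X. (?g X - H X)\<^sup>2) \<le> 4 * \<theta>" using H by simp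
  have "bexp (1/2) N (\<lambda>X. (f X - ?g X)\<^sup>2) = (\<Sum>T\<in>Pow N. of_bool (\<not> T \<subseteq> J1) * weight N f T)"
    by (rule average_outside_dist_self) (use N J in \<open>auto simp: J1_def\<close>)
  also have "\<dots> \<le> (\<Sum>T\<in>Pow N. of_bool (\<not> T \<subseteq> J) * weight N f T
       + of_bool (\<not> T \<subseteq> region N \<pi> B I) * weight N f T)"
    by (intro sum_mono) (auto simp: J1_def)
  also have "\<dots> \<le> \<alpha> + \<beta>" using wJ wI by (simp add: sum.distrib)
  finally have "bexp (1/2) N (\<lambda>X. (f X - ?g X)\<^sup>2) \<le> \<alpha> + \<beta>" .
  then have "bexp (1/2) N (\<lambda>X. (f X - H X)\<^sup>2) \<le> 2 * (\<alpha> + \<beta>) + 8 * \<theta>"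
    using bexp_dist_triangle[of "1/2" N f H ?g] gH by simp
  then show ?thesis using that H by blast
qed

section \<open>Random subsets, partitions and samples\<close>

lemma prob_pair_pmf_le_fst:
  assumes "\<And>a. a \<in> set_pmf A \<Longrightarrow> measure_pmf.prob B {b. P a b} \<le> c" "0 \<le> c"
  shows "measure_pmf.prob (pair_pmf A B) {x. P (fst x) (snd x)} \<le> c"
proof -
  let ?X = "{x. P (fst x) (snd x)}"
  have "emeasure (pair_pmf A B) ?X = (\<integral>\<^sup>+x. indicator ?X x \<partial>pair_pmf A B)"
    by simp
  also have "\<dots> = (\<integral>\<^sup>+a. \<integral>\<^sup>+b. indicator {b. P a b} b \<partial>B \<partial>A)"
    unfolding nn_integral_pair_pmf'
    by (intro nn_integral_cong) (simp add: indicator_def)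
  also have "\<dots> = (\<integral>\<^sup>+a. emeasure B {b. P a b} \<partial>A)"
    by simp
  also have "\<dots> \<le> (\<integral>\<^sup>+a. ennreal c \<partial>A)"
    using assms by (intro nn_integral_mono_AE) (auto simp: AE_measure_pmf_iff measure_pmf.emeasure_eq_measure ennreal_leI)
  also have "\<dots> = ennreal c" by simp
  finally show ?thesis
    using assms(2) by (simp add: measure_pmf.emeasure_eq_measure)
qed

lemma prob_pair_pmf_le_snd:
  assumes "\<And>b. b \<in> set_pmf B \<Longrightarrow> measure_pmf.prob A {a. P a b} \<le> c" "0 \<le> c"
  shows "measure_pmf.prob (pair_pmf A B) {x. P (fst x) (snd x)} \<le> c"
proof -
  have "measure_pmf.prob (pair_pmf A B) {x. P (fst x) (snd x)}
     = measure_pmf.prob (pair_pmf B A) {x. P (snd x) (fst x)}"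
    by (subst pair_commute_pmf) (auto simp: vimage_def case_prod_beta)
  also have "\<dots> \<le> c"
    using prob_pair_pmf_le_fst[of B A "\<lambda>b a. P a b"] assms by simp
  finally show ?thesis .
qed

lemma prob_mono_support:
  assumes "\<And>x. x \<in> set_pmf p \<Longrightarrow> x \<in> A \<Longrightarrow> x \<in> B"
  shows "measure_pmf.prob p A \<le> measure_pmf.prob p B"
proof -
  have "measure_pmf.prob p A = measure_pmf.prob p (A \<inter> set_pmf p)"
    by (simp add: measure_Int_set_pmf)
  also have "\<dots> \<le> measure_pmf.prob p B"
    using assms by (intro measure_pmf.finite_measure_mono) auto
  finally show ?thesis .
qed

lemma markov_pmf:
  fixes F :: "'a \<Rightarrow> real"
  assumes "finite (set_pmf p)" "\<And>x. x \<in> set_pmf p \<Longrightarrow> 0 \<le> F x" "0 < c"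
  shows "measure_pmf.prob p {x. F x > c} \<le> measure_pmf.expectation p F / c"
proof -
  have "measure_pmf.prob p {x. F x > c} = measure_pmf.expectation p (indicator {x. F x > c})"
    by simp
  also have "\<dots> \<le> measure_pmf.expectation p (\<lambda>x. F x / c)"
    using assms
    by (intro integral_mono_AE integrable_measure_pmf_finite)
       (auto simp: AE_measure_pmf_iff indicator_def field_simps)
  finally show ?thesis by simp
qed

lemma expectation_pair_pmf_finite:
  fixes F :: "'a \<times> 'b \<Rightarrow> real"
  assumes "finite (set_pmf A)" "finite (set_pmf B)"
  shows "measure_pmf.expectation (pair_pmf A B) F
     = measure_pmf.expectation A (\<lambda>a. measure_pmf.expectation B (\<lambda>b. F (a, b)))"
proof -
  have "measure_pmf.expectation (pair_pmf A B) F
      = (\<Sum>x\<in>set_pmf A \<times> set_pmf B. F x * pmf (pair_pmf A B) x)"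
    using assms by (intro integral_measure_pmf_real) auto
  also have "\<dots> = (\<Sum>a\<in>set_pmf A. \<Sum>b\<in>set_pmf B. F (a, b) * (pmf A a * pmf B b))"
    by (simp add: sum.cartesian_product case_prod_beta flip: pmf_pair)
  also have "\<dots> = (\<Sum>a\<in>set_pmf A. measure_pmf.expectation B (\<lambda>b. F (a, b)) * pmf A a)"
    using assms
    by (intro sum.cong refl, subst integral_measure_pmf_real[of "set_pmf B"])
       (auto simp: sum_distrib_right sum_distrib_left mult_ac)
  also have "\<dots> = measure_pmf.expectation A (\<lambda>a. measure_pmf.expectation B (\<lambda>b. F (a, b)))"
    using assms by (intro integral_measure_pmf_real[symmetric]) auto
  finally show ?thesis .
qed

definition subset_pmf :: "real \<Rightarrow> 'a set \<Rightarrow> 'a set pmf" where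
  "subset_pmf p N = map_pmf (\<lambda>b. {j \<in> N. b j}) (Pi_pmf N False (\<lambda>_. bernoulli_pmf p))"

lemma set_subset_pmf: "set_pmf (subset_pmf p N) \<subseteq> Pow N"
  by (auto simp: subset_pmf_def)

lemma finite_set_subset_pmf: "finite N \<Longrightarrow> finite (set_pmf (subset_pmf p N))"
  using set_subset_pmf finite_subset by (metis finite_Pow_iff)

lemma pmf_subset_pmf:
  assumes "finite N" "X \<subseteq> N" "0 < p" "p < 1"
  shows "pmf (subset_pmf p N) X = p ^ card X * (1 - p) ^ card (N - X)"
proof -
  let ?P = "Pi_pmf N False (\<lambda>_. bernoulli_pmf p)"
  let ?x = "\<lambda>j. j \<in> X"
  have inj: "inj_on (\<lambda>b. {j \<in> N. b j}) (set_pmf ?P)"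
    using set_Pi_pmf_subset[OF assms(1), of False "\<lambda>_. bernoulli_pmf p"]
    by (intro inj_onI ext) (blast)
  have x: "?x \<in> set_pmf ?P"
    using assms by (auto simp: set_Pi_pmf PiE_dflt_def set_pmf_bernoulli)
  have X: "{j \<in> N. ?x j} = X" using assms by auto
  have "pmf (subset_pmf p N) X = pmf ?P ?x"
    unfolding subset_pmf_def using pmf_map_inj[OF inj x] X by simp
  also have "\<dots> = (\<Prod>j\<in>N. if j \<in> X then p else 1 - p)"
    using assms by (subst pmf_Pi') (auto intro!: prod.cong)
  also have "\<dots> = p ^ card X * (1 - p) ^ card (N - X)"
    using assms by (simp add: prod.If_cases Int_absorb1 Diff_eq)
  finally show ?thesis .
qed

lemma expectation_subset_pmf:
  assumes "finite N" "0 < p" "p < 1"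
  shows "measure_pmf.expectation (subset_pmf p N) F = bexp p N F"
proof -
  have "measure_pmf.expectation (subset_pmf p N) F = (\<Sum>X\<in>Pow N. F X * pmf (subset_pmf p N) X)"
    using assms set_subset_pmf[of p N] by (intro integral_measure_pmf_real) auto
  then show ?thesis
    using assms by (simp add: bexp_def pmf_subset_pmf mult.commute)
qed

lemma prob_sample_mean_deviation:
  fixes G :: "'a \<Rightarrow> real" and M :: nat and \<epsilon> :: real
  assumes G: "\<And>x. x \<in> set_pmf p \<Longrightarrow> 0 \<le> G x \<and> G x \<le> 1" and M: "M > 0" and \<epsilon>: "0 \<le> \<epsilon>"
  shows "measure_pmf.prob (Pi_pmf {..<M} d (\<lambda>_. p))
      {t. \<bar>(\<Sum>i<M. G (t i)) / M - measure_pmf.expectation p G\<bar> \<ge> \<epsilon>} \<le> 2 * exp (- 2 * M * \<epsilon>\<^sup>2)"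
proof -
  let ?P = "Pi_pmf {..<M} d (\<lambda>_. p)"
  have comp: "map_pmf (\<lambda>t. t i) ?P = p" if "i < M" for i
    using that by (subst Pi_pmf_component) auto
  interpret Hoeffding_ineq_iid ?P "{..<M}" "\<lambda>i t. G (t i)" "\<lambda>t. G (t 0)" 0 1 "measure_pmf.expectation p G"
  proof unfold_locales
    show "prob_space.indep_vars (measure_pmf ?P) (\<lambda>_. borel) (\<lambda>i t. G (t i)) {..<M}"
      by (intro prob_space.indep_vars_compose2[OF _ indep_vars_Pi_pmf])
         (auto simp: measure_pmf.prob_space_axioms)
    have d: "distr (measure_pmf ?P) borel (\<lambda>t. G (t i)) = distr (measure_pmf p) borel G" if "i < M" for i
    proof -
      have "distr (measure_pmf ?P) borel (\<lambda>t. G (t i)) = distr (measure_pmf (map_pmf (\<lambda>t. t i) ?P)) borel G"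
        unfolding map_pmf_rep_eq by (subst distr_distr) (auto simp: o_def)
      then show ?thesis using comp[OF that] by simp
    qed
    show "distr (measure_pmf ?P) borel (\<lambda>t. G (t i)) = distr (measure_pmf ?P) borel (\<lambda>t. G (t 0))"
      if "i \<in> {..<M}" for i
      using d M that by simp
    show "AE t in measure_pmf ?P. G (t 0) \<in> {0..1}"
    proof -
      have "t 0 \<in> set_pmf p" if "t \<in> set_pmf ?P" for t
        using comp[OF M] that by (metis (no_types, lifting) image_eqI pmf.set_map)
      then show ?thesis using G by (auto simp: AE_measure_pmf_iff)
    qed
    have "measure_pmf.expectation p G = measure_pmf.expectation (map_pmf (\<lambda>t. t 0) ?P) G"
      using comp[OF M] by simp
    then show "measure_pmf.expectation p G \<equiv> measure_pmf.expectation ?P (\<lambda>t. G (t 0))"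
      by simp
  qed simp_all
  have "{..<M} \<noteq> {}" using M by auto
  then show ?thesis
    using Hoeffding_ineq_abs_ge'[OF \<epsilon>] by simp
qed

lemma prob_partition_collision:
  assumes "finite N" "i \<in> N" "j \<in> N" "i \<noteq> j" "s > 0"
  shows "measure_pmf.prob (Pi_pmf N d (\<lambda>_. pmf_of_set {..<s})) {\<pi>. \<pi> i = \<pi> j} \<le> 1 / real s"
proof -
  define N' where "N' = N - {i}"
  have N: "N = insert i N'" "i \<notin> N'" "finite N'" using assms by (auto simp: N'_def)
  have "measure_pmf.prob (Pi_pmf N d (\<lambda>_. pmf_of_set {..<s})) {\<pi>. \<pi> i = \<pi> j}
     = measure_pmf.prob (pair_pmf (pmf_of_set {..<s}) (Pi_pmf N' d (\<lambda>_. pmf_of_set {..<s})))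
         {x. fst x = snd x j}"
    unfolding N(1) Pi_pmf_insert[OF N(3,2)] using assms(4)
    by (simp add: vimage_def case_prod_beta)
  also have "\<dots> \<le> 1 / real s"
  proof (rule prob_pair_pmf_le_snd)
    fix \<pi> :: "'a \<Rightarrow> nat"
    have "measure_pmf.prob (pmf_of_set {..<s}) {a. a = \<pi> j} = card ({..<s} \<inter> {\<pi> j}) / s"
      using assms by (subst measure_pmf_of_set) auto
    also have "\<dots> \<le> 1 / s"
    proof (intro divide_right_mono)
      have "card ({..<s} \<inter> {\<pi> j}) \<le> card {\<pi> j}" by (intro card_mono) auto
      then show "real (card ({..<s} \<inter> {\<pi> j})) \<le> 1" by simp
    qed auto
    finally show "measure_pmf.prob (pmf_of_set {..<s}) {a. a = \<pi> j} \<le> 1 / real s" .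
  qed auto
  finally show ?thesis .
qed

lemma prob_partition_not_inj:
  fixes s :: nat
  assumes "finite N" "J \<subseteq> N" "s > 0"
  shows "measure_pmf.prob (Pi_pmf N d (\<lambda>_. pmf_of_set {..<s})) {\<pi>. \<not> inj_on \<pi> J} \<le> (real (card J))\<^sup>2 / s"
proof -
  let ?P = "Pi_pmf N d (\<lambda>_. pmf_of_set {..<s})"
  define D where "D = {(i, j). i \<in> J \<and> j \<in> J \<and> i \<noteq> j}"
  have finJ: "finite J" by (rule finite_subset[OF assms(2,1)])
  have "D \<subseteq> J \<times> J" by (auto simp: D_def)
  then have finD: "finite D" and cD: "card D \<le> card J * card J"
    using finJ card_mono[of "J \<times> J" D] by (auto simp: finite_subset card_cartesian_product)
  have "measure_pmf.prob ?P {\<pi>. \<not> inj_on \<pi> J} = measure_pmf.prob ?P (\<Union>x\<in>D. {\<pi>. \<pi> (fst x) = \<pi> (snd x)})"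
    by (rule arg_cong[where f = "measure_pmf.prob ?P"]) (force simp: inj_on_def D_def)
  also have "\<dots> \<le> (\<Sum>x\<in>D. measure_pmf.prob ?P {\<pi>. \<pi> (fst x) = \<pi> (snd x)})"
    by (rule measure_pmf.finite_measure_subadditive_finite[OF finD]) auto
  also have "\<dots> \<le> (\<Sum>x\<in>D. 1 / real s)"
    using assms by (intro sum_mono prob_partition_collision) (auto simp: D_def)
  also have "\<dots> = real (card D) / s" by simp
  also have "\<dots> \<le> (real (card J))\<^sup>2 / s"
  proof (rule divide_right_mono)
    have "real (card D) \<le> real (card J * card J)" using cD by linarith
    then show "real (card D) \<le> (real (card J))\<^sup>2" by (simp add: power2_eq_square)
  qed simp
  finally show ?thesis .
qed

lemma finite_set_partition_pmf:
  fixes N :: "'a set"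
  assumes "finite N" "s > 0"
  shows "finite (set_pmf (Pi_pmf N d (\<lambda>_. pmf_of_set {..<s::nat})))"
    and "\<pi> \<in> set_pmf (Pi_pmf N d (\<lambda>_. pmf_of_set {..<s})) \<Longrightarrow> \<pi> ` N \<subseteq> {..<s}"
proof -
  have [simp]: "set_pmf (pmf_of_set {..<s}) = {..<s}"
    using assms by (intro set_pmf_of_set) auto
  show "finite (set_pmf (Pi_pmf N d (\<lambda>_. pmf_of_set {..<s})))"
    using assms by (auto simp: set_Pi_pmf)
  show "\<pi> ` N \<subseteq> {..<s}" if "\<pi> \<in> set_pmf (Pi_pmf N d (\<lambda>_. pmf_of_set {..<s}))"
    using that assms by (auto simp: set_Pi_pmf PiE_dflt_def)
qed

text \<open>Second moment: the expected sum of the squared part weights exceeds \<open>\<Sum>j\<in>N. (w j)\<^sup>2\<close> only by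
  the colliding pairs.\<close>

lemma prob_heavy_part:
  fixes w :: "'a \<Rightarrow> real" and s :: nat
  assumes N: "finite N" and s: "s > 0" and c: "c > 0"
    and w: "\<And>j. j \<in> N \<Longrightarrow> 0 \<le> w j" "\<And>j. j \<in> N \<Longrightarrow> w j \<le> t" and t: "0 \<le> t"
    and L: "(\<Sum>j\<in>N. w j) \<le> L"
    and N': "N \<subseteq> N'" "finite N'"
  shows "measure_pmf.prob (Pi_pmf N' d (\<lambda>_. pmf_of_set {..<s})) {\<pi>. \<exists>i<s. (\<Sum>j\<in>{j\<in>N. \<pi> j = i}. w j) > c}
     \<le> (t * L + L\<^sup>2 / s) / c\<^sup>2"
proof -
  let ?P = "Pi_pmf N' d (\<lambda>_. pmf_of_set {..<s})"
  define S where "S \<pi> i = (\<Sum>j\<in>{j\<in>N. \<pi> j = i}. w j)" for \<pi> :: "'a \<Rightarrow> nat" and i :: nat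
  define Q where "Q \<pi> = (\<Sum>i<s. (S \<pi> i)\<^sup>2)" for \<pi> :: "'a \<Rightarrow> nat"
  note finP = finite_set_partition_pmf(1)[OF N'(2) s, of d]
  have L0: "0 \<le> L" using L w(1) by (meson order_trans sum_nonneg)
  have Q: "Q \<pi> = (\<Sum>j\<in>N. \<Sum>l\<in>N. w j * w l * of_bool (\<pi> j = \<pi> l))" if "\<pi> \<in> set_pmf ?P" for \<pi>
  proof -
    have "S \<pi> i = (\<Sum>j\<in>N. w j * of_bool (\<pi> j = i))" for i
      unfolding S_def using N by (simp add: sum.If_cases of_bool_def Collect_conj_eq if_distrib cong: if_cong)
    then have "Q \<pi> = (\<Sum>i<s. \<Sum>j\<in>N. \<Sum>l\<in>N. w j * w l * (of_bool (\<pi> j = i) * of_bool (\<pi> l = i)))"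
      by (simp add: Q_def power2_eq_square sum_product algebra_simps)
    also have "\<dots> = (\<Sum>j\<in>N. \<Sum>l\<in>N. \<Sum>i<s. w j * w l * (of_bool (\<pi> j = i) * of_bool (\<pi> l = i)))"
      by (subst sum.swap, rule sum.cong[OF refl], subst sum.swap, rule refl)
    also have "\<dots> = (\<Sum>j\<in>N. \<Sum>l\<in>N. w j * w l * of_bool (\<pi> j = \<pi> l))"
    proof (intro sum.cong refl)
      fix j l assume jl: "j \<in> N" "l \<in> N"
      have "\<pi> j \<in> {..<s}" using finite_set_partition_pmf(2)[OF N'(2) s that] jl N' by auto
      have "(\<Sum>i<s. w j * w l * (of_bool (\<pi> j = i) * of_bool (\<pi> l = i)))
        = (\<Sum>i<s. if \<pi> j = i then w j * w l * of_bool (\<pi> j = \<pi> l) else 0)"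
        by (intro sum.cong) auto
      then show "(\<Sum>i<s. w j * w l * (of_bool (\<pi> j = i) * of_bool (\<pi> l = i))) = w j * w l * of_bool (\<pi> j = \<pi> l)"
        using \<open>\<pi> j \<in> {..<s}\<close> by simp
    qed
    finally show ?thesis .
  qed
  have "measure_pmf.expectation ?P Q
      = measure_pmf.expectation ?P (\<lambda>\<pi>. \<Sum>j\<in>N. \<Sum>l\<in>N. w j * w l * of_bool (\<pi> j = \<pi> l))"
    by (rule integral_cong_AE) (auto simp: AE_measure_pmf_iff Q)
  also have "\<dots> = (\<Sum>j\<in>N. \<Sum>l\<in>N. w j * w l * measure_pmf.expectation ?P (\<lambda>\<pi>. of_bool (\<pi> j = \<pi> l)))"
    using finP by (simp add: integrable_measure_pmf_finite)
  also have "\<dots> = (\<Sum>j\<in>N. \<Sum>l\<in>N. w j * w l * measure_pmf.prob ?P {\<pi>. \<pi> j = \<pi> l})"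
  proof (intro sum.cong refl arg_cong2[where f = "(*)"])
    fix j l
    have eq: "(\<lambda>\<pi>. of_bool (\<pi> j = \<pi> l) :: real) = indicator {\<pi> :: 'a \<Rightarrow> nat. \<pi> j = \<pi> l}"
      by (auto simp: indicator_def)
    show "measure_pmf.expectation ?P (\<lambda>\<pi>. of_bool (\<pi> j = \<pi> l)) = measure_pmf.prob ?P {\<pi>. \<pi> j = \<pi> l}"
      unfolding eq by simp
  qed
  also have "\<dots> \<le> (\<Sum>j\<in>N. \<Sum>l\<in>N. (if j = l then t * w j else 0) + w j * w l * (1 / s))"
  proof (intro sum_mono)
    fix j l assume jl: "j \<in> N" "l \<in> N"
    show "w j * w l * measure_pmf.prob ?P {\<pi>. \<pi> j = \<pi> l} \<le> (if j = l then t * w j else 0) + w j * w l * (1 / s)"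
    proof (cases "j = l")
      case True
      have "w j * w j \<le> t * w j" using w jl by (intro mult_right_mono) auto
      then show ?thesis using True by (simp add: add_increasing2)
    next
      case False
      have "measure_pmf.prob ?P {\<pi>. \<pi> j = \<pi> l} \<le> 1 / s"
        using prob_partition_collision[OF N'(2) _ _ False s] jl N' by auto
      then show ?thesis using False w jl by (simp only: if_False add_0) (intro mult_left_mono; simp)
    qed
  qed
  also have "\<dots> = t * (\<Sum>j\<in>N. w j) + (\<Sum>j\<in>N. \<Sum>l\<in>N. w j * w l * (1 / s))"
    using N by (simp add: sum.distrib sum_distrib_left)
  also have "(\<Sum>j\<in>N. \<Sum>l\<in>N. w j * w l * (1 / s)) = (\<Sum>j\<in>N. w j)\<^sup>2 / s"
    unfolding power2_eq_square sum_product sum_divide_distrib by simp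
  also have "t * (\<Sum>j\<in>N. w j) + (\<Sum>j\<in>N. w j)\<^sup>2 / s \<le> t * L + L\<^sup>2 / s"
    using t L w(1) by (intro add_mono mult_left_mono divide_right_mono power_mono sum_nonneg) auto
  finally have EQ: "measure_pmf.expectation ?P Q \<le> t * L + L\<^sup>2 / s" .
  have "measure_pmf.prob ?P {\<pi>. \<exists>i<s. S \<pi> i > c} \<le> measure_pmf.prob ?P {\<pi>. Q \<pi> > c\<^sup>2}"
  proof (rule measure_pmf.finite_measure_mono)
    show "{\<pi>. \<exists>i<s. S \<pi> i > c} \<subseteq> {\<pi>. Q \<pi> > c\<^sup>2}"
    proof safe
      fix \<pi> i assume i: "i < s" "S \<pi> i > c"
      have "c\<^sup>2 < (S \<pi> i)\<^sup>2" using i c by (intro power_strict_mono) auto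
      also have "\<dots> \<le> Q \<pi>" unfolding Q_def using i by (intro member_le_sum) auto
      finally show "c\<^sup>2 < Q \<pi>" .
    qed
  qed auto
  also have "\<dots> \<le> measure_pmf.expectation ?P Q / c\<^sup>2"
    using finP c by (intro markov_pmf) (auto simp: Q_def intro!: sum_nonneg)
  also have "\<dots> \<le> (t * L + L\<^sup>2 / s) / c\<^sup>2"
    using EQ by (intro divide_right_mono) auto
  finally show ?thesis by (simp add: S_def)
qed

section \<open>The test on set functions\<close>

definition codes :: "nat \<Rightarrow> nat \<Rightarrow> (nat \<times> bool) set set" where
  "codes s k = {I. I \<subseteq> {..<s} \<times> UNIV \<and> card I \<le> k \<and> inj_on fst I}"

definition rerandomize :: "'a set \<Rightarrow> 'a set \<times> 'a set \<times> 'a set \<Rightarrow> 'a set" where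
  "rerandomize U = (\<lambda>(R, X, Z). X \<inter> (R \<inter> U) \<union> (Z - R \<inter> U))"

definition triple_pmf :: "real \<Rightarrow> 'a set \<Rightarrow> ('a set \<times> 'a set \<times> 'a set) pmf" where
  "triple_pmf \<rho> N = pair_pmf (subset_pmf \<rho> N) (pair_pmf (subset_pmf (1/2) N) (subset_pmf (1/2) N))"

definition estimate :: "nat \<Rightarrow> ('a set \<Rightarrow> real) \<Rightarrow> 'a set \<Rightarrow> (nat \<Rightarrow> 'a set \<times> 'a set \<times> 'a set) \<Rightarrow> real" where
  "estimate M f U t = (\<Sum>i<M. (f (fst (snd (t i))) - f (rerandomize U (t i)))\<^sup>2) / M"

lemma codes_subset: "codes s k \<subseteq> Pow ({..<s} \<times> UNIV)"
  by (auto simp: codes_def)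

lemma finite_codes: "finite (codes s k)"
  by (rule finite_subset[OF codes_subset]) simp

lemma codesD:
  assumes "I \<in> codes s k"
  shows "finite I" "fst ` I \<subseteq> {..<s}" "card I \<le> k" "inj_on fst I" "card (fst ` I) \<le> k"
proof -
  have I: "I \<subseteq> {..<s} \<times> UNIV" "card I \<le> k" "inj_on fst I" using assms by (auto simp: codes_def)
  show "finite I" by (rule finite_subset[OF I(1)]) simp
  show "fst ` I \<subseteq> {..<s}" using I(1) by auto
  show "card I \<le> k" "inj_on fst I" by fact+
  then show "card (fst ` I) \<le> k" by (simp add: card_image)
qed

lemma set_triple_pmf:
  assumes "x \<in> set_pmf (triple_pmf \<rho> N)"
  shows "fst (snd x) \<subseteq> N" "rerandomize U x \<subseteq> N"
  using assms set_subset_pmf[of _ N]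
  by (fastforce simp: triple_pmf_def rerandomize_def)+

lemma expectation_triple_pmf:
  assumes "finite N" "0 < \<rho>" "\<rho> < 1" "U \<subseteq> N"
  shows "measure_pmf.expectation (triple_pmf \<rho> N) (\<lambda>x. (f (fst (snd x)) - f (rerandomize U x))\<^sup>2)
    = noisy_dist \<rho> N U f"
proof -
  have "measure_pmf.expectation (triple_pmf \<rho> N) (\<lambda>x. (f (fst (snd x)) - f (rerandomize U x))\<^sup>2)
     = bexp \<rho> N (\<lambda>R. bexp (1/2) N (\<lambda>X. bexp (1/2) N (\<lambda>Z. (f X - f (X \<inter> (R \<inter> U) \<union> (Z - R \<inter> U)))\<^sup>2)))"
    using assms
    by (simp add: triple_pmf_def expectation_pair_pmf_finite finite_set_subset_pmf
        expectation_subset_pmf rerandomize_def)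
  then show ?thesis using noisy_dist_eq[OF assms(1,4)] by simp
qed

locale submodularity_test =
  fixes N :: "'a set" and s k M :: nat and \<rho> \<tau> :: real
  assumes fin: "finite N" and k: "k > 0" and M: "M > 0"
    and \<tau>: "0 < \<tau>" "\<tau> < 1" and \<rho>: "\<rho> = 1 - \<tau> / k"
    and s_large: "32000 * (k / \<tau>) ^ 8 \<le> s"
    and M_large: "40 * card (codes s k) * exp (- 2 * M * \<tau>\<^sup>2) \<le> 1"
begin

definition partitions :: "('a \<Rightarrow> nat) pmf" where
  "partitions = Pi_pmf N 0 (\<lambda>_. pmf_of_set {..<s})"

definition samples :: "(nat \<Rightarrow> 'a set \<times> 'a set \<times> 'a set) pmf" where
  "samples = Pi_pmf {..<M} ({}, {}, {}) (\<lambda>_. triple_pmf \<rho> N)"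

definition seeds :: "(('a \<Rightarrow> nat) \<times> 'a set \<times> (nat \<Rightarrow> 'a set \<times> 'a set \<times> 'a set) \<times> nat set) pmf" where
  "seeds = pair_pmf partitions (pair_pmf (subset_pmf (1/2) N) (pair_pmf samples (subset_pmf (1/2) {..<s})))"

definition passes where
  "passes f \<pi> B t I \<longleftrightarrow> I \<in> codes s k \<and> estimate M f (region N \<pi> B I) t \<le> 5 * \<tau>"

definition chosen where
  "chosen f \<pi> B t = (SOME I. passes f \<pi> B t I)"

text \<open>\<open>chosen\<close> depends on neither \<open>u\<close> nor the answers at the points of \<open>u\<close>, so Markov's inequality
  over \<open>u\<close> applies to the chosen set alone and no union bound over the \<open>2 ^ 2 ^ k\<close> tables is needed.
  When nothing passes it is a junk value, which \<open>accept\<close> guards against.\<close>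

definition accept where
  "accept f = (\<lambda>(\<pi>, B, t, u). (\<exists>I. passes f \<pi> B t I) \<and>
     (\<exists>h. submodular_function (chosen f \<pi> B t) h \<and>
        learned_dist N f \<pi> B u (chosen f \<pi> B t) h \<le> 3320 * \<tau>))"

definition accurate where
  "accurate f \<pi> B t \<longleftrightarrow>
     (\<forall>I\<in>codes s k. \<bar>estimate M f (region N \<pi> B I) t - noisy_dist \<rho> N (region N \<pi> B I) f\<bar> \<le> \<tau>)"

lemma \<rho>01: "0 < \<rho>" "\<rho> < 1"
  using \<tau> k unfolding \<rho> by (auto simp: divide_less_eq)

lemma kt: "1 \<le> k / \<tau>"
  using \<tau> k by (simp add: le_divide_eq)

lemma s_pos: "s > 0"
proof -
  have "1 \<le> (k / \<tau>) ^ 8" using kt by simp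
  then have "0 < real s" using s_large by linarith
  then show ?thesis by simp
qed

lemma chosen_passes: "passes f \<pi> B t I \<Longrightarrow> passes f \<pi> B t (chosen f \<pi> B t)"
  unfolding chosen_def by (rule someI)

lemma partitions_range: "\<pi> \<in> set_pmf partitions \<Longrightarrow> \<pi> ` N \<subseteq> {..<s}"
  unfolding partitions_def using finite_set_partition_pmf(2)[OF fin s_pos] by auto

lemma prob_seeds_partition:
  assumes "measure_pmf.prob partitions {\<pi>. P \<pi>} \<le> c" "0 \<le> c"
  shows "measure_pmf.prob seeds {(\<pi>, B, t, u). P \<pi>} \<le> c"
  unfolding seeds_def case_prod_unfold
  by (rule prob_pair_pmf_le_snd) (use assms in auto)

lemma prob_seeds_base:
  assumes "\<And>\<pi>. measure_pmf.prob (subset_pmf (1/2) N) {B. P \<pi> B} \<le> c" "0 \<le> c"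
  shows "measure_pmf.prob seeds {(\<pi>, B, t, u). P \<pi> B} \<le> c"
  unfolding seeds_def case_prod_unfold
  by (rule prob_pair_pmf_le_fst[where P = "\<lambda>\<pi> x. P \<pi> (fst x)"],
      rule prob_pair_pmf_le_snd[where P = "\<lambda>B _. P \<pi> B" for \<pi>]) (use assms in auto)

lemma prob_seeds_samples:
  assumes "\<And>\<pi> B. measure_pmf.prob samples {t. P \<pi> B t} \<le> c" "0 \<le> c"
  shows "measure_pmf.prob seeds {(\<pi>, B, t, u). P \<pi> B t} \<le> c"
  unfolding seeds_def case_prod_unfold
  by (rule prob_pair_pmf_le_fst[where P = "\<lambda>\<pi> x. P \<pi> (fst x) (fst (snd x))"],
      rule prob_pair_pmf_le_fst[where P = "\<lambda>B x. P \<pi> B (fst x)" for \<pi>],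
      rule prob_pair_pmf_le_snd[where P = "\<lambda>t _. P \<pi> B t" for \<pi> B]) (use assms in auto)

lemma prob_seeds_assignment:
  assumes "\<And>\<pi> B t. \<pi> \<in> set_pmf partitions \<Longrightarrow> B \<subseteq> N \<Longrightarrow>
      measure_pmf.prob (subset_pmf (1/2) {..<s}) {u. P \<pi> B t u} \<le> c" "0 \<le> c"
  shows "measure_pmf.prob seeds {(\<pi>, B, t, u). P \<pi> B t u} \<le> c"
  unfolding seeds_def case_prod_unfold
  by (rule prob_pair_pmf_le_fst[where P = "\<lambda>\<pi> x. P \<pi> (fst x) (fst (snd x)) (snd (snd x))"],
      rule prob_pair_pmf_le_fst[where P = "\<lambda>B x. P \<pi> B (fst x) (snd x)" for \<pi>],
      rule prob_pair_pmf_le_fst[where P = "\<lambda>t u. P \<pi> B t u" for \<pi> B])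
     (use assms set_subset_pmf[of "1/2" N] in auto)

context
  fixes f :: "'a set \<Rightarrow> real"
  assumes f01: "\<And>X. X \<subseteq> N \<Longrightarrow> 0 \<le> f X \<and> f X \<le> 1"
begin

lemma f_abs: "X \<subseteq> N \<Longrightarrow> \<bar>f X\<bar> \<le> 1"
  using f01[of X] by auto

lemma prob_not_accurate:
  "measure_pmf.prob seeds {(\<pi>, B, t, u). \<not> accurate f \<pi> B t} \<le> 1 / 20"
proof (rule prob_seeds_samples)
  fix \<pi> :: "'a \<Rightarrow> nat" and B :: "'a set"
  let ?U = "region N \<pi> B"
  let ?bad = "\<lambda>I. {t. \<bar>estimate M f (?U I) t - noisy_dist \<rho> N (?U I) f\<bar> \<ge> \<tau>}"
  have one: "measure_pmf.prob samples (?bad I) \<le> 2 * exp (- 2 * M * \<tau>\<^sup>2)" for I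
  proof -
    let ?G = "\<lambda>x. (f (fst (snd x)) - f (rerandomize (?U I) x))\<^sup>2"
    have "0 \<le> ?G x \<and> ?G x \<le> 1" if "x \<in> set_pmf (triple_pmf \<rho> N)" for x
      using f01[OF set_triple_pmf(1)[OF that]] f01[OF set_triple_pmf(2)[OF that, of "?U I"]]
      by (auto simp: abs_square_le_1 abs_le_iff)
    then have "measure_pmf.prob samples {t. \<bar>(\<Sum>i<M. ?G (t i)) / M
        - measure_pmf.expectation (triple_pmf \<rho> N) ?G\<bar> \<ge> \<tau>} \<le> 2 * exp (- 2 * M * \<tau>\<^sup>2)"
      unfolding samples_def using M \<tau> by (intro prob_sample_mean_deviation) auto
    then show ?thesis
      using expectation_triple_pmf[OF fin \<rho>01 region_subset, of f \<pi> B I] by (simp add: estimate_def)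
  qed
  have "measure_pmf.prob samples {t. \<not> accurate f \<pi> B t} \<le> measure_pmf.prob samples (\<Union>I\<in>codes s k. ?bad I)"
    by (intro measure_pmf.finite_measure_mono) (auto simp: accurate_def not_le)
  also have "\<dots> \<le> (\<Sum>I\<in>codes s k. measure_pmf.prob samples (?bad I))"
    by (rule measure_pmf.finite_measure_subadditive_finite[OF finite_codes]) auto
  also have "\<dots> \<le> (\<Sum>I\<in>codes s k. 2 * exp (- 2 * M * \<tau>\<^sup>2))"
    by (intro sum_mono one)
  also have "\<dots> \<le> 1 / 20" using M_large by simp
  finally show "measure_pmf.prob samples {t. \<not> accurate f \<pi> B t} \<le> 1 / 20" .
qed simp

lemma passes_weight:
  assumes "accurate f \<pi> B t" "passes f \<pi> B t I"
  shows "noisy_dist \<rho> N (region N \<pi> B I) f \<le> 6 * \<tau>"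
    and "(\<Sum>T\<in>Pow N. of_bool (\<not> T \<subseteq> region N \<pi> B I) * weight N f T) \<le> 3 * \<tau>"
proof -
  have "\<bar>estimate M f (region N \<pi> B I) t - noisy_dist \<rho> N (region N \<pi> B I) f\<bar> \<le> \<tau>"
    using assms by (auto simp: accurate_def passes_def)
  then show le: "noisy_dist \<rho> N (region N \<pi> B I) f \<le> 6 * \<tau>"
    using assms by (simp add: passes_def abs_le_iff)
  then show "(\<Sum>T\<in>Pow N. of_bool (\<not> T \<subseteq> region N \<pi> B I) * weight N f T) \<le> 3 * \<tau>"
    using weight_outside_le_noisy_dist[where \<rho> = \<rho> and N = N and U = "region N \<pi> B I" and f = f] \<rho>01 by simp
qed

definition learned where
  "learned J \<pi> B I = (let J1 = J \<inter> region N \<pi> B I in (\<lambda>a. average_outside N J1 f (lift \<pi> B J1 a)))"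

definition good where
  "good J = (\<lambda>(\<pi>, B, t, u). \<pi> ` N \<subseteq> {..<s} \<and> inj_on \<pi> J \<and> accurate f \<pi> B t \<and>
    ((\<exists>I. passes f \<pi> B t I) \<longrightarrow>
      learned_dist N f \<pi> B u (chosen f \<pi> B t) (learned J \<pi> B (chosen f \<pi> B t)) \<le> 3320 * \<tau>))"

lemma prob_good:
  assumes J: "J \<subseteq> N" "20 * (real (card J))\<^sup>2 \<le> s"
    and wJ: "(\<Sum>T\<in>Pow N. of_bool (\<not> T \<subseteq> J) * weight N f T) \<le> 4 * \<tau>"
  shows "measure_pmf.prob seeds {\<omega>. \<not> good J \<omega>} \<le> 1 / 5"
proof -
  let ?g = "average_outside N J f"
  define Q where "Q \<pi> B = bexp (1/2) {..<s} (\<lambda>u. (f (point N \<pi> B u) - ?g (point N \<pi> B u))\<^sup>2)" for \<pi> B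
  let ?E1 = "{(\<pi>, B :: 'a set, t :: nat \<Rightarrow> 'a set \<times> 'a set \<times> 'a set, u :: nat set). \<not> inj_on \<pi> J}"
  let ?E2 = "{(\<pi>, B, t :: nat \<Rightarrow> 'a set \<times> 'a set \<times> 'a set, u :: nat set). Q \<pi> B > 80 * \<tau>}"
  let ?E3 = "{(\<pi>, B, t, u :: nat set). \<not> accurate f \<pi> B t}"
  let ?E4 = "{(\<pi>, B, t, u). inj_on \<pi> J \<and> Q \<pi> B \<le> 80 * \<tau> \<and> accurate f \<pi> B t \<and> (\<exists>I. passes f \<pi> B t I) \<and>
      learned_dist N f \<pi> B u (chosen f \<pi> B t) (learned J \<pi> B (chosen f \<pi> B t)) > 3320 * \<tau>}"
  have E1: "measure_pmf.prob seeds ?E1 \<le> 1 / 20"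
  proof (rule prob_seeds_partition)
    have "measure_pmf.prob partitions {\<pi>. \<not> inj_on \<pi> J} \<le> (real (card J))\<^sup>2 / s"
      unfolding partitions_def by (rule prob_partition_not_inj[OF fin J(1) s_pos])
    also have "\<dots> \<le> 1 / 20" using J(2) s_pos by (simp add: field_simps)
    finally show "measure_pmf.prob partitions {\<pi>. \<not> inj_on \<pi> J} \<le> 1 / 20" .
  qed simp
  have E2: "measure_pmf.prob seeds ?E2 \<le> 1 / 20"
  proof (rule prob_seeds_base)
    fix \<pi> :: "'a \<Rightarrow> nat"
    have "measure_pmf.expectation (subset_pmf (1/2) N) (Q \<pi>)
        = bexp (1/2) N (\<lambda>B. bexp (1/2) {..<s} (\<lambda>u. (f (point N \<pi> B u) - ?g (point N \<pi> B u))\<^sup>2))"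
      using fin by (simp add: expectation_subset_pmf Q_def[abs_def])
    also have "\<dots> = bexp (1/2) {..<s} (\<lambda>u. bexp (1/2) N (\<lambda>B. (\<lambda>X. (f X - ?g X)\<^sup>2) (point N \<pi> B u)))"
      by (subst bexp_swap) simp
    also have "\<dots> = bexp (1/2) N (\<lambda>X. (f X - ?g X)\<^sup>2)"
      by (subst bexp_point_shift[OF fin, where F = "\<lambda>X. (f X - ?g X)\<^sup>2"]) simp
    also have "\<dots> \<le> 4 * \<tau>" using wJ average_outside_dist_self[OF fin J(1), of f] by simp
    finally have "measure_pmf.expectation (subset_pmf (1/2) N) (Q \<pi>) / (80 * \<tau>) \<le> 1 / 20"
      using \<tau> by (simp add: field_simps)
    moreover have "measure_pmf.prob (subset_pmf (1/2) N) {B. Q \<pi> B > 80 * \<tau>}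
       \<le> measure_pmf.expectation (subset_pmf (1/2) N) (Q \<pi>) / (80 * \<tau>)"
      using \<tau> fin by (intro markov_pmf finite_set_subset_pmf) (auto simp: Q_def intro!: bexp_nonneg)
    ultimately show "measure_pmf.prob (subset_pmf (1/2) N) {B. Q \<pi> B > 80 * \<tau>} \<le> 1 / 20" by linarith
  qed simp
  have E4: "measure_pmf.prob seeds ?E4 \<le> 1 / 20"
  proof (rule prob_seeds_assignment)
    fix \<pi> :: "'a \<Rightarrow> nat" and B :: "'a set" and t
    assume \<pi>: "\<pi> \<in> set_pmf partitions"
    let ?I = "chosen f \<pi> B t" and ?U = "subset_pmf (1/2) {..<s}"
    let ?D = "\<lambda>u. learned_dist N f \<pi> B u ?I (learned J \<pi> B ?I)"
    show "measure_pmf.prob ?U {u. inj_on \<pi> J \<and> Q \<pi> B \<le> 80 * \<tau> \<and> accurate f \<pi> B t \<and>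
        (\<exists>I. passes f \<pi> B t I) \<and> ?D u > 3320 * \<tau>} \<le> 1 / 20"
    proof (cases "inj_on \<pi> J \<and> Q \<pi> B \<le> 80 * \<tau> \<and> accurate f \<pi> B t \<and> (\<exists>I. passes f \<pi> B t I)")
      case True
      then have pass: "passes f \<pi> B t ?I" using chosen_passes by blast
      then have I: "?I \<in> codes s k" by (simp add: passes_def)
      have "measure_pmf.expectation ?U ?D = bexp (1/2) {..<s} ?D"
        by (simp add: expectation_subset_pmf)
      also have "\<dots> \<le> 2 * Q \<pi> B + 2 * (\<Sum>T\<in>Pow N. of_bool (\<not> T \<subseteq> region N \<pi> B ?I) * weight N f T)"
        unfolding learned_def Let_def Q_def
        using J(1) partitions_range[OF \<pi>] True
        by (intro bexp_learned_dist[OF fin _ codesD(2)[OF I] _ codesD(4)[OF I]]) auto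
      also have "\<dots> \<le> 166 * \<tau>" using True passes_weight(2)[OF _ pass] by auto
      finally have "measure_pmf.expectation ?U ?D / (3320 * \<tau>) \<le> 1 / 20"
        using \<tau> by (simp add: field_simps)
      moreover have "measure_pmf.prob ?U {u. ?D u > 3320 * \<tau>} \<le> measure_pmf.expectation ?U ?D / (3320 * \<tau>)"
        using \<tau> by (intro markov_pmf finite_set_subset_pmf learned_dist_nonneg) auto
      moreover have "measure_pmf.prob ?U {u. inj_on \<pi> J \<and> Q \<pi> B \<le> 80 * \<tau> \<and> accurate f \<pi> B t \<and>
        (\<exists>I. passes f \<pi> B t I) \<and> ?D u > 3320 * \<tau>} \<le> measure_pmf.prob ?U {u. ?D u > 3320 * \<tau>}"
        by (intro measure_pmf.finite_measure_mono) auto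
      ultimately show ?thesis by linarith
    next
      case False
      then have "{u. inj_on \<pi> J \<and> Q \<pi> B \<le> 80 * \<tau> \<and> accurate f \<pi> B t \<and>
        (\<exists>I. passes f \<pi> B t I) \<and> ?D u > 3320 * \<tau>} = {}" by blast
      then show ?thesis by (simp only: measure_empty)
    qed
  qed simp
  have "measure_pmf.prob seeds {\<omega>. \<not> good J \<omega>} \<le> measure_pmf.prob seeds (?E1 \<union> (?E2 \<union> (?E3 \<union> ?E4)))"
  proof (rule prob_mono_support)
    fix \<omega> assume "\<omega> \<in> set_pmf seeds" and bad: "\<omega> \<in> {\<omega>. \<not> good J \<omega>}"
    obtain \<pi> B t u where \<omega>: "\<omega> = (\<pi>, B, t, u)" by (cases \<omega>) auto
    have "\<pi> ` N \<subseteq> {..<s}"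
      using \<open>\<omega> \<in> set_pmf seeds\<close> partitions_range by (simp add: seeds_def \<omega>)
    then show "\<omega> \<in> ?E1 \<union> (?E2 \<union> (?E3 \<union> ?E4))"
      using bad by (auto simp: good_def \<omega> not_le)
  qed
  also have "\<dots> \<le> measure_pmf.prob seeds ?E1 + measure_pmf.prob seeds (?E2 \<union> (?E3 \<union> ?E4))"
    by (rule measure_Un_le) auto
  also have "\<dots> \<le> measure_pmf.prob seeds ?E1 + (measure_pmf.prob seeds ?E2 + measure_pmf.prob seeds (?E3 \<union> ?E4))"
    by (intro add_left_mono measure_Un_le) auto
  also have "\<dots> \<le> measure_pmf.prob seeds ?E1 + (measure_pmf.prob seeds ?E2 +
      (measure_pmf.prob seeds ?E3 + measure_pmf.prob seeds ?E4))"
    by (intro add_left_mono measure_Un_le) auto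
  finally show ?thesis using E1 E2 prob_not_accurate E4 by linarith
qed

lemma k_sq_le: "20 * (real k)\<^sup>2 \<le> s"
proof -
  have "real k \<le> k / \<tau>" using \<tau> by (simp add: le_divide_eq mult_left_le)
  then have "(real k)\<^sup>2 \<le> (k / \<tau>)\<^sup>2" by (intro power_mono) auto
  also have "\<dots> \<le> (k / \<tau>) ^ 8" using kt by (intro power_increasing) auto
  finally have "(real k)\<^sup>2 \<le> (k / \<tau>) ^ 8" .
  moreover have "0 \<le> (k / \<tau>) ^ 8" using kt by simp
  ultimately show ?thesis using s_large by linarith
qed

lemma completeness:
  assumes f: "submodular_function N f" and J: "J \<subseteq> N" "card J \<le> k"
    and wJ: "(\<Sum>T\<in>Pow N. of_bool (\<not> T \<subseteq> J) * weight N f T) \<le> \<tau>"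
  shows "measure_pmf.prob seeds {\<omega>. \<not> accept f \<omega>} \<le> 1 / 5"
proof -
  have "(real (card J))\<^sup>2 \<le> (real k)\<^sup>2" using J by (intro power_mono) auto
  then have J2: "20 * (real (card J))\<^sup>2 \<le> s" using k_sq_le by linarith
  have "accept f \<omega>" if "good J \<omega>" for \<omega>
  proof -
    obtain \<pi> B t u where \<omega>: "\<omega> = (\<pi>, B, t, u)" by (cases \<omega>) auto
    have g: "\<pi> ` N \<subseteq> {..<s}" "inj_on \<pi> J" "accurate f \<pi> B t" using that by (auto simp: good_def \<omega>)
    define I where "I = (\<lambda>j. (\<pi> j, j \<in> B)) ` J"
    have "card I \<le> k"
      using card_image_le[OF finite_subset[OF J(1) fin], of "\<lambda>j. (\<pi> j, j \<in> B)"] J(2) by (simp add: I_def)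
    moreover have "inj_on fst I" using inj_onD[OF g(2)] by (auto simp: I_def inj_on_def)
    moreover have "I \<subseteq> {..<s} \<times> UNIV" using g(1) J(1) by (auto simp: I_def)
    ultimately have I: "I \<in> codes s k" by (simp add: codes_def)
    have JU: "J \<subseteq> region N \<pi> B I" using J(1) by (auto simp: region_def I_def)
    have "noisy_dist \<rho> N (region N \<pi> B I) f \<le> 4 * \<tau>"
      by (rule noisy_dist_junta_le[OF fin JU region_subset J(2) k _ _ \<rho> f_abs wJ]) (use \<tau> k in auto)
    then have "passes f \<pi> B t I"
      using g(3) I by (fastforce simp: passes_def accurate_def abs_le_iff)
    then have ex: "\<exists>I. passes f \<pi> B t I" and ch: "passes f \<pi> B t (chosen f \<pi> B t)"
      using chosen_passes by blast+
    let ?I = "chosen f \<pi> B t"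
    have "?I \<in> codes s k" using ch by (simp add: passes_def)
    then have "submodular_function ?I (learned J \<pi> B ?I)"
      unfolding learned_def Let_def
      using J by (intro submodular_function.learned_function_submodular[OF f] codesD(1)) auto
    moreover have "learned_dist N f \<pi> B u ?I (learned J \<pi> B ?I) \<le> 3320 * \<tau>"
      using that ex by (simp add: good_def \<omega>)
    ultimately show ?thesis using ex by (auto simp: accept_def \<omega>)
  qed
  then have "measure_pmf.prob seeds {\<omega>. \<not> accept f \<omega>} \<le> measure_pmf.prob seeds {\<omega>. \<not> good J \<omega>}"
    by (intro measure_pmf.finite_measure_mono) auto
  also have "\<dots> \<le> 1 / 5" using wJ \<tau> by (intro prob_good J J2) auto
  finally show ?thesis .
qed

lemma soundness:
  assumes far: "\<And>H. submodular_function N H \<Longrightarrow> 26574 * \<tau> < bexp (1/2) N (\<lambda>X. (f X - H X)\<^sup>2)"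
  shows "measure_pmf.prob seeds {\<omega>. accept f \<omega>} \<le> 1 / 5"
proof -
  define L where "L = k / \<tau>"
  define c where "c = 1 / (40 * L ^ 3)"
  define a where "a = damped_influence \<rho> N f"
  define J where "J = {j \<in> N. a j \<ge> c}"
  have L1: "1 \<le> L" using kt by (simp add: L_def)
  then have c: "0 < c" by (simp add: c_def)
  have a0: "0 \<le> a j" for j using \<rho>01 by (simp add: a_def damped_influence_nonneg)
  have "1 / (1 - \<rho>) = L" using \<rho> k \<tau> by (simp add: L_def)
  then have sum_a: "(\<Sum>j\<in>N. a j) \<le> L"
    unfolding a_def using sum_damped_influence_le[of N \<rho> f, OF fin _ _ f_abs] \<rho>01 by simp
  have JN: "J \<subseteq> N" by (auto simp: J_def)
  have finJ: "finite J" by (rule finite_subset[OF JN fin])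
  have "c * card J = (\<Sum>j\<in>J. c)" by simp
  also have "\<dots> \<le> (\<Sum>j\<in>J. a j)" by (intro sum_mono) (auto simp: J_def)
  also have "\<dots> \<le> (\<Sum>j\<in>N. a j)" using JN fin a0 by (intro sum_mono2) auto
  also have "\<dots> \<le> L" by (rule sum_a)
  finally have "real (card J) \<le> 40 * L ^ 4"
    using L1 by (simp add: c_def field_simps power4_eq_xxxx power3_eq_cube)
  then have "(real (card J))\<^sup>2 \<le> (40 * L ^ 4)\<^sup>2" by (intro power_mono) auto
  also have "\<dots> = 1600 * L ^ 8" by (simp add: power_mult_distrib flip: power_mult)
  finally have Js: "20 * (real (card J))\<^sup>2 \<le> s" using s_large by (simp add: L_def)
  show ?thesis
  proof (cases "(\<Sum>T\<in>Pow N. of_bool (\<not> T \<subseteq> J) * weight N f T) \<le> 4 * \<tau>")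
    case True
    have "\<not> good J \<omega>" if acc: "accept f \<omega>" for \<omega>
    proof
      assume gd: "good J \<omega>"
      obtain \<pi> B t u where \<omega>: "\<omega> = (\<pi>, B, t, u)" by (cases \<omega>) auto
      let ?I = "chosen f \<pi> B t"
      obtain h where ex: "\<exists>I. passes f \<pi> B t I" and h: "submodular_function ?I h"
        "learned_dist N f \<pi> B u ?I h \<le> 3320 * \<tau>"
        using acc by (auto simp: accept_def \<omega>)
      have g: "inj_on \<pi> J" "accurate f \<pi> B t"
        "learned_dist N f \<pi> B u ?I (learned J \<pi> B ?I) \<le> 3320 * \<tau>"
        using gd ex by (auto simp: good_def \<omega>)
      have ch: "passes f \<pi> B t ?I" using ex chosen_passes by blast
      then have I: "?I \<in> codes s k" by (simp add: passes_def)
      obtain H where "submodular_function N H"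
        "bexp (1/2) N (\<lambda>X. (f X - H X)\<^sup>2) \<le> 2 * (4 * \<tau> + 3 * \<tau>) + 8 * (3320 * \<tau>)"
        using close_to_submodular[OF fin codesD(1,4)[OF I] h(1) JN g(1) h(2)
            g(3)[unfolded learned_def Let_def] True passes_weight(2)[OF g(2) ch]] .
      then show False using far[of H] by simp
    qed
    then have "measure_pmf.prob seeds {\<omega>. accept f \<omega>} \<le> measure_pmf.prob seeds {\<omega>. \<not> good J \<omega>}"
      by (intro measure_pmf.finite_measure_mono) auto
    also have "\<dots> \<le> 1 / 5" by (intro prob_good JN Js True)
    finally show ?thesis .
  next
    case False
    define heavy where "heavy \<pi> \<longleftrightarrow> (\<exists>i<s. (\<Sum>j\<in>{j\<in>N - J. \<pi> j = i}. a j) > 1 / L)" for \<pi>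
    let ?E1 = "{(\<pi>, B :: 'a set, t :: nat \<Rightarrow> 'a set \<times> 'a set \<times> 'a set, u :: nat set). heavy \<pi>}"
    let ?E2 = "{(\<pi>, B, t, u :: nat set). \<not> accurate f \<pi> B t}"
    have E1: "measure_pmf.prob seeds ?E1 \<le> 1 / 20"
    proof (rule prob_seeds_partition)
      have "(\<Sum>j\<in>N - J. a j) \<le> L"
        using sum_mono2[of N "N - J" a] fin a0 sum_a by auto
      then have "measure_pmf.prob partitions {\<pi>. heavy \<pi>} \<le> (c * L + L\<^sup>2 / s) / (1 / L)\<^sup>2"
        unfolding partitions_def heavy_def
        using fin s_pos L1 a0 c by (intro prob_heavy_part) (auto simp: J_def)
      also have "\<dots> = 1 / 40 + L ^ 4 / s"
        using L1 s_pos by (simp add: c_def field_simps power4_eq_xxxx power3_eq_cube power2_eq_square)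
      also have "L ^ 4 / s \<le> 1 / 40"
      proof -
        have "L ^ 4 \<le> L ^ 8" using L1 by (intro power_increasing) auto
        then have "40 * L ^ 4 \<le> s" using s_large zero_le_power[of L 8] L1 by (simp add: L_def)
        then show ?thesis using s_pos by (simp add: field_simps)
      qed
      finally show "measure_pmf.prob partitions {\<pi>. heavy \<pi>} \<le> 1 / 20" by simp
    qed simp
    have "heavy \<pi> \<or> \<not> accurate f \<pi> B t" if accepted: "accept f (\<pi>, B, t, u)" "\<pi> ` N \<subseteq> {..<s}" for \<pi> B t u
    proof (rule ccontr)
      assume "\<not> ?thesis"
      then have nh: "\<not> heavy \<pi>" and acc: "accurate f \<pi> B t" by auto
      obtain I where I: "passes f \<pi> B t I" using accepted by (auto simp: accept_def)
      then have Ic: "I \<in> codes s k" by (simp add: passes_def)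
      let ?U = "region N \<pi> B I"
      have "(\<Sum>j\<in>?U - J. a j) \<le> (\<Sum>j\<in>(\<Union>i\<in>fst ` I. {j\<in>N - J. \<pi> j = i}). a j)"
      proof (rule sum_mono2)
        show "?U - J \<subseteq> (\<Union>i\<in>fst ` I. {j\<in>N - J. \<pi> j = i})"
          by (force simp: region_def)
        show "finite (\<Union>i\<in>fst ` I. {j\<in>N - J. \<pi> j = i})"
          using codesD(1)[OF Ic] fin by auto
      qed (use a0 in auto)
      also have "\<dots> = (\<Sum>i\<in>fst ` I. \<Sum>j\<in>{j\<in>N - J. \<pi> j = i}. a j)"
        using codesD(1)[OF Ic] fin by (intro sum.UNION_disjoint) auto
      also have "\<dots> \<le> (\<Sum>i\<in>fst ` I. 1 / L)"
      proof (rule sum_mono)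
        fix i assume "i \<in> fst ` I"
        then have "i < s" using codesD(2)[OF Ic] by blast
        then have "\<not> 1 / L < (\<Sum>j\<in>{j\<in>N - J. \<pi> j = i}. a j)"
          using nh unfolding heavy_def by blast
        then show "(\<Sum>j\<in>{j\<in>N - J. \<pi> j = i}. a j) \<le> 1 / L" by simp
      qed
      also have "\<dots> \<le> k * (1 / L)"
        using codesD(5)[OF Ic] L1 by (simp add: divide_right_mono)
      also have "\<dots> = \<tau>" using k \<tau> by (simp add: L_def)
      finally have "(\<Sum>T\<in>Pow N. of_bool (\<not> T \<subseteq> J) * weight N f T) \<le> 4 * \<tau>"
        using weight_outside_junta_le[OF fin region_subset, of \<rho> J f \<pi> B I] \<rho>01
          passes_weight(1)[OF acc I] by (simp add: a_def)
      then show False using False by simp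
    qed
    note reject = this
    have "measure_pmf.prob seeds {\<omega>. accept f \<omega>} \<le> measure_pmf.prob seeds (?E1 \<union> ?E2)"
    proof (rule prob_mono_support)
      fix \<omega> assume \<omega>: "\<omega> \<in> set_pmf seeds" "\<omega> \<in> {\<omega>. accept f \<omega>}"
      obtain \<pi> B t u where eq: "\<omega> = (\<pi>, B, t, u)" by (cases \<omega>) auto
      have "\<pi> ` N \<subseteq> {..<s}" using \<omega>(1) partitions_range by (simp add: seeds_def eq)
      then show "\<omega> \<in> ?E1 \<union> ?E2" using reject[of \<pi> B t u] \<omega>(2) by (simp add: eq)
    qed
    also have "\<dots> \<le> measure_pmf.prob seeds ?E1 + measure_pmf.prob seeds ?E2"
      by (rule measure_Un_le) auto
    finally show ?thesis using E1 prob_not_accurate by simp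
  qed
qed

end

definition query_set where
  "query_set = (\<lambda>(\<pi>, B, t, u).
     (\<lambda>i. fst (snd (t i))) ` {..<M} \<union>
     (\<lambda>(I, i). rerandomize (region N \<pi> B I) (t i)) ` (codes s k \<times> {..<M}) \<union>
     (\<lambda>(I, a). point N \<pi> B (overwrite u I a)) ` Sigma (codes s k) Pow)"

lemma finite_query_set: "finite (query_set \<omega>)"
  using finite_codes codesD(1) by (auto simp: query_set_def split: prod.split)

lemma card_query_set:
  "card (query_set \<omega>) \<le> M + card (codes s k) * M + card (codes s k) * 2 ^ k"
proof -
  obtain \<pi> B t u where \<omega>: "\<omega> = (\<pi>, B, t, u)" by (cases \<omega>) auto
  let ?A = "(\<lambda>i. fst (snd (t i))) ` {..<M}"
  let ?B = "(\<lambda>(I, i). rerandomize (region N \<pi> B I) (t i)) ` (codes s k \<times> {..<M})"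
  let ?C = "(\<lambda>(I, a). point N \<pi> B (overwrite u I a)) ` Sigma (codes s k) Pow"
  have "card ?A \<le> M" using card_image_le[of "{..<M}"] by simp
  moreover have "card ?B \<le> card (codes s k) * M"
    using card_image_le[of "codes s k \<times> {..<M}"] finite_codes by (simp add: card_cartesian_product)
  moreover have "card ?C \<le> card (codes s k) * 2 ^ k"
  proof -
    have fS: "finite (Sigma (codes s k) Pow)" using finite_codes codesD(1) by auto
    have "card ?C \<le> card (Sigma (codes s k) Pow)" by (rule card_image_le[OF fS])
    also have "\<dots> = (\<Sum>I\<in>codes s k. card (Pow I))"
      using finite_codes codesD(1) by (intro card_SigmaI) auto
    also have "\<dots> \<le> (\<Sum>I\<in>codes s k. 2 ^ k)"
      using codesD by (intro sum_mono) (simp add: card_Pow)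
    finally show ?thesis by simp
  qed
  moreover have "card (query_set \<omega>) \<le> card ?A + card ?B + card ?C"
    unfolding query_set_def \<omega> prod.case
    using card_Un_le[of "?A \<union> ?B" ?C] card_Un_le[of ?A ?B] by linarith
  ultimately show ?thesis by linarith
qed

lemma accept_cong:
  assumes "\<And>X. X \<in> query_set \<omega> \<Longrightarrow> f X = g X"
  shows "accept f \<omega> = accept g \<omega>"
proof -
  obtain \<pi> B t u where \<omega>: "\<omega> = (\<pi>, B, t, u)" by (cases \<omega>) auto
  have "estimate M f (region N \<pi> B I) t = estimate M g (region N \<pi> B I) t" if "I \<in> codes s k" for I
    unfolding estimate_def using that
    by (intro arg_cong2[where f = "(/)"] sum.cong refl arg_cong[where f = "\<lambda>x. x\<^sup>2"] arg_cong2[where f = "(-)"] assms)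
       (auto simp: query_set_def \<omega>)
  then have p: "passes f \<pi> B t I = passes g \<pi> B t I" for I
    by (auto simp: passes_def)
  then have c: "chosen f \<pi> B t = chosen g \<pi> B t" by (simp add: chosen_def)
  have l: "learned_dist N f \<pi> B u (chosen g \<pi> B t) h = learned_dist N g \<pi> B u (chosen g \<pi> B t) h"
    if "passes g \<pi> B t I" for h I
  proof -
    have "chosen g \<pi> B t \<in> codes s k" using chosen_passes[OF that] by (simp add: passes_def)
    then have "point N \<pi> B (overwrite u (chosen g \<pi> B t) a) \<in> query_set \<omega>"
      if "a \<subseteq> chosen g \<pi> B t" for a
      using that by (force simp: query_set_def \<omega>)
    then show ?thesis unfolding learned_dist_def by (intro bexp_cong) (simp add: assms)
  qed
  show ?thesis unfolding accept_def \<omega> prod.case p c using l by auto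
qed

end

section \<open>From set functions to query algorithms\<close>

lemma query_alg_of_predicate:
  assumes "finite Q" "\<And>f g. (\<forall>x\<in>Q. f x = g x) \<Longrightarrow> D f = D g"
  shows "\<exists>t. queries t \<subseteq> Q \<and> (\<forall>f. accepts f t = D f) \<and> (\<forall>f. num_queries f t \<le> card Q)"
  using assms
proof (induction Q arbitrary: D rule: finite_induct)
  case empty
  then have "D f = D (\<lambda>_. 0)" for f by simp
  then show ?case by (intro exI[of _ "Answer (D (\<lambda>_. 0))"]) auto
next
  case (insert x Q)
  have "\<exists>t. queries t \<subseteq> Q \<and> (\<forall>f. accepts f t = D (f(x := v))) \<and> (\<forall>f. num_queries f t \<le> card Q)" for v
  proof (rule insert.IH)
    fix f g :: "'a \<Rightarrow> real" assume "\<forall>y\<in>Q. f y = g y"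
    then show "D (f(x := v)) = D (g(x := v))" by (intro insert.prems) auto
  qed
  then obtain k where k: "queries (k v) \<subseteq> Q" "accepts f (k v) = D (f(x := v))" "num_queries f (k v) \<le> card Q"
    for v f by metis
  show ?case
    using insert.hyps k by (intro exI[of _ "Query x k"]) (auto simp: fun_upd_idem)
qed

definition cube_point :: "nat \<Rightarrow> nat set \<Rightarrow> nat \<Rightarrow> bool" where
  "cube_point n X = restrict (\<lambda>j. j \<in> X) {..<n}"

definition support :: "nat \<Rightarrow> (nat \<Rightarrow> bool) \<Rightarrow> nat set" where
  "support n x = {j. j < n \<and> x j}"

lemma cube_point_in_cube: "cube_point n X \<in> cube n"
  by (simp add: cube_point_def cube_def)

lemma support_cube_point: "X \<subseteq> {..<n} \<Longrightarrow> support n (cube_point n X) = X"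
  by (auto simp: support_def cube_point_def)

lemma support_subset: "support n x \<subseteq> {..<n}"
  by (auto simp: support_def)

lemma cube_point_support: "x \<in> cube n \<Longrightarrow> cube_point n (support n x) = x"
  by (rule ext) (auto simp: support_def cube_point_def cube_def PiE_def extensional_def)

lemma cube_point_lattice:
  "inf (cube_point n X) (cube_point n Y) = cube_point n (X \<inter> Y)"
  "sup (cube_point n X) (cube_point n Y) = cube_point n (X \<union> Y)"
  by (auto simp: cube_point_def fun_eq_iff restrict_def)

lemma support_lattice:
  "support n (inf x y) = support n x \<inter> support n y"
  "support n (sup x y) = support n x \<union> support n y"
  by (auto simp: support_def)

lemma bij_cube_point: "bij_betw (cube_point n) (Pow {..<n}) (cube n)"
  by (rule bij_betwI[where g = "support n"])
     (simp_all add: Pi_iff cube_point_in_cube support_cube_point cube_point_support support_subset)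

lemma cube_in_cube:
  assumes "x \<in> cube n" "y \<in> cube n"
  shows "inf x y \<in> cube n" "sup x y \<in> cube n"
  using cube_point_lattice[of n "support n x" "support n y"] assms cube_point_in_cube
  by (metis cube_point_support)+

lemma finite_cube: "finite (cube n)" and cube_nonempty: "cube n \<noteq> {}" and card_cube: "card (cube n) = 2 ^ n"
proof -
  show "finite (cube n)" using bij_betw_finite[OF bij_cube_point[of n]] by simp
  show "cube n \<noteq> {}" using cube_point_in_cube by blast
  show "card (cube n) = 2 ^ n" using bij_betw_same_card[OF bij_cube_point[of n]] by (simp add: card_Pow)
qed

lemma expectation_cube:
  "measure_pmf.expectation (pmf_of_set (cube n)) G = bexp (1/2) {..<n} (\<lambda>X. G (cube_point n X))"
proof -
  have "measure_pmf.expectation (pmf_of_set (cube n)) G = (\<Sum>x\<in>cube n. G x) / card (cube n)"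
    by (rule integral_pmf_of_set[OF cube_nonempty finite_cube])
  also have "(\<Sum>x\<in>cube n. G x) = (\<Sum>X\<in>Pow {..<n}. G (cube_point n X))"
    by (rule sum.reindex_bij_betw[OF bij_cube_point, symmetric])
  finally show ?thesis by (simp add: bexp_half card_cube)
qed

lemma bounded_functions_cube_point:
  "f \<in> bounded_functions n \<Longrightarrow> 0 \<le> f (cube_point n X) \<and> f (cube_point n X) \<le> 1"
  using cube_point_in_cube[of n X] by (auto simp: bounded_functions_def PiE_iff)

lemma submodular_function_cube_point:
  assumes "f \<in> submodularity n"
  shows "submodular_function {..<n} (\<lambda>X. f (cube_point n X))"
proof
  have f: "f \<in> bounded_functions n" using assms by (simp add: submodularity_def)
  fix X Y
  show "0 \<le> f (cube_point n X)" "f (cube_point n X) \<le> 1"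
    using bounded_functions_cube_point[OF f] by auto
  show "f (cube_point n (X \<inter> Y)) + f (cube_point n (X \<union> Y)) \<le> f (cube_point n X) + f (cube_point n Y)"
    using assms cube_point_in_cube by (simp add: submodularity_def flip: cube_point_lattice)
qed simp

lemma submodularityI:
  assumes "submodular_function {..<n} H"
  shows "restrict (\<lambda>x. H (support n x)) (cube n) \<in> submodularity n"
  using submodular_function.nonneg[OF assms support_subset]
    submodular_function.le_one[OF assms support_subset]
    submodular_function.submod[OF assms support_subset support_subset]
  by (auto simp: submodularity_def bounded_functions_def cube_in_cube support_lattice)

lemma far_square_dist:
  assumes p: "p \<ge> 1" and \<epsilon>: "\<epsilon> > 0" and f: "f \<in> bounded_functions n"
    and far: "lp_dist_to n p f (submodularity n) \<ge> \<epsilon>"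
    and H: "submodular_function {..<n} H"
  shows "\<epsilon> powr max 2 p \<le> bexp (1/2) {..<n} (\<lambda>X. (f (cube_point n X) - H X)\<^sup>2)"
proof -
  define g where "g = restrict (\<lambda>x. H (support n x)) (cube n)"
  have g: "g \<in> submodularity n" unfolding g_def by (rule submodularityI[OF H])
  let ?d = "\<lambda>X. \<bar>f (cube_point n X) - H X\<bar>"
  let ?S = "bexp (1/2) {..<n} (\<lambda>X. (f (cube_point n X) - H X)\<^sup>2)"
  define A where "A = bexp (1/2) {..<n} (\<lambda>X. ?d X powr p)"
  have A0: "0 \<le> A" unfolding A_def by (intro bexp_nonneg) auto
  have "bdd_below ((\<lambda>g. lp_dist n p f g) ` submodularity n)"
    by (intro bdd_belowI[of _ 0]) (auto simp: lp_dist_def)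
  then have "lp_dist_to n p f (submodularity n) \<le> lp_dist n p f g"
    unfolding lp_dist_to_def by (rule cINF_lower[OF _ g])
  then have "\<epsilon> \<le> lp_dist n p f g" using far by linarith
  also have "lp_dist n p f g = A powr (1 / p)"
    unfolding lp_dist_def expectation_cube A_def
    by (intro arg_cong2[where f = "(powr)"] bexp_cong)
       (simp_all add: g_def cube_point_in_cube support_cube_point)
  finally have "\<epsilon> powr p \<le> (A powr (1 / p)) powr p"
    using \<epsilon> p by (intro powr_mono2) auto
  also have "\<dots> = A" using p A0 by (simp add: powr_powr)
  finally have A: "\<epsilon> powr p \<le> A" .
  have d1: "?d X \<le> 1" if "X \<subseteq> {..<n}" for X
    using bounded_functions_cube_point[OF f, of X] submodular_function.nonneg[OF H that]
      submodular_function.le_one[OF H that] by (auto simp: abs_le_iff)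
  show ?thesis
  proof (cases "p \<ge> 2")
    case True
    have "A \<le> ?S"
      unfolding A_def
    proof (rule bexp_mono)
      fix X assume X: "X \<subseteq> {..<n}"
      have "?d X powr p \<le> ?d X powr 2"
        using True d1[OF X] by (intro powr_mono') auto
      then show "?d X powr p \<le> (f (cube_point n X) - H X)\<^sup>2"
        by (cases "?d X = 0") (auto simp: powr_numeral)
    qed auto
    then show ?thesis using A True by (simp add: max_def)
  next
    case False
    define c where "c = \<epsilon> powr (p - 2)"
    have c0: "0 < c" using \<epsilon> by (simp add: c_def)
    have c\<epsilon>: "\<epsilon>\<^sup>2 * c = \<epsilon> powr p"
      using \<epsilon> by (simp add: c_def powr_diff powr_numeral)
    have "A \<le> bexp (1/2) {..<n} (\<lambda>X. c * (p / 2) * (f (cube_point n X) - H X)\<^sup>2 + (1 - p / 2) * \<epsilon> powr p)"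
      unfolding A_def
    proof (rule bexp_mono)
      fix X
      let ?t = "?d X"
      have "(?t\<^sup>2) powr (p / 2) * (\<epsilon>\<^sup>2) powr (1 - p / 2) \<le> p / 2 * ?t\<^sup>2 + (1 - p / 2) * \<epsilon>\<^sup>2"
      proof (cases "?t = 0")
        case True
        then show ?thesis using False by simp
      next
        case nz: False
        then show ?thesis using p False \<epsilon> by (intro Youngs_inequality_0) auto
      qed
      moreover have "(?t\<^sup>2) powr (p / 2) = ?t powr p"
      proof -
        have eq: "?t\<^sup>2 = ?t powr 2" by (simp add: powr_numeral)
        show ?thesis unfolding eq powr_powr by simp
      qed
      moreover have "(\<epsilon>\<^sup>2) powr (1 - p / 2) = 1 / c"
        using \<epsilon> by (simp add: c_def powr_powr powr_minus_divide[symmetric] flip: powr_numeral)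
      ultimately have "?t powr p / c \<le> p / 2 * ?t\<^sup>2 + (1 - p / 2) * \<epsilon>\<^sup>2" by simp
      then have "?t powr p \<le> c * (p / 2 * ?t\<^sup>2 + (1 - p / 2) * \<epsilon>\<^sup>2)"
        using c0 by (simp add: field_simps)
      also have "\<dots> = c * (p / 2) * ?t\<^sup>2 + (1 - p / 2) * (\<epsilon>\<^sup>2 * c)" by (simp add: algebra_simps)
      finally show "?t powr p \<le> c * (p / 2) * (f (cube_point n X) - H X)\<^sup>2 + (1 - p / 2) * \<epsilon> powr p"
        by (simp add: c\<epsilon>)
    qed auto
    also have "\<dots> = c * (p / 2) * ?S + (1 - p / 2) * \<epsilon> powr p"
      unfolding bexp_add bexp_cmult by simp
    finally have "(p / 2) * \<epsilon> powr p \<le> c * (p / 2) * ?S" using A by (simp add: algebra_simps)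
    then have "(p / 2 * c) * \<epsilon>\<^sup>2 \<le> (p / 2 * c) * ?S" unfolding c\<epsilon>[symmetric] by (simp add: algebra_simps)
    then have "\<epsilon>\<^sup>2 \<le> ?S" using p c0 by (subst (asm) mult_le_cancel_left_pos) auto
    then show ?thesis using False \<epsilon> by (simp add: max_def powr_numeral)
  qed
qed

lemma card_bounded_subsets_le:
  assumes "finite P"
  shows "card {I. I \<subseteq> P \<and> card I \<le> k} \<le> (card P + 1) ^ k"
proof -
  let ?A = "insert None (Some ` P)"
  let ?L = "{l. set l \<subseteq> ?A \<and> length l = k}"
  have finA: "finite ?A" using assms by simp
  have "{I. I \<subseteq> P \<and> card I \<le> k} \<subseteq> (\<lambda>l. {x. Some x \<in> set l}) ` ?L"
  proof
    fix I assume "I \<in> {I. I \<subseteq> P \<and> card I \<le> k}"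
    then have I: "I \<subseteq> P" "card I \<le> k" by auto
    obtain xs where xs: "set xs = I" "distinct xs"
      using finite_distinct_list[OF finite_subset[OF I(1) assms]] by auto
    define l where "l = map Some xs @ replicate (k - card I) None"
    have "length xs = card I" using xs distinct_card by metis
    then have "l \<in> ?L" using I xs by (auto simp: l_def)
    moreover have "I = {x. Some x \<in> set l}" using xs by (auto simp: l_def)
    ultimately show "I \<in> (\<lambda>l. {x. Some x \<in> set l}) ` ?L" by blast
  qed
  then have "card {I. I \<subseteq> P \<and> card I \<le> k} \<le> card ?L"
    by (rule surj_card_le[OF finite_lists_length_eq[OF finA]])
  also have "\<dots> = (card P + 1) ^ k"
    using card_lists_length_eq[OF finA] assms by (simp add: card_image)
  finally show ?thesis .
qed

lemma card_codes_le: "card (codes s k) \<le> (2 * s + 1) ^ k"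
proof -
  let ?P = "{..<s} \<times> (UNIV :: bool set)"
  have "card (codes s k) \<le> card {I. I \<subseteq> ?P \<and> card I \<le> k}"
    by (rule card_mono, rule finite_subset[of _ "Pow ?P"]) (auto simp: codes_def)
  also have "\<dots> \<le> (card ?P + 1) ^ k" by (rule card_bounded_subsets_le) simp
  finally show ?thesis by (simp add: card_cartesian_product mult.commute)
qed

lemma lp_tester_exists:
  assumes "submodularity_test {..<n} s k M \<rho> \<tau>"
    and p: "p \<ge> 1" and \<epsilon>: "\<epsilon> > 0" and \<tau>\<epsilon>: "26574 * \<tau> < \<epsilon> powr max 2 p"
    and junta: "\<And>f. submodular_function {..<n} f \<Longrightarrow>
      \<exists>J \<subseteq> {..<n}. card J \<le> k \<and> (\<Sum>T\<in>Pow {..<n}. of_bool (\<not> T \<subseteq> J) * weight {..<n} f T) \<le> \<tau>"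
    and q: "real (M + card (codes s k) * M + card (codes s k) * 2 ^ k) \<le> q"
  shows "\<exists>T. lp_tester n p \<epsilon> (submodularity n) T \<and> query_complexity_at_most n T q"
proof -
  interpret submodularity_test "{..<n}" s k M \<rho> \<tau> by fact
  let ?F = "\<lambda>f X. f (cube_point n X)"
  have "\<exists>t. queries t \<subseteq> cube_point n ` query_set \<omega> \<and> (\<forall>f. accepts f t = accept (?F f) \<omega>) \<and>
      (\<forall>f. num_queries f t \<le> card (cube_point n ` query_set \<omega>))" for \<omega>
    by (rule query_alg_of_predicate) (auto simp: finite_query_set intro!: accept_cong)
  then obtain alg where alg: "queries (alg \<omega>) \<subseteq> cube_point n ` query_set \<omega>"
    "accepts f (alg \<omega>) = accept (?F f) \<omega>"
    "num_queries f (alg \<omega>) \<le> card (cube_point n ` query_set \<omega>)" for \<omega> f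
    by metis
  define T where "T = map_pmf alg seeds"
  have "lp_tester n p \<epsilon> (submodularity n) T"
    unfolding lp_tester_def
  proof (intro conjI ballI impI)
    fix t assume "t \<in> set_pmf T"
    then show "queries t \<subseteq> cube n" using alg(1) cube_point_in_cube by (fastforce simp: T_def)
  next
    fix f assume f: "f \<in> submodularity n"
    have sub: "submodular_function {..<n} (?F f)" by (rule submodular_function_cube_point[OF f])
    obtain J where J: "J \<subseteq> {..<n}" "card J \<le> k"
      "(\<Sum>T\<in>Pow {..<n}. of_bool (\<not> T \<subseteq> J) * weight {..<n} (?F f) T) \<le> \<tau>"
      using junta[OF sub] by blast
    have "measure_pmf.prob seeds {\<omega>. \<not> accept (?F f) \<omega>} \<le> 1 / 5"
      using submodular_function.nonneg[OF sub] submodular_function.le_one[OF sub]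
      by (intro completeness[OF _ sub J]) auto
    moreover have "measure_pmf.prob seeds {\<omega>. accept (?F f) \<omega>}
        = 1 - measure_pmf.prob seeds {\<omega>. \<not> accept (?F f) \<omega>}"
      using measure_pmf.prob_compl[of "{\<omega>. \<not> accept (?F f) \<omega>}" seeds] by (simp add: Compl_eq_Diff_UNIV[symmetric] Collect_neg_eq)
    ultimately show "2 / 3 \<le> measure_pmf.prob T {t. accepts f t}"
      by (simp add: T_def alg(2) vimage_def)
  next
    fix f assume f: "f \<in> bounded_functions n" and far: "\<epsilon> \<le> lp_dist_to n p f (submodularity n)"
    have "measure_pmf.prob seeds {\<omega>. accept (?F f) \<omega>} \<le> 1 / 5"
    proof (rule soundness)
      fix H assume H: "submodular_function {..<n} H"
      show "26574 * \<tau> < bexp (1/2) {..<n} (\<lambda>X. (f (cube_point n X) - H X)\<^sup>2)"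
        using far_square_dist[OF p \<epsilon> f far H] \<tau>\<epsilon> by linarith
    qed (use bounded_functions_cube_point[OF f] in auto)
    moreover have "measure_pmf.prob seeds {\<omega>. \<not> accept (?F f) \<omega>}
        = 1 - measure_pmf.prob seeds {\<omega>. accept (?F f) \<omega>}"
      using measure_pmf.prob_compl[of "{\<omega>. accept (?F f) \<omega>}" seeds] by (simp add: Compl_eq_Diff_UNIV[symmetric] Collect_neg_eq)
    ultimately show "2 / 3 \<le> measure_pmf.prob T {t. \<not> accepts f t}"
      by (simp add: T_def alg(2) vimage_def)
  qed
  moreover have "query_complexity_at_most n T q"
    unfolding query_complexity_at_most_def
  proof (intro ballI)
    fix f t assume "t \<in> set_pmf T"
    then obtain \<omega> where t: "t = alg \<omega>" by (auto simp: T_def)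
    have "num_queries f t \<le> card (query_set \<omega>)"
      unfolding t using alg(3) card_image_le[OF finite_query_set] by (rule order_trans)
    also have "\<dots> \<le> M + card (codes s k) * M + card (codes s k) * 2 ^ k" by (rule card_query_set)
    finally show "real (num_queries f t) \<le> q" using q by linarith
  qed
  ultimately show ?thesis by blast
qed

lemma one_le_ln_add_two:
  fixes m :: real
  assumes "m \<ge> 1"
  shows "1 \<le> ln (2 + m)"
proof -
  have "exp 1 \<le> 2 + m" using exp_le assms by linarith
  then show ?thesis using assms by (subst ln_ge_iff) auto
qed

lemma parameters_exist:
  fixes m :: real
  assumes m: "m \<ge> 1"
  defines "\<tau> \<equiv> 1 / (30000 * m)"
  obtains r k :: nat where "r \<ge> 1" "\<tau> / 2 + 2 * real r * (1/2) ^ r \<le> \<tau>" "8 * real r / (\<tau> / 2) \<le> k"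
    "1 / \<tau> \<le> k" "64000 \<le> k" "k \<le> 2 ^ 25 * m * ln (2 + m)"
proof -
  define L where "L = ln (2 + m)"
  have L1: "1 \<le> L" unfolding L_def by (rule one_le_ln_add_two[OF m])
  define q where "q = nat \<lceil>log 2 (240000 * m)\<rceil>"
  have lgm: "log 2 m \<le> 2 * L"
  proof -
    have "ln m \<le> L" using m by (simp add: L_def)
    moreover have "0 \<le> ln m" using m by simp
    moreover have "ln m / ln 2 \<le> ln m / (1/2)"
      using ln2_ge_two_thirds m by (intro divide_left_mono) auto
    ultimately show ?thesis by (simp add: log_def)
  qed
  have "log 2 (240000 * m) \<le> log 2 (2 ^ 18 * m)" using m by (subst log_le_cancel_iff) auto
  also have "\<dots> = log 2 (2 ^ 18) + log 2 m" using m by (intro log_mult_pos) auto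
  also have "\<dots> = 18 + log 2 m" using log_pow_cancel[of "2::real" 18] by linarith
  finally have lg: "log 2 (240000 * m) \<le> 18 + 2 * L" using lgm by linarith
  have lg0: "0 \<le> log 2 (240000 * m)" using m by simp
  have q_le: "real q \<le> 21 * L"
    using lg lg0 L1 unfolding q_def by linarith
  have q_ge: "log 2 (240000 * m) \<le> q" unfolding q_def by linarith
  then have pow: "240000 * m \<le> 2 ^ q"
    using m by (simp add: log_le_iff powr_realpow)
  have q1: "q \<ge> 1"
  proof (rule ccontr)
    assume "\<not> ?thesis"
    then have "q = 0" by simp
    then show False using pow m by simp
  qed
  define r where "r = 2 * q"
  define k where "k = nat \<lceil>480000 * m * r\<rceil>"
  have k_ge: "480000 * m * r \<le> k" unfolding k_def by linarith
  have r2: "2 \<le> real r" using q1 by (simp add: r_def)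
  have "480000 * m * 2 \<le> 480000 * m * r" using m r2 by (intro mult_left_mono) auto
  then have kbig: "960000 * m \<le> k" using k_ge by linarith
  have "real q \<le> 2 ^ q" using of_nat_less_two_power[of q, where 'a = real] by simp
  then have "real q * (1/2) ^ q \<le> 1" by (simp add: field_simps)
  have "(1/2 :: real) ^ r = (1/2) ^ q * (1/2) ^ q"
    unfolding r_def mult_2 by (rule power_add)
  then have "2 * real r * (1/2) ^ r = 4 * (real q * (1/2) ^ q) * (1/2) ^ q"
    by (simp add: r_def)
  also have "\<dots> \<le> 4 * 1 * (1 / (240000 * m))"
  proof (intro mult_mono)
    show "(1/2) ^ q \<le> 1 / (240000 * m)"
      unfolding power_one_over using pow m by (intro divide_left_mono) auto
  qed (use \<open>real q * (1/2) ^ q \<le> 1\<close> in auto)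
  also have "\<dots> = \<tau> / 2" using m by (simp add: \<tau>_def)
  finally have "\<tau> / 2 + 2 * real r * (1/2) ^ r \<le> \<tau>" by simp
  moreover have "8 * real r / (\<tau> / 2) \<le> k" using k_ge m by (simp add: \<tau>_def mult_ac)
  moreover have "1 / \<tau> \<le> k" "64000 \<le> k" using kbig m by (simp_all add: \<tau>_def)
  moreover have "k \<le> 2 ^ 25 * m * ln (2 + m)"
  proof -
    have "real k \<le> 480000 * m * r + 1" unfolding k_def using m by simp
    also have "480000 * m * r \<le> 480000 * m * (42 * L)"
      using q_le m by (intro mult_left_mono) (auto simp: r_def)
    also have "480000 * m * (42 * L) + 1 \<le> 480000 * m * (42 * L) + m * L"
      using mult_mono[of 1 m 1 L] m L1 by (simp add: mult.commute)
    also have "\<dots> = 20160001 * (m * L)" by simp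
    also have "\<dots> \<le> 2 ^ 25 * (m * L)" using m L1 by (intro mult_right_mono) auto
    finally show ?thesis by (simp add: L_def mult.assoc)
  qed
  moreover have "r \<ge> 1" using q1 by (simp add: r_def)
  ultimately show ?thesis using that by blast
qed

lemma power_le_soft_O_bound:
  fixes m :: real and k :: nat
  assumes m: "m \<ge> 1" and k: "1 \<le> k" "k \<le> 2 ^ 25 * m * ln (2 + m)"
  shows "real k ^ (38 * k) \<le> 2 powr soft_O_bound (38 * 29 * 2 ^ 25) 2 m"
proof -
  define L where "L = ln (2 + m)"
  have L1: "1 \<le> L" unfolding L_def by (rule one_le_ln_add_two[OF m])
  have k': "k \<le> 2 ^ 25 * m * L" using k by (simp add: L_def)
  have "L \<le> 2 + m" unfolding L_def using ln_le_minus_one[of "2 + m"] m by simp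
  then have "m * L \<le> (2 + m) * (2 + m)" using m L1 by (intro mult_mono) auto
  then have "real k \<le> 2 ^ 25 * (2 + m)\<^sup>2" using k' by (simp add: power2_eq_square)
  then have "log 2 k \<le> log 2 (2 ^ 25 * (2 + m)\<^sup>2)"
    using k m by (subst log_le_cancel_iff) (auto intro!: mult_pos_pos)
  also have "\<dots> = log 2 (2 ^ 25) + log 2 ((2 + m)\<^sup>2)" using m by (intro log_mult_pos) auto
  also have "\<dots> = 25 + 2 * log 2 (2 + m)"
    using m log_pow_cancel[of "2::real" 25] log_nat_power[of "2 + m" 2 2] by linarith
  also have "log 2 (2 + m) \<le> 2 * L"
  proof -
    have "L / ln 2 \<le> L / (1/2)" using ln2_ge_two_thirds L1 by (intro divide_left_mono) auto
    then show ?thesis by (simp add: log_def L_def)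
  qed
  finally have lgk: "log 2 k \<le> 29 * L" using L1 by linarith
  have "real k ^ (38 * k) = (2 powr log 2 k) ^ (38 * k)" using k by simp
  also have "\<dots> = 2 powr (log 2 k * (38 * k))" by (simp add: powr_powr flip: powr_realpow)
  also have "\<dots> \<le> 2 powr ((29 * L) * (38 * (2 ^ 25 * m * L)))"
    using lgk k k' L1 by (intro powr_mono mult_mono) (simp_all add: mult_ac)
  also have "(29 * L) * (38 * (2 ^ 25 * m * L)) = soft_O_bound (38 * 29 * 2 ^ 25) 2 m"
    by (simp add: soft_O_bound_def L_def power2_eq_square)
  finally show ?thesis .
qed

lemma query_count_le:
  fixes k c M :: nat
  assumes k: "64000 \<le> k" and c: "1 \<le> c" "c \<le> (2 * (32000 * k ^ 16) + 1) ^ k" and M: "M = 40 * c * k\<^sup>2"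
  shows "M + c * M + c * 2 ^ k \<le> k ^ (38 * k)"
proof -
  have "2 * (32000 * k ^ 16) + 1 \<le> 64000 * k ^ 16 + k ^ 16" using k by simp
  also have "\<dots> = 64001 * k ^ 16" by simp
  also have "\<dots> \<le> (k * k) * k ^ 16"
  proof (rule mult_right_mono)
    have "64000 * 64000 \<le> k * k" using k by (intro mult_mono) auto
    then show "64001 \<le> k * k" by simp
  qed simp
  also have "\<dots> = k ^ 18"
  proof -
    have "k ^ 18 = k ^ (2 + 16)" by simp
    then show ?thesis by (simp only: power_add power2_eq_square)
  qed
  finally have "(2 * (32000 * k ^ 16) + 1) ^ k \<le> (k ^ 18) ^ k" by (intro power_mono) auto
  then have c': "c \<le> k ^ (18 * k)" using c by (simp add: power_mult)
  have kk: "80 * k\<^sup>2 \<le> k ^ k"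
  proof -
    have "80 * k\<^sup>2 \<le> k * k\<^sup>2" using k by (intro mult_right_mono) auto
    also have "\<dots> = k ^ 3" by (simp add: power3_eq_cube power2_eq_square)
    also have "\<dots> \<le> k ^ k" using k by (intro power_increasing) auto
    finally show ?thesis .
  qed
  have "M \<le> c * M" using c by simp
  then have "M + c * M + c * 2 ^ k \<le> 2 * c * M + c * 2 ^ k" by simp
  also have "\<dots> = c * c * (80 * k\<^sup>2) + c * 2 ^ k" by (simp add: M)
  also have "\<dots> \<le> c * c * (k ^ k) + c * c * k ^ k"
  proof (intro add_mono mult_left_mono mult_mono kk)
    show "c \<le> c * c" using c by simp
    show "2 ^ k \<le> k ^ k" using k by (intro power_mono) auto
  qed auto
  also have "\<dots> = c * c * (2 * k ^ k)" by simp
  also have "\<dots> \<le> (k ^ (18 * k) * k ^ (18 * k)) * (k ^ k * k ^ k)"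
  proof (intro mult_mono c')
    have "k ^ 1 \<le> k ^ k" using k by (intro power_increasing) auto
    then have "k \<le> k ^ k" by (simp only: power_one_right)
    then show "2 \<le> k ^ k" using k by linarith
  qed auto
  also have "\<dots> = k ^ (38 * k)" by (simp flip: power_add)
  finally show ?thesis .
qed

lemma lp_tester_accept_all:
  assumes p: "p \<ge> 1" and \<epsilon>: "\<epsilon> > 1" and q: "q \<ge> 0"
  shows "\<exists>T. lp_tester n p \<epsilon> (submodularity n) T \<and> query_complexity_at_most n T q"
proof (intro exI conjI)
  have "\<not> \<epsilon> \<le> lp_dist_to n p f (submodularity n)" if f: "f \<in> bounded_functions n" for f
  proof
    assume far: "\<epsilon> \<le> lp_dist_to n p f (submodularity n)"
    have "submodular_function {..<n} (\<lambda>_. 0)" by unfold_locales auto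
    then have "\<epsilon> powr max 2 p \<le> bexp (1/2) {..<n} (\<lambda>X. (f (cube_point n X) - 0)\<^sup>2)"
      using \<epsilon> by (intro far_square_dist[OF p _ f far]) auto
    also have "\<dots> \<le> bexp (1/2) {..<n} (\<lambda>_. 1)"
      using bounded_functions_cube_point[OF f] by (intro bexp_mono) (auto simp: abs_square_le_1)
    finally have "\<epsilon> powr max 2 p \<le> 1" by simp
    moreover have "1 < \<epsilon> powr max 2 p" using \<epsilon> by (simp add: less_max_iff_disj)
    ultimately show False by simp
  qed
  then show "lp_tester n p \<epsilon> (submodularity n) (return_pmf (Answer True))"
    by (auto simp: lp_tester_def measure_return_pmf)
  show "query_complexity_at_most n (return_pmf (Answer True)) q"
    using q by (simp add: query_complexity_at_most_def)
qed

theorem theorem1: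
  "\<exists>(C::real) (K::nat). C > 0 \<and>
     (\<forall>(p::real) (\<epsilon>::real) (n::nat). p \<ge> 1 \<longrightarrow> \<epsilon> > 0 \<longrightarrow> n \<ge> 1 \<longrightarrow>
        (\<exists>T. lp_tester n p \<epsilon> (submodularity n) T \<and>
             query_complexity_at_most n T
               (2 powr soft_O_bound C K (1 / \<epsilon> powr max 2 p))))"
proof (intro exI[of _ "38 * 29 * 2 ^ 25 :: real"] exI[of _ "2 :: nat"] conjI allI impI)
  fix p \<epsilon> :: real and n :: nat
  assume p: "p \<ge> 1" and \<epsilon>: "\<epsilon> > 0"
  define m where "m = 1 / \<epsilon> powr max 2 p"
  show "\<exists>T. lp_tester n p \<epsilon> (submodularity n) T \<and>
      query_complexity_at_most n T (2 powr soft_O_bound (38 * 29 * 2 ^ 25) 2 (1 / \<epsilon> powr max 2 p))"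
  proof (cases "\<epsilon> > 1")
    case True
    then show ?thesis using p by (intro lp_tester_accept_all) auto
  next
    case False
    have m: "m \<ge> 1" using False \<epsilon> by (simp add: m_def powr_le1)
    define \<tau> where "\<tau> = 1 / (30000 * m)"
    have \<tau>: "0 < \<tau>" "\<tau> < 1" using m by (auto simp: \<tau>_def)
    obtain r k :: nat where rk: "r \<ge> 1" "\<tau> / 2 + 2 * real r * (1/2) ^ r \<le> \<tau>"
      "8 * real r / (\<tau> / 2) \<le> k" "1 / \<tau> \<le> k" "64000 \<le> k" "k \<le> 2 ^ 25 * m * ln (2 + m)"
      using parameters_exist[OF m] unfolding \<tau>_def by blast
    define s where "s = 32000 * k ^ 16"
    define c where "c = card (codes s k)"
    define M where "M = 40 * c * k\<^sup>2"
    have "{} \<in> codes s k" by (simp add: codes_def)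
    then have c1: "1 \<le> c" unfolding c_def using finite_codes by (simp add: card_gt_0_iff Suc_le_eq) blast
    have k1: "1 \<le> real k" using rk(5) by simp
    show ?thesis
    proof (rule lp_tester_exists)
      show "submodularity_test {..<n} s k M (1 - \<tau> / k) \<tau>"
      proof
        have "k / \<tau> = k * (1 / \<tau>)" by simp
        also have "\<dots> \<le> real k * real k" using rk(4) by (intro mult_left_mono) auto
        finally have "(k / \<tau>) ^ 8 \<le> (real k * k) ^ 8" using \<tau> by (intro power_mono) auto
        also have "\<dots> = real k ^ 16" by (simp add: power_mult_distrib flip: power_add)
        finally show "32000 * (k / \<tau>) ^ 8 \<le> s" by (simp add: s_def)
        have "1 \<le> (k * \<tau>)\<^sup>2" using rk(4) \<tau> by (intro one_le_power) (simp add: field_simps)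
        then have "40 * real c * 1 \<le> 40 * real c * (k * \<tau>)\<^sup>2" by (intro mult_left_mono) auto
        also have "\<dots> \<le> 2 * M * \<tau>\<^sup>2" by (simp add: M_def power_mult_distrib)
        also have "\<dots> \<le> exp (2 * M * \<tau>\<^sup>2)" using exp_ge_add_one_self[of "2 * M * \<tau>\<^sup>2"] by linarith
        finally have "40 * real c \<le> exp (2 * M * \<tau>\<^sup>2)" by simp
        then show "40 * card (codes s k) * exp (- 2 * M * \<tau>\<^sup>2) \<le> 1"
          by (simp add: c_def exp_minus field_simps)
      qed (use \<tau> rk(5) c1 in \<open>auto simp: M_def\<close>)
      show "26574 * \<tau> < \<epsilon> powr max 2 p"
      proof -
        have "\<epsilon> powr max 2 p = 30000 * \<tau>" using \<epsilon> by (simp add: \<tau>_def m_def)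
        then show ?thesis using \<tau> by simp
      qed
      show "\<exists>J\<subseteq>{..<n}. card J \<le> k \<and>
          (\<Sum>T\<in>Pow {..<n}. of_bool (\<not> T \<subseteq> J) * weight {..<n} f T) \<le> \<tau>"
        if sub: "submodular_function {..<n} f" for f
      proof -
        obtain J where "J \<subseteq> {..<n}" "real (card J) \<le> 8 * real r / (\<tau> / 2)"
          "(\<Sum>T\<in>Pow {..<n}. of_bool (\<not> T \<subseteq> J) * weight {..<n} f T) \<le> \<tau> / 2 + 2 * real r * (1/2) ^ r"
          using submodular_function.junta_approximation[OF sub rk(1), of "\<tau> / 2"] \<tau> by auto
        then show ?thesis using rk(2,3) by (intro exI[of _ J]) linarith
      qed
      have "M + c * M + c * 2 ^ k \<le> k ^ (38 * k)"
        using rk(5) c1 card_codes_le[of s k] by (intro query_count_le) (simp_all add: M_def c_def s_def)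
      then have "real (M + c * M + c * 2 ^ k) \<le> real k ^ (38 * k)"
        unfolding of_nat_power[symmetric] of_nat_le_iff .
      also have "\<dots> \<le> 2 powr soft_O_bound (38 * 29 * 2 ^ 25) 2 m"
        using power_le_soft_O_bound[OF m _ rk(6)] rk(5) by simp
      finally show "real (M + card (codes s k) * M + card (codes s k) * 2 ^ k)
          \<le> 2 powr soft_O_bound (38 * 29 * 2 ^ 25) 2 (1 / \<epsilon> powr max 2 p)"
        by (simp add: c_def m_def)
    qed (use p \<epsilon> in auto)
  qed
qed simp

end
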